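(* Let $\lambda>0$ and $f\in L^2(X,\nu)$. For every $v_0\in L^2(X,\nu)$ there exists a unique strong solution, in $(0,T)$ for any $T>0$, of the Cauchy problem $$\begin{cases} v_t\in\Delta_1^m v(t)-\lambda(v(t)-f) & \text{in }(0,T)\times X,\\ v(0,x)=v_0(x) & \text{for } x\in X.\end{cases}\qquad (CP_f)$$ Moreover, the following contraction and maximum principles hold in any $L^q(X,\nu)$-space, $1\le q\le\infty$: $$\|(v(t)-w(t))^+\|_q\le\|(v_0-w_0)^+\|_q\quad\forall\,0<t<T,$$ for any pair of solutions $v,w$ of, respectively, $(CP_f)$ with initial datum $v_0$ and $(CP_{\hat f})$ with initial datum $w_0$, where $f,\hat f\in L^2(X,\nu)$ satisfy $f\le\hat f$.
   Context: Setting: $(X,d)$ is a Polish metric space with its Borel $\sigma$-algebra. A random walk $m=(m_x)_{x\in X}$ on $X$ is a family of Borel probability measures on $X$ such that $x\mapsto m_x(A)$ is Borel for every Borel $A\subset X$ and $\int_X d(z,y)\,dm_x(y)<\infty$ for all $x\in X$ and some (hence any) $z\in X$; $[X,d,m]$ is a metric random walk space. $\nu$ is a finite (nonzero) Radon measure on $X$ which is reversible for $m$: $dm_x(y)d\nu(x)=dm_y(x)d\nu(y)$ as measures on $X\times X$ (this implies invariance, $\nu(A)=\int_X m_x(A)\,d\nu(x)$). It is also assumed that $\frac1{\nu(X)}\nu$ is ergodic with respect to $m$: every Borel set $B$ with $m_x(B)=1$ for all $x\in B$ satisfies $\nu(B)=0$ or $\nu(B)=\nu(X)$. $m$-total variation: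 $TV_m(u)=\frac12\int_X\int_X|u(y)-u(x)|\,dm_x(y)\,d\nu(x)$. $\mathcal F_m:L^2(X,\nu)\to\,]-\infty,+\infty]$, $\mathcal F_m(u)=TV_m(u)$, is convex and lower semicontinuous; $\partial\mathcal F_m$ is its subdifferential in $L^2(X,\nu)$. The multivalued operator $\Delta_1^m$ in $L^2(X,\nu)$ is defined by: $v\in\Delta_1^m(u)$ iff $-v\in\partial\mathcal F_m(u)$. A (strong) solution of $(CP_f)$ in $(0,T)$ is a function $v\in C([0,T];L^2(X,\nu))\cap W^{1,1}_{loc}(0,T;L^2(X,\nu))$ such that $v(0,x)=v_0(x)$ for $\nu$-a.e. $x\in X$ and $\lambda(v(t)-f)+v_t(t)\in\Delta_1^m(v(t))$ for almost every $t\in(0,T)$. Here $r^+=\max\{r,0\}$ and $\|\cdot\|_q$ is the norm of $L^q(X,\nu)$ (possibly $+\infty$). *)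

theory Defs
  imports "HOL-Analysis.Analysis" "HOL-Probability.Essential_Supremum"
begin

section \<open>Metric random walk spaces\<close>

text \<open>The class \<open>polish_space\<close> consists of complete separable metric spaces,
  so a type \<open>'a\<close> of this class is a Polish metric space with metric \<^const>\<open>dist\<close>.\<close>

definition random_walk :: "('a::polish_space \<Rightarrow> 'a measure) \<Rightarrow> bool" where
  "random_walk m \<longleftrightarrow>
     (\<forall>x. sets (m x) = sets borel \<and> emeasure (m x) UNIV = 1) \<and>
     (\<forall>A\<in>sets borel. (\<lambda>x. emeasure (m x) A) \<in> borel_measurable borel) \<and>
     (\<exists>z. \<forall>x. (\<integral>\<^sup>+y. ennreal (dist z y) \<partial>m x) < \<infinity>)"

text \<open>On a Polish space the inner regularity clause follows from the other two
  (theorem \<open>inner_regular\<close>); it is kept because it is what ``Radon'' means.\<close>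

definition finite_radon_measure :: "'a::polish_space measure \<Rightarrow> bool" where
  "finite_radon_measure \<nu> \<longleftrightarrow>
     sets \<nu> = sets borel \<and> emeasure \<nu> UNIV \<noteq> \<infinity> \<and>
     (\<forall>B\<in>sets borel. emeasure \<nu> B = (SUP K\<in>{K. K \<subseteq> B \<and> compact K}. emeasure \<nu> K))"

text \<open>Equality, on every Borel set \<open>C\<close> of the product, of the measures
  \<open>dm\<^sub>x(y) d\<nu>(x)\<close> and \<open>dm\<^sub>y(x) d\<nu>(y)\<close>.\<close>

definition reversible :: "('a::polish_space \<Rightarrow> 'a measure) \<Rightarrow> 'a measure \<Rightarrow> bool" where
  "reversible m \<nu> \<longleftrightarrow>
     (\<forall>C::('a \<times> 'a) set. C \<in> sets borel \<longrightarrow>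
        (\<integral>\<^sup>+x. emeasure (m x) {y. (x, y) \<in> C} \<partial>\<nu>) =
        (\<integral>\<^sup>+y. emeasure (m y) {x. (x, y) \<in> C} \<partial>\<nu>))"

definition ergodic :: "('a::polish_space \<Rightarrow> 'a measure) \<Rightarrow> 'a measure \<Rightarrow> bool" where
  "ergodic m \<nu> \<longleftrightarrow>
     (\<forall>B\<in>sets borel. (\<forall>x\<in>B. emeasure (m x) B = 1) \<longrightarrow>
        emeasure \<nu> B = 0 \<or> emeasure \<nu> B = emeasure \<nu> UNIV)"


section \<open>Lebesgue spaces\<close>

text \<open>Elements of \<open>L\<^sup>q(X,\<nu>)\<close> are represented by measurable functions; equality in
  \<open>L\<^sup>q(X,\<nu>)\<close> is equality \<open>\<nu>\<close>-almost everywhere.\<close>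

definition L2 :: "'a measure \<Rightarrow> ('a \<Rightarrow> real) set" where
  "L2 \<nu> = {u \<in> borel_measurable \<nu>. integrable \<nu> (\<lambda>x. (u x)\<^sup>2)}"

definition L2_inner :: "'a measure \<Rightarrow> ('a \<Rightarrow> real) \<Rightarrow> ('a \<Rightarrow> real) \<Rightarrow> real" where
  "L2_inner \<nu> u w = (LINT x|\<nu>. u x * w x)"

text \<open>Real-valued norm, meaningful only on \<^const>\<open>L2\<close> (outside it the integral is 0).\<close>

definition L2_norm :: "'a measure \<Rightarrow> ('a \<Rightarrow> real) \<Rightarrow> real" where
  "L2_norm \<nu> u = sqrt (LINT x|\<nu>. (u x)\<^sup>2)"

text \<open>The norm of \<open>L\<^sup>q(X,\<nu>)\<close> for \<open>1 \<le> q \<le> \<infinity>\<close>, with values in \<open>[0,\<infinity>]\<close>.\<close>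

definition Lq_norm :: "'a measure \<Rightarrow> ennreal \<Rightarrow> ('a \<Rightarrow> real) \<Rightarrow> ennreal" where
  "Lq_norm \<nu> q u =
     (if q = \<infinity> then esssup \<nu> (\<lambda>x. ennreal \<bar>u x\<bar>)
      else let I = \<integral>\<^sup>+x. ennreal (\<bar>u x\<bar> powr enn2real q) \<partial>\<nu>
           in if I = \<infinity> then \<infinity> else ennreal (enn2real I powr (1 / enn2real q)))"


section \<open>Total variation and the 1-Laplacian\<close>

definition TV :: "('a \<Rightarrow> 'a measure) \<Rightarrow> 'a measure \<Rightarrow> ('a \<Rightarrow> real) \<Rightarrow> ennreal" where
  "TV m \<nu> u = (\<integral>\<^sup>+x. \<integral>\<^sup>+y. ennreal \<bar>u y - u x\<bar> \<partial>m x \<partial>\<nu>) / 2"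

definition subdifferential ::
  "'a measure \<Rightarrow> (('a \<Rightarrow> real) \<Rightarrow> ereal) \<Rightarrow> ('a \<Rightarrow> real) \<Rightarrow> ('a \<Rightarrow> real) set" where
  "subdifferential \<nu> \<Phi> u =
     {g \<in> L2 \<nu>. u \<in> L2 \<nu> \<and> \<Phi> u < \<infinity> \<and>
        (\<forall>w\<in>L2 \<nu>. \<Phi> w \<ge> \<Phi> u + ereal (L2_inner \<nu> g (\<lambda>x. w x - u x)))}"

definition one_laplacian ::
  "('a \<Rightarrow> 'a measure) \<Rightarrow> 'a measure \<Rightarrow> ('a \<Rightarrow> real) \<Rightarrow> ('a \<Rightarrow> real) set" where
  "one_laplacian m \<nu> u =
     {v. (\<lambda>x. - v x) \<in> subdifferential \<nu> (\<lambda>w. enn2ereal (TV m \<nu> w)) u}"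


section \<open>Functions of time with values in the space \<open>L\<^sup>2(X,\<nu>)\<close>\<close>

definition L2_continuous_on :: "'a measure \<Rightarrow> real set \<Rightarrow> (real \<Rightarrow> 'a \<Rightarrow> real) \<Rightarrow> bool" where
  "L2_continuous_on \<nu> S u \<longleftrightarrow>
     (\<forall>t\<in>S. u t \<in> L2 \<nu> \<and>
        ((\<lambda>s. L2_norm \<nu> (\<lambda>x. u s x - u t x)) \<longlongrightarrow> 0) (at t within S))"

text \<open>The Bochner integral of \<open>L\<^sup>2(X,\<nu>)\<close>-valued functions. The library's
  \<^const>\<open>has_bochner_integral\<close> needs the values to form a Banach space \<^emph>\<open>type\<close>, so its
  definition by simple functions is repeated here with \<^const>\<open>L2_norm\<close> in place of
  \<^const>\<open>norm\<close>. The approximating sequence together with the measurability of the distances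
  also expresses that \<open>u\<close> is strongly measurable.\<close>

definition L2_simple :: "'a measure \<Rightarrow> real measure \<Rightarrow> (real \<Rightarrow> 'a \<Rightarrow> real) \<Rightarrow> bool" where
  "L2_simple \<nu> M s \<longleftrightarrow>
     simple_function M s \<and> (\<forall>t\<in>space M. s t \<in> L2 \<nu>) \<and>
     emeasure M {t\<in>space M. s t \<noteq> (\<lambda>_. 0)} \<noteq> \<infinity>"

definition L2_simple_integral ::
  "real measure \<Rightarrow> (real \<Rightarrow> 'a \<Rightarrow> real) \<Rightarrow> 'a \<Rightarrow> real" where
  "L2_simple_integral M s =
     (\<lambda>x. \<Sum>h\<in>s ` space M. measure M {t\<in>space M. s t = h} * h x)"

definition L2_has_bochner_integral ::
  "'a measure \<Rightarrow> real measure \<Rightarrow> (real \<Rightarrow> 'a \<Rightarrow> real) \<Rightarrow> ('a \<Rightarrow> real) \<Rightarrow> bool" where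
  "L2_has_bochner_integral \<nu> M u G \<longleftrightarrow>
     (AE t in M. u t \<in> L2 \<nu>) \<and> G \<in> L2 \<nu> \<and>
     (\<exists>s::nat \<Rightarrow> real \<Rightarrow> 'a \<Rightarrow> real.
        (\<forall>n. L2_simple \<nu> M (s n)) \<and>
        (\<forall>n. (\<lambda>t. L2_norm \<nu> (\<lambda>x. u t x - s n t x)) \<in> borel_measurable M) \<and>
        (\<lambda>n. \<integral>\<^sup>+t. ennreal (L2_norm \<nu> (\<lambda>x. u t x - s n t x)) \<partial>M) \<longlonglongrightarrow> 0 \<and>
        (\<lambda>n. L2_norm \<nu> (\<lambda>x. L2_simple_integral M (s n) x - G x)) \<longlonglongrightarrow> 0)"

definition L1loc_L2 :: "'a measure \<Rightarrow> real \<Rightarrow> (real \<Rightarrow> 'a \<Rightarrow> real) \<Rightarrow> bool" where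
  "L1loc_L2 \<nu> T u \<longleftrightarrow>
     (\<forall>a b. 0 < a \<longrightarrow> a < b \<longrightarrow> b < T \<longrightarrow>
        (\<exists>G. L2_has_bochner_integral \<nu> (lebesgue_on {a..b}) u G))"

text \<open>\<open>C\<^sub>c\<^sup>\<infinity>(0,T)\<close>\<close>

definition test_functions :: "real \<Rightarrow> (real \<Rightarrow> real) set" where
  "test_functions T =
     {\<phi>. (\<forall>n t. (deriv ^^ n) \<phi> differentiable (at t)) \<and>
          (\<exists>a b. 0 < a \<and> a < b \<and> b < T \<and> (\<forall>t. t \<notin> {a..b} \<longrightarrow> \<phi> t = 0))}"

text \<open>\<open>u \<in> W\<^sup>1\<^sup>,\<^sup>1\<^sub>l\<^sub>o\<^sub>c(0,T;L\<^sup>2(X,\<nu>))\<close> with distributional derivative \<open>u'\<close>, that is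
  \<open>\<integral> \<phi>'(t) u(t) dt = - \<integral> \<phi>(t) u'(t) dt\<close> for all test functions \<open>\<phi>\<close>.\<close>

definition W11loc_deriv ::
  "'a measure \<Rightarrow> real \<Rightarrow> (real \<Rightarrow> 'a \<Rightarrow> real) \<Rightarrow> (real \<Rightarrow> 'a \<Rightarrow> real) \<Rightarrow> bool" where
  "W11loc_deriv \<nu> T u u' \<longleftrightarrow>
     L1loc_L2 \<nu> T u \<and> L1loc_L2 \<nu> T u' \<and>
     (\<forall>\<phi>\<in>test_functions T. \<exists>G.
        L2_has_bochner_integral \<nu> (lebesgue_on {0<..<T}) (\<lambda>t x. deriv \<phi> t * u t x) G \<and>
        L2_has_bochner_integral \<nu> (lebesgue_on {0<..<T}) (\<lambda>t x. \<phi> t * u' t x) (\<lambda>x. - G x))"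


section \<open>Strong solutions of the Cauchy problem\<close>

definition strong_solution ::
  "('a \<Rightarrow> 'a measure) \<Rightarrow> 'a measure \<Rightarrow> real \<Rightarrow> ('a \<Rightarrow> real) \<Rightarrow> ('a \<Rightarrow> real) \<Rightarrow> real \<Rightarrow>
   (real \<Rightarrow> 'a \<Rightarrow> real) \<Rightarrow> bool" where
  "strong_solution m \<nu> lam f v\<^sub>0 T v \<longleftrightarrow>
     L2_continuous_on \<nu> {0..T} v \<and>
     (AE x in \<nu>. v 0 x = v\<^sub>0 x) \<and>
     (\<exists>v'. W11loc_deriv \<nu> T v v' \<and>
        (AE t in lebesgue_on {0<..<T}.
           (\<lambda>x. lam * (v t x - f x) + v' t x) \<in> one_laplacian m \<nu> (v t)))"

end

theory Submission
  imports Defs "HOL-Library.Function_Algebras" "HOL-Computational_Algebra.Polynomial"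
    "HOL-Probability.Giry_Monad"
begin

text \<open>Reversibility implies that \<open>TV\<close> is finite and Lipschitz on \<open>L\<^sup>2\<close>: a finite measure \<open>\<nu>\<close> that is
reversible is invariant, so \<open>TV u\<close> is at most the integral of \<open>\<bar>u\<bar>\<close>. Moreover, an explicit
subgradient exists everywhere, namely the average of \<open>sgn (u x - u y)\<close> over \<open>y\<close> with law \<open>m x\<close>.
Therefore all subgradients are bounded in \<open>L\<^sup>2\<close> by one constant, the domain of the
subdifferential is the whole space, and the theory of gradient flows of convex functions
simplifies considerably.

\<^bold>\<open>Existence.\<close> The equation is the gradient flow of \<open>\<Phi> u = TV u + (lam / 2) \<bar>u - f\<bar>\<^sup>2\<close>. As
subgradients are bounded, the explicit Euler scheme converges: by monotonicity, halving the step
changes the iterates by a quantity whose square is of the order of the step (\<open>euler_half\<close>).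
The limit satisfies an evolution variational inequality (\<open>flow_evi\<close>), which says that its
difference quotients are, up to sign, \<open>\<epsilon>\<close>-subgradients of \<open>\<Phi>\<close>. Their norms do not exceed the norm of
the minimal subgradient, and by the parallelogram law this forces strong convergence
(\<open>flow_right_derivative\<close>). The flow is thus Lipschitz and has a right derivative at every time,
which solves the inclusion. A Lipschitz function with a right derivative everywhere has that derivative as its
weak derivative: in the pairing with a test function one moves a difference quotient from one factor to
the other, and passes to the limit by dominated convergence (\<open>W11loc_deriv_right_derivative\<close>).

\<^bold>\<open>Contraction.\<close> The subdifferential of \<open>TV\<close> is completely accretive: if \<open>b\<close> is nondecreasing and
1-Lipschitz, then moving \<open>v\<close> down and \<open>w\<close> up by \<open>b (v - w)\<close> does not increase \<open>TV v + TV w\<close>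
(\<open>TV_exchange\<close>), hence \<open>p - q\<close> pairs nonnegatively with \<open>b (v - w)\<close> for subgradients \<open>p\<close>, \<open>q\<close> at
\<open>v\<close>, \<open>w\<close> (\<open>subdifferential_accretive\<close>). Consequently the integral of \<open>j (v t - w t)\<close>, where \<open>j' = b\<close>, does
not increase for the Huber functions \<open>j\<close>; suitably scaled they approximate \<open>r \<mapsto> (r - k)\<^sup>+\<close>, so every excess integral of
\<open>(v t - w t - k)\<^sup>+\<close> with \<open>k \<ge> 0\<close> is nonincreasing (\<open>excess_nonincreasing\<close>). These integrals control all
norms at once, because \<open>r\<^sup>q\<close> is a superposition of the functions \<open>(r - k)\<^sup>+\<close>
(\<open>Lq_norm_mono_excess\<close>). Uniqueness is the case of equal data.\<close>

section \<open>Semi-inner product spaces\<close>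

text \<open>The elements of \<open>L\<^sup>2\<close> are functions here, not classes of functions, so the inner product is
only positive semidefinite and vectors are equal only up to norm zero. The form is defined on a
whole vector space rather than on a subspace, which spares all side conditions on membership.\<close>

locale semi_inner =
  fixes ip :: "'v::real_vector \<Rightarrow> 'v \<Rightarrow> real"
  assumes ip_sym: "ip x y = ip y x"
    and ip_add_left: "ip (x + y) z = ip x z + ip y z"
    and ip_scale_left: "ip (a *\<^sub>R x) y = a * ip x y"
    and ip_nonneg: "0 \<le> ip x x"
begin

definition nrm :: "'v \<Rightarrow> real" where
  "nrm x = sqrt (ip x x)"

lemma ip_add_right: "ip z (x + y) = ip z x + ip z y"
  by (metis ip_sym ip_add_left)

lemma ip_scale_right: "ip x (a *\<^sub>R y) = a * ip x y"
  by (metis ip_sym ip_scale_left)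

lemma ip_minus_left: "ip (- x) y = - ip x y"
  using ip_scale_left[of "-1" x y] by simp

lemma ip_minus_right: "ip x (- y) = - ip x y"
  using ip_scale_right[of x "-1" y] by simp

lemma ip_diff_left: "ip (x - y) z = ip x z - ip y z"
  using ip_add_left[of x "- y" z] by (simp add: ip_minus_left)

lemma ip_diff_right: "ip z (x - y) = ip z x - ip z y"
  using ip_add_right[of z x "- y"] by (simp add: ip_minus_right)

lemma ip_zero_left: "ip 0 x = 0"
  using ip_scale_left[of 0 0 x] by simp

lemma ip_zero_right: "ip x 0 = 0"
  using ip_sym ip_zero_left by metis

lemmas ip_linear = ip_add_left ip_add_right ip_scale_left ip_scale_right
  ip_minus_left ip_minus_right ip_diff_left ip_diff_right ip_zero_left ip_zero_right

lemma nrm_nonneg [simp]: "0 \<le> nrm x"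
  by (simp add: nrm_def ip_nonneg)

lemma nrm_power2: "(nrm x)\<^sup>2 = ip x x"
  by (simp add: nrm_def ip_nonneg)

lemma nrm_zero [simp]: "nrm 0 = 0"
  by (simp add: nrm_def ip_zero_left)

lemma nrm_scale: "nrm (a *\<^sub>R x) = \<bar>a\<bar> * nrm x"
  by (simp add: nrm_def ip_linear real_sqrt_mult flip: mult.assoc power2_eq_square)

lemma nrm_minus [simp]: "nrm (- x) = nrm x"
  by (simp add: nrm_def ip_linear)

lemma nrm_diff_commute: "nrm (x - y) = nrm (y - x)"
  using nrm_minus[of "x - y"] by simp

lemma cauchy_schwarz: "\<bar>ip x y\<bar> \<le> nrm x * nrm y"
proof -
  have *: "2 * s * ip x y \<le> s\<^sup>2 * (nrm x)\<^sup>2 + (nrm y)\<^sup>2" for s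
    using ip_nonneg[of "s *\<^sub>R x - y"] ip_sym[of y x]
    unfolding nrm_power2 by (simp add: ip_linear power2_eq_square algebra_simps)
  have "(ip x y)\<^sup>2 \<le> (nrm x)\<^sup>2 * (nrm y)\<^sup>2"
  proof (cases "(nrm x)\<^sup>2 = 0")
    case True
    have "ip x y = 0"
    proof (rule ccontr)
      assume ne: "ip x y \<noteq> 0"
      \<comment> \<open>As \<open>x\<close> has norm 0, this choice makes the left-hand side of \<open>*\<close> exceed the right-hand side.\<close>
      define s where "s = ((nrm y)\<^sup>2 + 1) / (2 * ip x y)"
      have "2 * s * ip x y = (nrm y)\<^sup>2 + 1" using ne by (simp add: s_def)
      then show False using *[of s] True by simp
    qed
    then show ?thesis by simp
  next
    case False
    then have pos: "(nrm x)\<^sup>2 > 0" by (simp add: zero_less_power2)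
    define N s where "N = (nrm x)\<^sup>2" and "s = ip x y / N"
    have s: "s * N = ip x y" using pos by (simp add: s_def N_def)
    have "N * (2 * s * ip x y) \<le> N * (s\<^sup>2 * N + (nrm y)\<^sup>2)"
      using *[of s] pos unfolding N_def by (intro mult_left_mono) auto
    also have "\<dots> = (s * N)\<^sup>2 + N * (nrm y)\<^sup>2" by (simp add: power2_eq_square algebra_simps)
    finally have "2 * (s * N) * ip x y \<le> (s * N)\<^sup>2 + N * (nrm y)\<^sup>2" by (simp add: mult_ac)
    then show ?thesis unfolding s by (simp add: N_def power2_eq_square)
  qed
  then show ?thesis
    by (metis abs_le_square_iff abs_mult abs_of_nonneg nrm_nonneg power_mult_distrib)
qed

lemma ip_le_nrm: "ip x y \<le> nrm x * nrm y"
  using cauchy_schwarz[of x y] by linarith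

lemma nrm_triangle: "nrm (x + y) \<le> nrm x + nrm y"
proof (rule power2_le_imp_le)
  show "(nrm (x + y))\<^sup>2 \<le> (nrm x + nrm y)\<^sup>2"
    using ip_le_nrm[of x y] ip_sym[of x y]
    by (simp add: power2_sum nrm_power2 ip_linear)
qed simp

lemma nrm_triangle_diff: "nrm (x - z) \<le> nrm (x - y) + nrm (y - z)"
  using nrm_triangle[of "x - y" "y - z"] by simp

lemma nrm_diff_le: "nrm (x - y) \<le> nrm x + nrm y"
  using nrm_triangle[of x "- y"] by simp

lemma nrm_reverse_triangle: "\<bar>nrm x - nrm y\<bar> \<le> nrm (x - y)"
  using nrm_triangle[of "x - y" y] nrm_triangle[of "y - x" x] nrm_diff_commute[of x y] by simp

lemma nrm_add_power2: "(nrm (x + y))\<^sup>2 = (nrm x)\<^sup>2 + 2 * ip x y + (nrm y)\<^sup>2"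
  using ip_sym[of x y] by (simp add: nrm_power2 ip_linear)

lemma nrm_diff_power2: "(nrm (x - y))\<^sup>2 = (nrm x)\<^sup>2 - 2 * ip x y + (nrm y)\<^sup>2"
  using ip_sym[of x y] by (simp add: nrm_power2 ip_linear)

lemma nrm_power2_shift:
  "(nrm (w - f))\<^sup>2 = (nrm (u - f))\<^sup>2 + 2 * ip (u - f) (w - u) + (nrm (w - u))\<^sup>2"
  using nrm_add_power2[of "u - f" "w - u"] by simp

lemma parallelogram: "(nrm (x - y))\<^sup>2 = 2 * (nrm x)\<^sup>2 + 2 * (nrm y)\<^sup>2 - 4 * (nrm ((1/2) *\<^sub>R (x + y)))\<^sup>2"
  unfolding nrm_power2 ip_scale_left ip_scale_right ip_add_left ip_add_right ip_diff_left ip_diff_right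
  using ip_sym[of x y] by (simp add: algebra_simps)

lemma tendsto_ip:
  assumes "((\<lambda>n. nrm (X n - l)) \<longlongrightarrow> 0) F"
  shows "((\<lambda>n. ip (X n) z) \<longlongrightarrow> ip l z) F"
proof -
  have "((\<lambda>n. nrm (X n - l) * nrm z) \<longlongrightarrow> 0 * nrm z) F"
    by (intro tendsto_intros assms)
  then have "((\<lambda>n. ip (X n) z - ip l z) \<longlongrightarrow> 0) F"
    using cauchy_schwarz[of _ z]
    by (rule_tac Lim_null_comparison[where g = "\<lambda>n. nrm (X n - l) * nrm z"])
       (auto simp flip: ip_diff_left)
  then show ?thesis by (simp add: LIM_zero_iff)
qed

lemma tendsto_nrm:
  assumes "((\<lambda>n. nrm (X n - l)) \<longlongrightarrow> 0) F"
  shows "((\<lambda>n. nrm (X n)) \<longlongrightarrow> nrm l) F"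
proof -
  have "((\<lambda>n. nrm (X n) - nrm l) \<longlongrightarrow> 0) F"
    by (rule Lim_null_comparison[OF _ assms]) (use nrm_reverse_triangle in simp)
  then show ?thesis by (simp add: LIM_zero_iff)
qed

lemma tendsto_nrm_diff:
  assumes "((\<lambda>n. nrm (X n - l)) \<longlongrightarrow> 0) F" and "((\<lambda>n. nrm (Y n - k)) \<longlongrightarrow> 0) F"
  shows "((\<lambda>n. nrm ((X n - Y n) - (l - k))) \<longlongrightarrow> 0) F"
proof (rule Lim_null_comparison)
  have "nrm ((X n - Y n) - (l - k)) \<le> nrm (X n - l) + nrm (Y n - k)" for n
    using nrm_diff_le[of "X n - l" "Y n - k"] by (simp add: algebra_simps)
  then show "\<forall>\<^sub>F n in F. norm (nrm (X n - Y n - (l - k))) \<le> nrm (X n - l) + nrm (Y n - k)"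
    by simp
  show "((\<lambda>n. nrm (X n - l) + nrm (Y n - k)) \<longlongrightarrow> 0) F"
    using tendsto_add[OF assms] by simp
qed

end

locale semi_hilbert = semi_inner +
  assumes complete: "\<lbrakk>\<And>e. 0 < e \<Longrightarrow> \<exists>N. \<forall>i\<ge>N. \<forall>j\<ge>N. nrm (X i - X j) < e\<rbrakk>
     \<Longrightarrow> \<exists>l. (\<lambda>n. nrm (X n - l)) \<longlonglongrightarrow> 0"
begin

lemma complete_summable:
  fixes a :: "nat \<Rightarrow> real"
  assumes a: "summable a" and X: "\<And>n. nrm (X n - X (Suc n)) \<le> a n"
  shows "\<exists>l. (\<lambda>n. nrm (X n - l)) \<longlonglongrightarrow> 0"
proof (rule complete)
  have le: "nrm (X i - X j) \<le> sum a {i..<j}" if "i \<le> j" for i j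
    using that
  proof (induction j rule: dec_induct)
    case base show ?case by simp
  next
    case (step j)
    then show ?case
      using nrm_triangle_diff[of "X i" "X (Suc j)" "X j"] X[of j] by simp
  qed
  fix e :: real assume "0 < e"
  then obtain N where N: "\<And>m n. m \<ge> N \<Longrightarrow> \<bar>sum a {m..<n}\<bar> < e"
    using a unfolding summable_Cauchy by (metis real_norm_def)
  have "nrm (X i - X j) < e" if "i \<ge> N" "j \<ge> N" for i j
  proof (cases "i \<le> j")
    case True
    then show ?thesis using le[of i j] N[of i j] that by linarith
  next
    case False
    then show ?thesis using le[of j i] N[of j i] that nrm_diff_commute[of "X i" "X j"] by simp
  qed
  then show "\<exists>N. \<forall>i\<ge>N. \<forall>j\<ge>N. nrm (X i - X j) < e" by blast
qed

end

section \<open>Gradient flow of a convex function with bounded subgradients\<close>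

text \<open>Convexity of \<open>F\<close> is expressed by a selection \<open>P\<close> of subgradients. Since \<open>P\<close> is defined everywhere and
bounded, already the explicit Euler scheme converges.\<close>

locale subgradient_flow = semi_hilbert +
  fixes F :: "'a \<Rightarrow> real" and P :: "'a \<Rightarrow> 'a" and C lam :: real and f u\<^sub>0 :: 'a
  assumes F_sub: "F u + ip (P u) (w - u) \<le> F w"
    and P_bound: "nrm (P u) \<le> C"
    and lam_pos: "0 < lam"
begin

definition \<Phi> :: "'a \<Rightarrow> real" where
  "\<Phi> u = F u + lam / 2 * (nrm (u - f))\<^sup>2"

definition S :: "'a \<Rightarrow> 'a" where
  "S u = P u + lam *\<^sub>R (u - f)"

lemma \<Phi>_sub: "\<Phi> u + ip (S u) (w - u) \<le> \<Phi> w"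
proof -
  have "lam / 2 * (nrm (w - f))\<^sup>2
      = lam / 2 * (nrm (u - f))\<^sup>2 + lam * ip (u - f) (w - u) + lam / 2 * (nrm (w - u))\<^sup>2"
    unfolding nrm_power2_shift[of w f u] by (simp add: field_simps)
  moreover have "0 \<le> lam / 2 * (nrm (w - u))\<^sup>2" using lam_pos by simp
  ultimately show ?thesis
    using F_sub[of u w] unfolding \<Phi>_def S_def ip_add_left ip_scale_left by linarith
qed

lemma S_mono: "0 \<le> ip (S u - S w) (u - w)"
  using \<Phi>_sub[of u w] \<Phi>_sub[of w u] by (simp add: ip_linear)

lemma C_nonneg: "0 \<le> C"
  using P_bound[of 0] nrm_nonneg[of "P 0"] by linarith

text \<open>The Euler iterates stay in the ball of radius \<open>R\<close> around \<open>f\<close>, and on it the subgradients of \<open>\<Phi>\<close> are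
bounded by \<open>M\<close>.\<close>

definition R :: real where "R = max (nrm (u\<^sub>0 - f)) (C / lam)"
definition M :: real where "M = C + lam * R"

lemma R_nonneg: "0 \<le> R"
  using nrm_nonneg[of "u\<^sub>0 - f"] unfolding R_def by linarith

lemma C_le: "C \<le> lam * R"
proof -
  have "C / lam \<le> R" by (simp add: R_def)
  then show ?thesis using lam_pos by (simp add: field_simps)
qed

lemma M_nonneg: "0 \<le> M"
  using C_nonneg R_nonneg lam_pos by (simp add: M_def)

primrec euler :: "real \<Rightarrow> nat \<Rightarrow> 'a" where
  "euler \<tau> 0 = u\<^sub>0"
| "euler \<tau> (Suc k) = euler \<tau> k - \<tau> *\<^sub>R S (euler \<tau> k)"

context
  fixes \<tau> :: real
  assumes \<tau>: "0 \<le> \<tau>" "\<tau> * lam \<le> 1"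
begin

text \<open>A step moves to a convex combination of the old iterate and a point within \<open>C / lam \<le> R\<close> of \<open>f\<close>.\<close>

lemma euler_ball: "nrm (euler \<tau> k - f) \<le> R"
proof (induction k)
  case 0 show ?case by (simp add: R_def)
next
  case (Suc k)
  have "euler \<tau> (Suc k) - f = (1 - \<tau> * lam) *\<^sub>R (euler \<tau> k - f) - \<tau> *\<^sub>R P (euler \<tau> k)"
    by (simp add: S_def algebra_simps)
  then have "nrm (euler \<tau> (Suc k) - f)
      \<le> nrm ((1 - \<tau> * lam) *\<^sub>R (euler \<tau> k - f)) + nrm (\<tau> *\<^sub>R P (euler \<tau> k))"
    using nrm_diff_le by metis
  also have "\<dots> = (1 - \<tau> * lam) * nrm (euler \<tau> k - f) + \<tau> * nrm (P (euler \<tau> k))"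
    using \<tau> by (simp add: nrm_scale)
  also have "\<dots> \<le> (1 - \<tau> * lam) * R + \<tau> * (lam * R)"
    using \<tau> Suc P_bound[of "euler \<tau> k"] C_le by (intro add_mono mult_left_mono) auto
  also have "\<dots> = R" by (simp add: algebra_simps)
  finally show ?case .
qed

lemma S_bound: "nrm (S (euler \<tau> k)) \<le> M"
proof -
  have "nrm (S (euler \<tau> k)) \<le> nrm (P (euler \<tau> k)) + nrm (lam *\<^sub>R (euler \<tau> k - f))"
    unfolding S_def by (rule nrm_triangle)
  also have "\<dots> \<le> C + lam * R"
    using P_bound[of "euler \<tau> k"] euler_ball[of k] lam_pos by (auto simp: nrm_scale intro!: add_mono)
  finally show ?thesis by (simp add: M_def)
qed

lemma euler_step: "nrm (euler \<tau> k - euler \<tau> (Suc k)) \<le> \<tau> * M"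
  using S_bound[of k] \<tau> by (simp add: nrm_scale mult_left_mono)

lemma euler_lipschitz: "nrm (euler \<tau> k - euler \<tau> (k + j)) \<le> M * (j * \<tau>)"
proof (induction j)
  case (Suc j)
  then show ?case
    using nrm_triangle_diff[of "euler \<tau> k" "euler \<tau> (k + Suc j)" "euler \<tau> (k + j)"]
      euler_step[of "k + j"] by (simp add: algebra_simps)
qed simp

text \<open>The discrete evolution variational inequality. One step contributes \<open>\<Phi> z - \<Phi>\<close> at the current
iterate; replacing that iterate by the first one costs \<open>M\<^sup>2\<close> times the elapsed time, which is the
origin of the term quadratic in the total time. In this form no time integral of \<open>\<Phi>\<close> along
the trajectory appears.\<close>

lemma euler_evi:
  defines "\<delta> \<equiv> \<lambda>j. real j * \<tau>"
  shows "(nrm (euler \<tau> (k + j) - z))\<^sup>2 \<le> (nrm (euler \<tau> k - z))\<^sup>2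
    + 2 * \<delta> j * (\<Phi> z - \<Phi> (euler \<tau> k)) + 2 * M\<^sup>2 * (\<delta> j)\<^sup>2 + \<delta> j * \<tau> * M\<^sup>2"
proof (induction j)
  case 0 show ?case by (simp add: \<delta>_def)
next
  case (Suc j)
  let ?E = "euler \<tau> (k + j)"
  have e: "euler \<tau> (k + Suc j) - z = (?E - z) - \<tau> *\<^sub>R S ?E" by simp
  have "(nrm (euler \<tau> (k + Suc j) - z))\<^sup>2 = (nrm (?E - z))\<^sup>2 - 2 * \<tau> * ip (S ?E) (?E - z) + \<tau>\<^sup>2 * (nrm (S ?E))\<^sup>2"
    unfolding e nrm_diff_power2[of "?E - z"] nrm_scale ip_scale_right ip_sym[of "?E - z"]
    by (simp add: power_mult_distrib)
  moreover have "\<tau>\<^sup>2 * (nrm (S ?E))\<^sup>2 \<le> \<tau>\<^sup>2 * M\<^sup>2"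
    using S_bound[of "k + j"] by (intro mult_left_mono power_mono) auto
  moreover have "- 2 * \<tau> * ip (S ?E) (?E - z) \<le> 2 * \<tau> * (\<Phi> z - \<Phi> ?E)"
  proof -
    have "- ip (S ?E) (?E - z) \<le> \<Phi> z - \<Phi> ?E" using \<Phi>_sub[of ?E z] by (simp add: ip_linear)
    from mult_left_mono[OF this, of "2 * \<tau>"] show ?thesis using \<tau> by simp
  qed
  moreover have "2 * \<tau> * (\<Phi> z - \<Phi> ?E) \<le> 2 * \<tau> * (\<Phi> z - \<Phi> (euler \<tau> k) + M\<^sup>2 * \<delta> j)"
  proof -
    have "ip (S (euler \<tau> k)) (euler \<tau> k - ?E) \<le> nrm (S (euler \<tau> k)) * nrm (euler \<tau> k - ?E)"
      by (rule ip_le_nrm)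
    also have "\<dots> \<le> M * (M * (j * \<tau>))"
      using S_bound euler_lipschitz \<tau> M_nonneg by (intro mult_mono) auto
    finally have "\<Phi> (euler \<tau> k) - \<Phi> ?E \<le> M\<^sup>2 * \<delta> j"
      using \<Phi>_sub[of "euler \<tau> k" ?E] by (simp add: ip_linear \<delta>_def power2_eq_square algebra_simps)
    then show ?thesis using \<tau> by (intro mult_left_mono) auto
  qed
  moreover have "(nrm (euler \<tau> k - z))\<^sup>2 + 2 * \<delta> (Suc j) * (\<Phi> z - \<Phi> (euler \<tau> k))
        + 2 * M\<^sup>2 * (\<delta> (Suc j))\<^sup>2 + \<delta> (Suc j) * \<tau> * M\<^sup>2
      = ((nrm (euler \<tau> k - z))\<^sup>2 + 2 * \<delta> j * (\<Phi> z - \<Phi> (euler \<tau> k)) + 2 * M\<^sup>2 * (\<delta> j)\<^sup>2 + \<delta> j * \<tau> * M\<^sup>2)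
        + 2 * \<tau> * (\<Phi> z - \<Phi> (euler \<tau> k) + M\<^sup>2 * \<delta> j) + \<tau>\<^sup>2 * M\<^sup>2
        + (2 * (M\<^sup>2 * \<delta> j * \<tau>) + 2 * (M\<^sup>2 * \<tau>\<^sup>2))"
  proof -
    have "\<delta> (Suc j) = \<delta> j + \<tau>" by (simp add: \<delta>_def algebra_simps)
    then show ?thesis by (simp add: power2_eq_square algebra_simps)
  qed
  moreover have "0 \<le> M\<^sup>2 * \<delta> j * \<tau>" "0 \<le> M\<^sup>2 * \<tau>\<^sup>2" using \<tau> by (auto simp: \<delta>_def)
  ultimately show ?case using Suc by linarith
qed

end

text \<open>One step of size \<open>\<tau>\<close> against two of size \<open>\<tau> / 2\<close>: the terms of first order have the good sign by
monotonicity of \<open>S\<close>, except that the second half step uses the subgradient at a point displaced by at most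
\<open>\<tau> M / 2\<close>. So the squared distance grows by \<open>O(\<tau>\<^sup>2)\<close> per step, hence by \<open>O(\<tau>)\<close> in bounded time.\<close>

lemma euler_half:
  assumes \<tau>: "0 \<le> \<tau>" "\<tau> * lam \<le> 1"
  shows "(nrm (euler \<tau> k - euler (\<tau> / 2) (2 * k)))\<^sup>2 \<le> 5 * M\<^sup>2 * \<tau>\<^sup>2 * k"
proof (induction k)
  case 0 show ?case by simp
next
  case (Suc k)
  define a b b' where "a = euler \<tau> k" and "b = euler (\<tau> / 2) (2 * k)"
    and "b' = euler (\<tau> / 2) (Suc (2 * k))"
  have half: "0 \<le> \<tau> / 2" "\<tau> / 2 * lam \<le> 1" using \<tau> lam_pos by (auto intro: order_trans[rotated])
  have bounds: "nrm (S a) \<le> M" "nrm (S b) \<le> M" "nrm (S b') \<le> M"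
    unfolding a_def b_def b'_def by (intro S_bound \<tau> half)+
  define D where "D = (S a - S b) + (S a - S b')"
  have D: "nrm D \<le> 4 * M"
    using nrm_triangle[of "S a - S b" "S a - S b'"] nrm_diff_le[of "S a" "S b"]
      nrm_diff_le[of "S a" "S b'"] bounds unfolding D_def by linarith
  have e: "euler \<tau> (Suc k) - euler (\<tau> / 2) (2 * Suc k) = (a - b) - (\<tau> / 2) *\<^sub>R D"
    by (simp add: a_def b_def b'_def D_def algebra_simps flip: scaleR_add_left)
  have "(nrm (euler \<tau> (Suc k) - euler (\<tau> / 2) (2 * Suc k)))\<^sup>2
      = (nrm (a - b))\<^sup>2 - \<tau> * ip D (a - b) + (\<tau>\<^sup>2 / 4) * (nrm D)\<^sup>2"
    unfolding e nrm_diff_power2[of "a - b"] nrm_scale ip_scale_right ip_sym[of "a - b"]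
    by (simp add: power_mult_distrib power_divide)
  also have "\<dots> \<le> 5 * M\<^sup>2 * \<tau>\<^sup>2 * k + \<tau> * (\<tau> * M\<^sup>2) + (\<tau>\<^sup>2 / 4) * (16 * M\<^sup>2)"
  proof (intro add_mono)
    have bb: "b' - b = - (\<tau> / 2) *\<^sub>R S b" by (simp add: b_def b'_def)
    have "nrm (b' - b) \<le> \<tau> / 2 * M"
      unfolding bb using bounds(2) \<tau> by (simp add: nrm_scale mult_left_mono)
    then have "\<bar>ip (S a - S b') (b' - b)\<bar> \<le> (2 * M) * (\<tau> / 2 * M)"
      using nrm_diff_le[of "S a" "S b'"] bounds M_nonneg
      by (intro order_trans[OF cauchy_schwarz] mult_mono) auto
    moreover have "ip D (a - b) = ip (S a - S b) (a - b) + ip (S a - S b') (a - b') + ip (S a - S b') (b' - b)"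
      by (simp add: D_def ip_linear)
    ultimately have "- ip D (a - b) \<le> \<tau> * M\<^sup>2"
      using S_mono[of a b] S_mono[of a b'] by (simp add: power2_eq_square mult_ac abs_le_iff)
    then have "\<tau> * (- ip D (a - b)) \<le> \<tau> * (\<tau> * M\<^sup>2)" using \<tau> by (intro mult_left_mono)
    then show "(nrm (a - b))\<^sup>2 - \<tau> * ip D (a - b) \<le> 5 * M\<^sup>2 * \<tau>\<^sup>2 * k + \<tau> * (\<tau> * M\<^sup>2)"
      using Suc by (simp add: a_def b_def)
    have "(nrm D)\<^sup>2 \<le> (4 * M)\<^sup>2" using D by (intro power_mono) auto
    then show "(\<tau>\<^sup>2 / 4) * (nrm D)\<^sup>2 \<le> (\<tau>\<^sup>2 / 4) * (16 * M\<^sup>2)"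
      by (intro mult_left_mono) (auto simp: power_mult_distrib)
  qed
  also have "\<dots> = 5 * M\<^sup>2 * \<tau>\<^sup>2 * Suc k" by (simp add: power2_eq_square algebra_simps)
  finally show ?case .
qed

text \<open>Dyadic steps, beginning with \<open>1 / lam\<close> so that the step condition \<open>\<tau> lam \<le> 1\<close> always holds.\<close>

definition tau :: "nat \<Rightarrow> real" where "tau n = 1 / (lam * 2 ^ n)"
definition idx :: "nat \<Rightarrow> real \<Rightarrow> nat" where "idx n t = nat \<lfloor>t / tau n\<rfloor>"
definition approx :: "nat \<Rightarrow> real \<Rightarrow> 'a" where "approx n t = euler (tau n) (idx n t)"

lemma tau_pos: "0 < tau n"
  using lam_pos by (simp add: tau_def)

lemma tau_lam: "tau n * lam \<le> 1"
  using lam_pos by (simp add: tau_def)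

lemma tau_Suc: "tau (Suc n) = tau n / 2"
  by (simp add: tau_def)

lemma tau_tendsto: "tau \<longlonglongrightarrow> 0"
proof -
  have "(\<lambda>n. 1 / lam * (1/2) ^ n) \<longlonglongrightarrow> 1 / lam * 0"
    by (intro tendsto_intros LIMSEQ_realpow_zero) auto
  then show ?thesis by (simp add: tau_def[abs_def] power_one_over)
qed

lemma idx_bounds:
  assumes "0 \<le> t"
  shows "idx n t * tau n \<le> t" "t - tau n < idx n t * tau n"
proof -
  have nn: "0 \<le> t / tau n" using assms tau_pos[of n] by simp
  then have i: "real (idx n t) = of_int \<lfloor>t / tau n\<rfloor>"
    by (simp add: idx_def)
  have "real (idx n t) \<le> t / tau n" "t / tau n - 1 < real (idx n t)" unfolding i by linarith+
  then show "idx n t * tau n \<le> t" "t - tau n < idx n t * tau n"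
    using tau_pos[of n] by (simp_all add: field_simps)
qed

lemma idx_Suc: assumes "0 \<le> t" shows "idx (Suc n) t = 2 * idx n t \<or> idx (Suc n) t = 2 * idx n t + 1"
proof -
  have *: "t / tau (Suc n) = 2 * (t / tau n)" by (simp add: tau_Suc)
  have nn: "0 \<le> t / tau n" using assms tau_pos[of n] by simp
  show ?thesis unfolding idx_def * using nn by linarith
qed

lemma idx_tendsto:
  assumes "0 \<le> t"
  shows "(\<lambda>n. idx n t * tau n) \<longlonglongrightarrow> t"
proof (rule tendsto_sandwich[where f = "\<lambda>n. t - tau n" and h = "\<lambda>_. t"])
  show "(\<lambda>n. t - tau n) \<longlonglongrightarrow> t" using tendsto_diff[OF tendsto_const tau_tendsto, of t] by simp
qed (use idx_bounds[OF assms] in \<open>auto intro!: always_eventually simp: less_imp_le\<close>)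

text \<open>The first summand compares the two Euler schemes, the second accounts for the half step by which
the two rounded times may differ.\<close>

lemma approx_step:
  assumes "0 \<le> t"
  shows "nrm (approx n t - approx (Suc n) t) \<le> M * sqrt (5 * t * tau n) + M * tau n"
proof -
  let ?k = "idx n t"
  let ?b = "euler (tau (Suc n)) (2 * ?k)"
  have "(nrm (approx n t - ?b))\<^sup>2 \<le> 5 * M\<^sup>2 * (tau n)\<^sup>2 * ?k"
    using euler_half[OF less_imp_le[OF tau_pos[of n]] tau_lam] by (simp add: approx_def tau_Suc)
  also have "\<dots> = M\<^sup>2 * (5 * tau n * (?k * tau n))" by (simp add: power2_eq_square)
  also have "\<dots> \<le> M\<^sup>2 * (5 * tau n * t)"
    using idx_bounds(1)[OF assms, of n] tau_pos[of n] by (intro mult_left_mono) auto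
  finally have "nrm (approx n t - ?b) \<le> sqrt (M\<^sup>2 * (5 * tau n * t))"
    by (rule real_le_rsqrt)
  also have "\<dots> = M * sqrt (5 * t * tau n)"
    using M_nonneg by (simp add: real_sqrt_mult mult_ac)
  finally have 1: "nrm (approx n t - ?b) \<le> M * sqrt (5 * t * tau n)" .
  have "nrm (?b - approx (Suc n) t) \<le> M * tau n"
    using idx_Suc[OF assms, of n]
  proof
    assume "idx (Suc n) t = 2 * ?k + 1"
    then have "nrm (?b - approx (Suc n) t) \<le> tau (Suc n) * M"
      using euler_step[OF less_imp_le[OF tau_pos[of "Suc n"]] tau_lam, of "2 * ?k"] by (simp add: approx_def)
    also have "\<dots> \<le> M * tau n" using tau_pos[of n] M_nonneg by (simp add: tau_Suc)
    finally show ?thesis .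
  qed (use M_nonneg tau_pos[of n] in \<open>simp add: approx_def\<close>)
  then show ?thesis using 1 nrm_triangle_diff[of "approx n t" "approx (Suc n) t" ?b] by linarith
qed

lemma approx_converges:
  assumes "0 \<le> t"
  shows "\<exists>l. (\<lambda>n. nrm (approx n t - l)) \<longlonglongrightarrow> 0"
proof (rule complete_summable)
  show "nrm (approx n t - approx (Suc n) t) \<le> M * sqrt (5 * t * tau n) + M * tau n" for n
    by (rule approx_step[OF assms])
  have "sqrt (5 * t * tau n) = sqrt (5 * t / lam) * (1 / sqrt 2) ^ n" for n
    by (simp add: tau_def real_sqrt_mult real_sqrt_divide real_sqrt_power power_one_over)
  moreover have "summable (\<lambda>n. M * (sqrt (5 * t / lam) * (1 / sqrt 2) ^ n) + M * ((1 / lam) * (1/2) ^ n))"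
    by (intro summable_add summable_mult summable_geometric) auto
  ultimately show "summable (\<lambda>n. M * sqrt (5 * t * tau n) + M * tau n)"
    by (simp add: tau_def[abs_def] power_one_over)
qed

definition flow :: "real \<Rightarrow> 'a" where
  "flow t = (SOME l. (\<lambda>n. nrm (approx n t - l)) \<longlonglongrightarrow> 0)"

lemma flow_lim: "0 \<le> t \<Longrightarrow> (\<lambda>n. nrm (approx n t - flow t)) \<longlonglongrightarrow> 0"
  unfolding flow_def by (rule someI_ex) (rule approx_converges)

lemma flow_0: "nrm (flow 0 - u\<^sub>0) = 0"
  using flow_lim[of 0] by (simp add: approx_def idx_def nrm_diff_commute LIMSEQ_const_iff)

text \<open>Passage to the limit in the discrete inequality. Semicontinuity of \<open>\<Phi>\<close> along the approximations
is supplied by the subgradient at the limit.\<close>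

lemma flow_evi:
  assumes t: "0 \<le> t" and h: "0 \<le> h"
  shows "(nrm (flow (t + h) - z))\<^sup>2 \<le> (nrm (flow t - z))\<^sup>2
    + 2 * h * (\<Phi> z - \<Phi> (flow t)) + 2 * M\<^sup>2 * h\<^sup>2"
proof -
  define d where "d n = real (idx n (t + h) - idx n t) * tau n" for n
  have le: "idx n t \<le> idx n (t + h)" for n
    using h tau_pos[of n] unfolding idx_def by (intro nat_mono floor_mono divide_right_mono) auto
  have d: "d \<longlonglongrightarrow> h"
  proof -
    have "d n = idx n (t + h) * tau n - idx n t * tau n" for n
      using le[of n] by (simp add: d_def of_nat_diff algebra_simps)
    then show ?thesis
      using tendsto_diff[OF idx_tendsto[of "t + h"] idx_tendsto[OF t]] t h by (simp add: d_def[abs_def])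
  qed
  have d_nonneg: "0 \<le> d n" for n using tau_pos[of n] by (simp add: d_def)
  have lim: "(\<lambda>n. nrm (approx n s - z)) \<longlonglongrightarrow> nrm (flow s - z)" if "0 \<le> s" for s
    using tendsto_nrm[OF tendsto_nrm_diff[OF flow_lim[OF that], of "\<lambda>_. z" z]] by simp
  have bound: "(nrm (approx n (t + h) - z))\<^sup>2 \<le> (nrm (approx n t - z))\<^sup>2
      + 2 * d n * (\<Phi> z - (\<Phi> (flow t) + ip (S (flow t)) (approx n t - flow t)))
      + 2 * M\<^sup>2 * (d n)\<^sup>2 + d n * tau n * M\<^sup>2" for n
  proof -
    have "2 * d n * (\<Phi> z - \<Phi> (approx n t))
        \<le> 2 * d n * (\<Phi> z - (\<Phi> (flow t) + ip (S (flow t)) (approx n t - flow t)))"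
      using \<Phi>_sub[of "flow t" "approx n t"] d_nonneg[of n] by (intro mult_left_mono) auto
    then show ?thesis
      using euler_evi[OF less_imp_le[OF tau_pos[of n]] tau_lam, of "idx n t" "idx n (t + h) - idx n t" z] le[of n]
      by (simp add: approx_def d_def)
  qed
  have lim_r: "(\<lambda>n. (nrm (approx n t - z))\<^sup>2
      + 2 * d n * (\<Phi> z - (\<Phi> (flow t) + ip (S (flow t)) (approx n t - flow t)))
      + 2 * M\<^sup>2 * (d n)\<^sup>2 + d n * tau n * M\<^sup>2)
     \<longlonglongrightarrow> (nrm (flow t - z))\<^sup>2 + 2 * h * (\<Phi> z - (\<Phi> (flow t) + 0)) + 2 * M\<^sup>2 * h\<^sup>2 + h * 0 * M\<^sup>2"
  proof (intro tendsto_intros lim t d tau_tendsto)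
    have "(\<lambda>n. nrm (approx n t - flow t - 0)) \<longlonglongrightarrow> 0" using flow_lim[OF t] by simp
    from tendsto_ip[OF this, of "S (flow t)"]
    show "(\<lambda>n. ip (S (flow t)) (approx n t - flow t)) \<longlonglongrightarrow> 0"
      by (simp add: ip_zero_left ip_sym[of "S (flow t)"])
  qed
  have lim_l: "(\<lambda>n. (nrm (approx n (t + h) - z))\<^sup>2) \<longlonglongrightarrow> (nrm (flow (t + h) - z))\<^sup>2"
    using t h by (intro tendsto_intros lim) auto
  show ?thesis using LIMSEQ_le[OF lim_l lim_r] bound by simp
qed

lemma flow_lipschitz:
  assumes t: "0 \<le> t" and h: "0 \<le> h"
  shows "nrm (flow (t + h) - flow t) \<le> 2 * M * h"
proof (rule power2_le_imp_le)
  have "(nrm (flow (t + h) - flow t))\<^sup>2 \<le> 2 * (M\<^sup>2 * h\<^sup>2)"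
    using flow_evi[OF t h, of "flow t"] by simp
  also have "\<dots> \<le> (2 * M * h)\<^sup>2" by (simp add: power_mult_distrib)
  finally show "(nrm (flow (t + h) - flow t))\<^sup>2 \<le> (2 * M * h)\<^sup>2" .
qed (use M_nonneg h in simp)

text \<open>The \<open>\<epsilon>\<close>-subdifferential: difference quotients of the flow belong to it exactly, whereas they are
genuine subgradients only in the limit.\<close>

definition eps_sub :: "real \<Rightarrow> 'a \<Rightarrow> 'a set" where
  "eps_sub e u = {g. \<forall>z. ip g (z - u) \<le> \<Phi> z - \<Phi> u + e}"

lemma eps_sub_mono: "e \<le> e' \<Longrightarrow> eps_sub e u \<subseteq> eps_sub e' u"
  by (auto simp: eps_sub_def intro: order_trans)

lemma S_eps_sub: "0 \<le> e \<Longrightarrow> S u \<in> eps_sub e u"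
  unfolding eps_sub_def
proof (intro CollectI allI)
  fix z assume "0 \<le> e"
  then show "ip (S u) (z - u) \<le> \<Phi> z - \<Phi> u + e" using \<Phi>_sub[of u z] by linarith
qed

lemma eps_sub_midpoint:
  assumes "g \<in> eps_sub e u" "g' \<in> eps_sub e u"
  shows "(1/2) *\<^sub>R (g + g') \<in> eps_sub e u"
  unfolding eps_sub_def
proof (intro CollectI allI)
  fix z
  have "ip g (z - u) \<le> \<Phi> z - \<Phi> u + e" "ip g' (z - u) \<le> \<Phi> z - \<Phi> u + e"
    using assms by (auto simp: eps_sub_def)
  then show "ip ((1/2) *\<^sub>R (g + g')) (z - u) \<le> \<Phi> z - \<Phi> u + e"
    unfolding ip_scale_left ip_add_left by simp
qed

text \<open>The \<open>\<epsilon>\<close>-subdifferentials are convex, closed and decrease with \<open>\<epsilon>\<close>. By the parallelogram law nearly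
minimal elements of them form a Cauchy sequence, whose limit is the subgradient of minimal norm.
The point is that the minimal norms of the \<open>\<epsilon>\<close>-subdifferentials increase to the norm of this limit.\<close>

lemma minimal_subgradient:
  "\<exists>p\<in>eps_sub 0 u. \<forall>e>0. \<exists>d>0. \<forall>g\<in>eps_sub d u. nrm p - e < nrm g"
proof -
  define \<mu> where "\<mu> n = Inf (nrm ` eps_sub (inverse (real (Suc n))) u)" for n
  have ne: "nrm ` eps_sub (inverse (real (Suc n))) u \<noteq> {}" for n
    using S_eps_sub[of "inverse (real (Suc n))" u] by auto
  have bdd: "bdd_below (nrm ` A)" for A by (rule bdd_belowI[of _ 0]) auto
  have mu_le: "\<mu> n \<le> nrm g" if "g \<in> eps_sub (inverse (real (Suc n))) u" for n g
    unfolding \<mu>_def using that by (intro cInf_lower bdd) auto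
  have mono: "incseq \<mu>"
  proof (rule incseq_SucI)
    fix n
    show "\<mu> n \<le> \<mu> (Suc n)" unfolding \<mu>_def
      by (intro cInf_superset_mono ne bdd image_mono eps_sub_mono) (auto simp: field_simps)
  qed
  have "\<mu> n \<le> nrm (S u)" for n by (intro mu_le S_eps_sub) auto
  then obtain \<mu>0 where \<mu>0: "\<mu> \<longlonglongrightarrow> \<mu>0" "\<And>n. \<mu> n \<le> \<mu>0"
    using incseq_convergent[OF mono] by blast
  have "\<exists>g\<in>eps_sub (inverse (real (Suc n))) u. nrm g < \<mu> n + inverse (real (Suc n))" for n
  proof -
    have "Inf (nrm ` eps_sub (inverse (real (Suc n))) u) < \<mu> n + inverse (real (Suc n))"
      by (simp add: \<mu>_def)
    from cInf_lessD[OF ne this] show ?thesis by auto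
  qed
  then obtain g where g: "\<And>n. g n \<in> eps_sub (inverse (real (Suc n))) u"
    and g_lt: "\<And>n. nrm (g n) < \<mu> n + inverse (real (Suc n))" by metis
  have in_mono: "g i \<in> eps_sub (inverse (real (Suc n))) u" if "n \<le> i" for n i
    using g[of i] eps_sub_mono[of "inverse (real (Suc i))" "inverse (real (Suc n))" u] that
    by (auto simp: field_simps)
  have g_le: "nrm (g i) \<le> \<mu>0 + inverse (real (Suc n))" if "n \<le> i" for n i
  proof -
    have "inverse (real (Suc i)) \<le> inverse (real (Suc n))" using that by (simp add: field_simps)
    then show ?thesis using g_lt[of i] \<mu>0(2)[of i] by linarith
  qed
  have mu_nonneg: "0 \<le> \<mu> n" for n unfolding \<mu>_def by (intro cInf_greatest ne) auto
  define b where "b n = 4 * (\<mu>0 + inverse (real (Suc n)))\<^sup>2 - 4 * (\<mu> n)\<^sup>2" for n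
  have b_lim: "b \<longlonglongrightarrow> 0"
  proof -
    have "b \<longlonglongrightarrow> 4 * (\<mu>0 + 0)\<^sup>2 - 4 * \<mu>0\<^sup>2" unfolding b_def
      by (intro tendsto_intros \<mu>0 LIMSEQ_inverse_real_of_nat)
    then show ?thesis by simp
  qed
  have cauchy: "(nrm (g i - g j))\<^sup>2 \<le> b n" if "n \<le> i" "n \<le> j" for i j n
  proof -
    have "\<mu> n \<le> nrm ((1/2) *\<^sub>R (g i + g j))"
      by (intro mu_le eps_sub_midpoint in_mono that)
    then have "(\<mu> n)\<^sup>2 \<le> (nrm ((1/2) *\<^sub>R (g i + g j)))\<^sup>2"
      using mu_nonneg by (intro power_mono)
    moreover have "(nrm (g i))\<^sup>2 \<le> (\<mu>0 + inverse (real (Suc n)))\<^sup>2"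
      "(nrm (g j))\<^sup>2 \<le> (\<mu>0 + inverse (real (Suc n)))\<^sup>2"
      using g_le that by (auto intro!: power_mono)
    ultimately show ?thesis unfolding parallelogram[of "g i"] b_def by linarith
  qed
  have "\<exists>p. (\<lambda>n. nrm (g n - p)) \<longlonglongrightarrow> 0"
  proof (rule complete)
    fix e :: real assume e: "0 < e"
    then have "0 < e\<^sup>2" by simp
    with b_lim have "\<forall>\<^sub>F n in sequentially. b n < e\<^sup>2" by (rule order_tendstoD)
    then obtain N where N: "b N < e\<^sup>2" by (auto simp: eventually_sequentially)
    have "nrm (g i - g j) < e" if "N \<le> i" "N \<le> j" for i j
      using cauchy[OF that] N e by (intro power2_less_imp_less[of _ e]) auto
    then show "\<exists>N. \<forall>i\<ge>N. \<forall>j\<ge>N. nrm (g i - g j) < e" by blast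
  qed
  then obtain p where p: "(\<lambda>n. nrm (g n - p)) \<longlonglongrightarrow> 0" by blast
  show ?thesis
  proof (intro bexI[of _ p] allI impI)
    fix e :: real assume e: "0 < e"
    have "nrm p \<le> \<mu>0"
    proof (rule LIMSEQ_le[OF tendsto_nrm[OF p]])
      show "(\<lambda>n. \<mu> n + inverse (real (Suc n))) \<longlonglongrightarrow> \<mu>0"
        using tendsto_add[OF \<mu>0(1) LIMSEQ_inverse_real_of_nat] by simp
    qed (use g_lt less_imp_le in blast)
    moreover have "\<forall>\<^sub>F n in sequentially. \<mu>0 - e < \<mu> n" using \<mu>0(1) e by (intro order_tendstoD) auto
    then obtain n where "\<mu>0 - e < \<mu> n" by (auto simp: eventually_sequentially)
    ultimately show "\<exists>d>0. \<forall>g\<in>eps_sub d u. nrm p - e < nrm g"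
      using mu_le[of _ n] by (intro exI[of _ "inverse (real (Suc n))"]) fastforce
  next
    show "p \<in> eps_sub 0 u" unfolding eps_sub_def
    proof (intro CollectI allI)
      fix z
      have "(\<lambda>n. ip (g n) (z - u)) \<longlonglongrightarrow> ip p (z - u)" by (rule tendsto_ip[OF p])
      moreover have "(\<lambda>n. \<Phi> z - \<Phi> u + inverse (real (Suc n))) \<longlonglongrightarrow> \<Phi> z - \<Phi> u + 0"
        by (intro tendsto_intros LIMSEQ_inverse_real_of_nat)
      ultimately show "ip p (z - u) \<le> \<Phi> z - \<Phi> u + 0"
        by (rule LIMSEQ_le) (use g in \<open>auto simp: eps_sub_def\<close>)
    qed
  qed
qed

lemma flow_quotient_eps_sub:
  assumes t: "0 \<le> t" and h: "0 < h"
  shows "- ((1 / h) *\<^sub>R (flow (t + h) - flow t)) \<in> eps_sub (M\<^sup>2 * h) (flow t)"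
  unfolding eps_sub_def
proof (intro CollectI allI)
  fix z
  let ?D = "flow (t + h) - flow t"
  have "(nrm (flow (t + h) - z))\<^sup>2 = (nrm (flow t - z))\<^sup>2 - 2 * ip ?D (z - flow t) + (nrm ?D)\<^sup>2"
    unfolding nrm_power2_shift[of "flow (t + h)" z "flow t"] ip_sym[of _ ?D] by (simp add: ip_diff_right)
  then have "- 2 * ip ?D (z - flow t) \<le> 2 * h * (\<Phi> z - \<Phi> (flow t)) + 2 * M\<^sup>2 * h\<^sup>2"
    using flow_evi[OF t less_imp_le[OF h], of z] zero_le_power2[of "nrm ?D"] by linarith
  then have "- ip ?D (z - flow t) \<le> h * (\<Phi> z - \<Phi> (flow t) + M\<^sup>2 * h)"
    by (simp add: power2_eq_square algebra_simps)
  then show "ip (- ((1 / h) *\<^sub>R ?D)) (z - flow t) \<le> \<Phi> z - \<Phi> (flow t) + M\<^sup>2 * h"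
    using h by (simp only: ip_minus_left ip_scale_left) (simp add: field_simps)
qed

text \<open>Comparison of the flow with its starting point \<open>z = flow t\<close>: the inequality \<open>flow_evi\<close> with this \<open>z\<close> is a discrete
Gronwall estimate \<open>\<phi>(s + d)\<^sup>2 \<le> (\<phi>(s) + d \<bar>p\<bar>)\<^sup>2 + O(d\<^sup>2)\<close> for \<open>\<phi>(s) = \<bar>flow (t + s) - z\<bar>\<close>. On a partition into
\<open>N\<close> parts the errors add up to \<open>O(N\<^sup>-\<^sup>1\<^sup>/\<^sup>2)\<close>.\<close>

lemma flow_speed_le:
  assumes p: "p \<in> eps_sub 0 (flow t)" and t: "0 \<le> t" and h: "0 \<le> h"
  shows "nrm (flow (t + h) - flow t) \<le> h * nrm p"
proof -
  let ?z = "flow t"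
  have step: "(nrm (flow (t + (s + d)) - ?z))\<^sup>2 \<le> (nrm (flow (t + s) - ?z) + d * nrm p)\<^sup>2 + 2 * M\<^sup>2 * d\<^sup>2"
    if "0 \<le> s" "0 \<le> d" for s d
  proof -
    have "ip p (flow (t + s) - ?z) \<le> \<Phi> (flow (t + s)) - \<Phi> ?z"
      using p by (auto simp: eps_sub_def)
    moreover have "- ip p (flow (t + s) - ?z) \<le> nrm p * nrm (flow (t + s) - ?z)"
      using cauchy_schwarz[of p "flow (t + s) - ?z"] by linarith
    ultimately have le: "2 * d * (\<Phi> ?z - \<Phi> (flow (t + s))) \<le> 2 * d * (nrm p * nrm (flow (t + s) - ?z))"
      using that by (intro mult_left_mono) auto
    have "(nrm (flow (t + s) - ?z) + d * nrm p)\<^sup>2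
        = (nrm (flow (t + s) - ?z))\<^sup>2 + 2 * d * (nrm p * nrm (flow (t + s) - ?z)) + (d * nrm p)\<^sup>2"
      by (simp add: power2_sum)
    moreover have "0 \<le> (d * nrm p)\<^sup>2" by simp
    moreover have "flow (t + (s + d)) = flow (t + s + d)" by (simp add: add.assoc)
    ultimately show ?thesis
      using flow_evi[of "t + s" d ?z] t that le by argo
  qed
  have "nrm (flow (t + h) - ?z) \<le> h * nrm p + M * h * sqrt (2 / real (Suc N))" for N
  proof -
    define d where "d = h / real (Suc N)"
    have d: "0 \<le> d" using h by (simp add: d_def)
    have "nrm (flow (t + k * d) - ?z) \<le> k * d * nrm p + sqrt (2 * real k) * M * d" for k
    proof (induction k)
      case 0 show ?case by simp
    next
      case (Suc k)
      let ?A = "Suc k * d * nrm p"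
      have A: "0 \<le> ?A" using d by simp
      have "(nrm (flow (t + Suc k * d) - ?z))\<^sup>2
          \<le> (nrm (flow (t + k * d) - ?z) + d * nrm p)\<^sup>2 + 2 * M\<^sup>2 * d\<^sup>2"
        using step[of "k * d" d] d by (simp add: algebra_simps)
      also have "\<dots> \<le> (?A + sqrt (2 * real k) * M * d)\<^sup>2 + 2 * M\<^sup>2 * d\<^sup>2"
        using Suc d by (intro add_right_mono power_mono) (auto simp: algebra_simps)
      also have "\<dots> = ?A\<^sup>2 + 2 * ?A * (sqrt (2 * real k) * (M * d)) + 2 * real (Suc k) * (M * d)\<^sup>2"
        by (simp add: power2_sum power_mult_distrib algebra_simps)
      also have "\<dots> \<le> ?A\<^sup>2 + 2 * ?A * (sqrt (2 * real (Suc k)) * (M * d)) + 2 * real (Suc k) * (M * d)\<^sup>2"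
        using A d M_nonneg by (intro add_mono mult_left_mono mult_right_mono real_sqrt_le_mono) auto
      also have "\<dots> = (?A + sqrt (2 * real (Suc k)) * M * d)\<^sup>2"
        by (simp add: power2_sum power_mult_distrib mult.assoc)
      finally show ?case
        by (rule power2_le_imp_le) (use A d M_nonneg in auto)
    qed
    from this[of "Suc N"] have "nrm (flow (t + h) - ?z) \<le> h * nrm p + sqrt (2 * real (Suc N)) * M * d"
      by (simp add: d_def)
    also have "sqrt (2 * real (Suc N)) * M * d = M * h * sqrt (2 / real (Suc N))"
    proof -
      have "sqrt (2 * real (Suc N)) / real (Suc N) = sqrt (2 / real (Suc N))"
      proof -
        have "2 / x = 2 * x / x\<^sup>2" if "0 < x" for x :: real using that by (simp add: power2_eq_square)
        then have "2 / real (Suc N) = 2 * real (Suc N) / (real (Suc N))\<^sup>2" by simp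
        then show ?thesis by (simp only: real_sqrt_divide) simp
      qed
      then show ?thesis unfolding d_def by (metis mult.commute mult.left_commute times_divide_eq_right)
    qed
    finally show ?thesis .
  qed
  moreover have "(\<lambda>N. h * nrm p + M * h * sqrt (2 * inverse (real (Suc N)))) \<longlonglongrightarrow> h * nrm p + M * h * sqrt (2 * 0)"
    by (intro tendsto_intros LIMSEQ_inverse_real_of_nat)
  ultimately show ?thesis
    by (intro LIMSEQ_le_const[of "\<lambda>N. h * nrm p + M * h * sqrt (2 * inverse (real (Suc N)))"])
       (auto simp: divide_inverse)
qed

text \<open>For the minimal subgradient \<open>p\<close>, both \<open>p\<close> and the negative difference quotient have norm at most \<open>\<bar>p\<bar>\<close>
and lie in a convex set all of whose elements have norm almost \<open>\<bar>p\<bar>\<close>. Applied to their midpoint, the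
parallelogram law shows that they are close.\<close>

lemma flow_right_derivative:
  assumes t: "0 \<le> t"
  shows "\<exists>p\<in>eps_sub 0 (flow t).
    ((\<lambda>h. nrm ((1 / h) *\<^sub>R (flow (t + h) - flow t) + p)) \<longlongrightarrow> 0) (at_right 0)"
proof -
  from minimal_subgradient[of "flow t"] obtain p where p: "p \<in> eps_sub 0 (flow t)"
    and min: "\<And>e. 0 < e \<Longrightarrow> \<exists>d>0. \<forall>g\<in>eps_sub d (flow t). nrm p - e < nrm g" by blast
  let ?q = "\<lambda>h. (1 / h) *\<^sub>R (flow (t + h) - flow t)"
  have q_le: "nrm (?q h) \<le> nrm p" if "0 < h" for h
    unfolding nrm_scale using flow_speed_le[OF p t, of h] that
    by (simp add: divide_le_eq mult.commute del: scaleR_diff_right)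
  have "((\<lambda>h. (nrm (?q h + p))\<^sup>2) \<longlongrightarrow> 0) (at_right 0)"
  proof (rule tendstoI)
    fix e :: real assume e: "0 < e"
    have "\<exists>r>0. 8 * r * nrm p < e"
    proof (intro exI conjI)
      have pos: "0 < 8 * nrm p + 8" using nrm_nonneg[of p] by linarith
      show "0 < e / (8 * nrm p + 8)" using e pos by simp
      have "8 * (e / (8 * nrm p + 8)) * nrm p = e * (8 * nrm p / (8 * nrm p + 8))" by simp
      also have "\<dots> < e * 1" using e pos by (intro mult_strict_left_mono) (auto simp: divide_less_eq)
      finally show "8 * (e / (8 * nrm p + 8)) * nrm p < e" by simp
    qed
    then obtain r where r: "0 < r" "8 * r * nrm p < e" by blast
    from min[OF r(1)] obtain d where d: "0 < d" "\<And>g. g \<in> eps_sub d (flow t) \<Longrightarrow> nrm p - r < nrm g"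
      by blast
    have "\<forall>\<^sub>F h in at_right 0. h < d / (M\<^sup>2 + 1)"
      using d(1) by (intro eventually_at_rightI[of 0 "d / (M\<^sup>2 + 1)"]) (auto simp: add_nonneg_pos)
    moreover have "\<forall>\<^sub>F h :: real in at_right 0. 0 < h" by (rule eventually_at_right_less)
    ultimately show "\<forall>\<^sub>F h in at_right 0. dist ((nrm (?q h + p))\<^sup>2) 0 < e"
    proof eventually_elim
      case (elim h)
      have "h * (M\<^sup>2 + 1) < d" using elim(1) by (simp add: pos_less_divide_eq add_nonneg_pos)
      then have "M\<^sup>2 * h \<le> d" using elim(2) by (simp add: algebra_simps)
      then have "- ?q h \<in> eps_sub d (flow t)" "p \<in> eps_sub d (flow t)"
        using flow_quotient_eps_sub[OF t elim(2)] eps_sub_mono[of "M\<^sup>2 * h" d] p eps_sub_mono[of 0 d] d(1)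
        by auto
      then have "nrm p - r < nrm ((1/2) *\<^sub>R (- ?q h + p))" by (intro d(2) eps_sub_midpoint)
      moreover have "(nrm (?q h + p))\<^sup>2 = 2 * (nrm (- ?q h))\<^sup>2 + 2 * (nrm p)\<^sup>2 - 4 * (nrm ((1/2) *\<^sub>R (- ?q h + p)))\<^sup>2"
        using parallelogram[of "- ?q h" p] nrm_minus[of "?q h + p"] by simp
      moreover have "(nrm (- ?q h))\<^sup>2 \<le> (nrm p)\<^sup>2"
        using q_le[OF elim(2)] unfolding nrm_minus by (intro power_mono) auto
      moreover have "(nrm p)\<^sup>2 - 2 * r * nrm p \<le> (nrm ((1/2) *\<^sub>R (- ?q h + p)))\<^sup>2"
      proof (cases "nrm p \<le> r")
        case True
        have "(nrm p)\<^sup>2 \<le> r * nrm p" unfolding power2_eq_square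
          using True by (intro mult_right_mono) auto
        moreover have "0 \<le> r * nrm p" using r by simp
        ultimately show ?thesis using zero_le_power2[of "nrm ((1/2) *\<^sub>R (- ?q h + p))"] by linarith
      next
        case False
        then have "(nrm p - r)\<^sup>2 \<le> (nrm ((1/2) *\<^sub>R (- ?q h + p)))\<^sup>2"
          using \<open>nrm p - r < _\<close> by (intro power_mono) auto
        moreover have "(nrm p - r)\<^sup>2 = (nrm p)\<^sup>2 - 2 * r * nrm p + r\<^sup>2"
          by (simp add: power2_diff algebra_simps)
        ultimately show ?thesis using zero_le_power2[of r] by linarith
      qed
      ultimately have "(nrm (?q h + p))\<^sup>2 \<le> 8 * r * nrm p" by linarith
      then show ?case using r by (simp add: dist_real_def)
    qed
  qed
  from tendsto_real_sqrt[OF this]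
  have "((\<lambda>h. nrm (?q h + p)) \<longlongrightarrow> 0) (at_right 0)" by simp
  with p show ?thesis by blast
qed

text \<open>The differentiable part of \<open>\<Phi>\<close> can be subtracted from a subgradient: the inequality for \<open>\<Phi>\<close> is used at
\<open>u + s (w - u)\<close> with \<open>s\<close> tending to 0, where the remainder of the quadratic term is of second order.\<close>

lemma F_sub_if_eps_sub:
  assumes g: "g \<in> eps_sub 0 u"
  shows "F u + ip (g - lam *\<^sub>R (u - f)) (w - u) \<le> F w"
proof -
  define e where "e = w - u"
  define A where "A = ip (g - lam *\<^sub>R (u - f)) e"
  have conv: "F (u + s *\<^sub>R e) \<le> F u + s * (F w - F u)" if s: "0 \<le> s" "s \<le> 1" for s
  proof -
    let ?x = "u + s *\<^sub>R e"
    have 1: "F ?x - s * ip (P ?x) e \<le> F u"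
      using F_sub[of ?x u] by (simp add: ip_linear)
    have "w - ?x = (1 - s) *\<^sub>R e" by (simp add: e_def algebra_simps)
    with F_sub[of ?x w] have 2: "F ?x + (1 - s) * ip (P ?x) e \<le> F w" by (simp add: ip_scale_right)
    have "(1 - s) * (F ?x - s * ip (P ?x) e) \<le> (1 - s) * F u"
      "s * (F ?x + (1 - s) * ip (P ?x) e) \<le> s * F w"
      using 1 2 s by (auto intro: mult_left_mono)
    then show ?thesis by (simp add: algebra_simps)
  qed
  have le: "A \<le> F w - F u + s * (lam / 2 * (nrm e)\<^sup>2)" if s: "0 < s" "s \<le> 1" for s
  proof -
    let ?x = "u + s *\<^sub>R e"
    have "ip g (?x - u) \<le> \<Phi> ?x - \<Phi> u" 
    proof -
      have "ip g (?x - u) \<le> \<Phi> ?x - \<Phi> u + 0" using g unfolding eps_sub_def by blast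
      then show ?thesis by simp
    qed
    moreover have "(nrm (?x - f))\<^sup>2 = (nrm (u - f))\<^sup>2 + 2 * s * ip (u - f) e + s\<^sup>2 * (nrm e)\<^sup>2"
      unfolding nrm_power2_shift[of ?x f u] by (simp add: ip_scale_right nrm_scale power_mult_distrib)
    then have "lam / 2 * (nrm (?x - f))\<^sup>2 = lam / 2 * (nrm (u - f))\<^sup>2 + s * (lam * ip (u - f) e) + s * (s * (lam / 2 * (nrm e)\<^sup>2))"
      by (simp add: algebra_simps power2_eq_square)
    ultimately have "s * ip g e \<le> s * (F w - F u) + s * (lam * ip (u - f) e) + s * (s * (lam / 2 * (nrm e)\<^sup>2))"
      using conv[of s] s ip_scale_right[of g s e] unfolding \<Phi>_def add_diff_cancel_left' by argo
    then have "s * A \<le> s * (F w - F u + s * (lam / 2 * (nrm e)\<^sup>2))"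
      unfolding A_def ip_diff_left ip_scale_left by argo
    then show ?thesis using s by simp
  qed
  have "(\<lambda>n. F w - F u + inverse (real (Suc n)) * (lam / 2 * (nrm e)\<^sup>2)) \<longlonglongrightarrow> F w - F u + 0 * (lam / 2 * (nrm e)\<^sup>2)"
    by (intro tendsto_intros LIMSEQ_inverse_real_of_nat)
  then have "A \<le> F w - F u + 0 * (lam / 2 * (nrm e)\<^sup>2)"
    by (rule LIMSEQ_le_const) (use le[of "inverse (real (Suc _))"] in \<open>auto simp: inverse_le_1_iff\<close>)
  then show ?thesis by (simp add: A_def e_def)
qed

end

section \<open>The space of square-integrable functions\<close>

instantiation "fun" :: (type, real_vector) real_vector
begin

definition "a *\<^sub>R f = (\<lambda>x. a *\<^sub>R f x)"

instance
  by standard (simp_all add: scaleR_fun_def fun_eq_iff scaleR_add_right scaleR_add_left)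

end

lemma scaleR_fun_apply [simp]: "(a *\<^sub>R f) x = a *\<^sub>R f x"
  by (simp add: scaleR_fun_def)

locale l2 = finite_measure \<nu> for \<nu> :: "'a measure"
begin

lemma L2_measurable: "u \<in> L2 \<nu> \<Longrightarrow> u \<in> borel_measurable \<nu>"
  by (simp add: L2_def)

lemma L2_integrable_mult:
  assumes "u \<in> L2 \<nu>" "w \<in> L2 \<nu>"
  shows "integrable \<nu> (\<lambda>x. u x * w x)"
proof (rule Bochner_Integration.integrable_bound)
  show "integrable \<nu> (\<lambda>x. (u x)\<^sup>2 + (w x)\<^sup>2)" using assms by (auto simp: L2_def)
  have "\<bar>u x * w x\<bar> \<le> (u x)\<^sup>2 + (w x)\<^sup>2" for x
    using sum_squares_bound[of "\<bar>u x\<bar>" "\<bar>w x\<bar>"] abs_ge_zero[of "u x * w x"]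
    unfolding abs_mult power2_abs by linarith
  then show "AE x in \<nu>. norm (u x * w x) \<le> norm ((u x)\<^sup>2 + (w x)\<^sup>2)" by simp
qed (use assms in \<open>auto simp: L2_def\<close>)

lemma L2_add:
  assumes "u \<in> L2 \<nu>" "w \<in> L2 \<nu>"
  shows "u + w \<in> L2 \<nu>"
proof -
  have "integrable \<nu> (\<lambda>x. (u x)\<^sup>2 + 2 * (u x * w x) + (w x)\<^sup>2)"
    using assms L2_integrable_mult[OF assms] by (auto simp: L2_def)
  moreover have "(\<lambda>x. (u x)\<^sup>2 + 2 * (u x * w x) + (w x)\<^sup>2) = (\<lambda>x. ((u + w) x)\<^sup>2)"
    by (simp add: power2_sum fun_eq_iff)
  moreover have "(\<lambda>x. u x + w x) \<in> borel_measurable \<nu>" using assms by (auto simp: L2_def)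
  ultimately show ?thesis by (simp add: L2_def plus_fun_def)
qed

lemma L2_scale: "u \<in> L2 \<nu> \<Longrightarrow> a *\<^sub>R u \<in> L2 \<nu>"
  by (auto simp: L2_def scaleR_fun_def power_mult_distrib)

lemma L2_zero: "0 \<in> L2 \<nu>"
  by (simp add: L2_def zero_fun_def)

lemma L2_minus: "u \<in> L2 \<nu> \<Longrightarrow> - u \<in> L2 \<nu>"
  using L2_scale[of u "-1"] by simp

lemma L2_diff: "u \<in> L2 \<nu> \<Longrightarrow> w \<in> L2 \<nu> \<Longrightarrow> u - w \<in> L2 \<nu>"
  using L2_add[OF _ L2_minus, of u w] by simp

lemmas L2_closed = L2_zero L2_add L2_scale L2_minus L2_diff

lemma L2_sum: "(\<And>i. i \<in> A \<Longrightarrow> u i \<in> L2 \<nu>) \<Longrightarrow> sum u A \<in> L2 \<nu>"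
  by (induction A rule: infinite_finite_induct) (auto intro: L2_closed)

lemma subspace_L2: "subspace (L2 \<nu>)"
  by (simp add: subspace_def L2_closed)

lemma L2_bounded:
  assumes "u \<in> borel_measurable \<nu>" and "\<And>x. x \<in> space \<nu> \<Longrightarrow> \<bar>u x\<bar> \<le> B"
  shows "u \<in> L2 \<nu>"
proof -
  have "integrable \<nu> (\<lambda>x. (u x)\<^sup>2)"
    using assms by (intro integrable_const_bound[where B = "B\<^sup>2"]) (auto simp: abs_le_square_iff[symmetric] intro!: AE_I2 order_trans[OF assms(2)])
  then show ?thesis using assms by (simp add: L2_def)
qed

lemma L2_integrable: "u \<in> L2 \<nu> \<Longrightarrow> integrable \<nu> u"
  using L2_integrable_mult[of u "\<lambda>_. 1"] L2_bounded[of "\<lambda>_. 1" 1] by simp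

text \<open>A linear projection of all functions onto the square-integrable ones; its kernel is an arbitrary algebraic
complement. It only serves to extend the inner product to all functions.\<close>

definition proj :: "('a \<Rightarrow> real) \<Rightarrow> 'a \<Rightarrow> real" where
  "proj = (SOME g. range g \<subseteq> L2 \<nu> \<and> linear g \<and> (\<forall>u\<in>L2 \<nu>. g u = u))"

lemma proj: "proj u \<in> L2 \<nu>" "linear proj" "u \<in> L2 \<nu> \<Longrightarrow> proj u = u"
proof -
  have "\<exists>g. range g \<subseteq> L2 \<nu> \<and> linear g \<and> (\<forall>u\<in>L2 \<nu>. g (id u) = u)"
    by (rule linear_exists_left_inverse_on) (auto simp: subspace_L2 linear_id[unfolded id_def])
  then have "\<exists>g. range g \<subseteq> L2 \<nu> \<and> linear g \<and> (\<forall>u\<in>L2 \<nu>. g u = u)" by simp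
  from someI_ex[OF this, folded proj_def]
  show "proj u \<in> L2 \<nu>" "linear proj" "u \<in> L2 \<nu> \<Longrightarrow> proj u = u" by auto
qed

lemma proj_linear: "proj (u + w) = proj u + proj w" "proj (u - w) = proj u - proj w" "proj (a *\<^sub>R u) = a *\<^sub>R proj u"
  using proj(2) by (simp_all add: linear_add linear_diff linear_scale)

definition ip :: "('a \<Rightarrow> real) \<Rightarrow> ('a \<Rightarrow> real) \<Rightarrow> real" where
  "ip u w = L2_inner \<nu> (proj u) (proj w)"

lemma ip_eq: "u \<in> L2 \<nu> \<Longrightarrow> w \<in> L2 \<nu> \<Longrightarrow> ip u w = (LINT x|\<nu>. u x * w x)"
  by (simp add: ip_def proj(3) L2_inner_def)

sublocale semi_inner ip
proof
  fix u w z :: "'a \<Rightarrow> real" and a :: real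
  show "ip u w = ip w u" by (simp add: ip_def L2_inner_def mult.commute)
  show "ip (u + w) z = ip u z + ip w z"
    using L2_integrable_mult[OF proj(1) proj(1)]
    by (simp add: ip_def L2_inner_def proj_linear distrib_right)
  show "ip (a *\<^sub>R u) w = a * ip u w"
    by (simp add: ip_def L2_inner_def proj_linear mult.assoc)
  show "0 \<le> ip u u" by (simp add: ip_def L2_inner_def)
qed

lemma nrm_eq: "u \<in> L2 \<nu> \<Longrightarrow> nrm u = L2_norm \<nu> u"
  by (simp add: nrm_def L2_norm_def ip_eq power2_eq_square)

lemma L2_inner_eq_ip: "u \<in> L2 \<nu> \<Longrightarrow> w \<in> L2 \<nu> \<Longrightarrow> L2_inner \<nu> u w = ip u w"
  by (simp add: ip_eq L2_inner_def)

lemma L2_norm_diff: "u \<in> L2 \<nu> \<Longrightarrow> w \<in> L2 \<nu> \<Longrightarrow> L2_norm \<nu> (\<lambda>x. u x - w x) = nrm (u - w)"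
  using nrm_eq[OF L2_diff, of u w] by (simp add: fun_diff_def)

lemma L2_square_integral: "u \<in> L2 \<nu> \<Longrightarrow> (\<integral>\<^sup>+x. ennreal ((u x)\<^sup>2) \<partial>\<nu>) = ennreal ((nrm u)\<^sup>2)"
  unfolding nrm_power2 ip_eq by (subst nn_integral_eq_integral) (auto simp: L2_def power2_eq_square)

lemma nrm_0_iff_AE: "u \<in> L2 \<nu> \<Longrightarrow> nrm u = 0 \<longleftrightarrow> (AE x in \<nu>. u x = 0)"
  by (simp add: nrm_eq L2_norm_def) (auto simp: L2_def integral_nonneg_eq_0_iff_AE)

lemma integral_abs_le: "u \<in> L2 \<nu> \<Longrightarrow> (LINT x|\<nu>. \<bar>u x\<bar>) \<le> sqrt (measure \<nu> (space \<nu>)) * nrm u"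
proof -
  assume u: "u \<in> L2 \<nu>"
  have one: "(\<lambda>_. 1) \<in> L2 \<nu>" by (rule L2_bounded[of _ 1]) auto
  have abs: "(\<lambda>x. \<bar>u x\<bar>) \<in> L2 \<nu>" using u by (auto simp: L2_def)
  have "nrm (\<lambda>_. 1) = sqrt (measure \<nu> (space \<nu>))" by (simp add: nrm_eq[OF one] L2_norm_def)
  moreover have "nrm (\<lambda>x. \<bar>u x\<bar>) = nrm u" by (simp add: nrm_eq[OF abs] nrm_eq[OF u] L2_norm_def)
  ultimately show ?thesis
    using ip_le_nrm[of "\<lambda>_. 1" "\<lambda>x. \<bar>u x\<bar>"] by (simp add: ip_eq[OF one abs])
qed

text \<open>A rapidly converging subsequence has increments that are summable in \<open>L\<^sup>1\<close>, hence converges almost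
everywhere; Fatou's lemma identifies the pointwise limit as the limit in \<open>L\<^sup>2\<close>.\<close>

lemma L2_complete:
  assumes X: "\<And>n. X n \<in> L2 \<nu>"
    and cauchy: "\<And>e. 0 < e \<Longrightarrow> \<exists>N. \<forall>i\<ge>N. \<forall>j\<ge>N. nrm (X i - X j) < e"
  shows "\<exists>l\<in>L2 \<nu>. (\<lambda>n. nrm (X n - l)) \<longlonglongrightarrow> 0"
proof -
  note [measurable] = L2_measurable[OF X]
  have "\<exists>N. \<forall>k. (\<forall>i\<ge>N k. \<forall>j\<ge>N k. nrm (X i - X j) < (1/2) ^ k)"
    by (intro choice allI cauchy) simp
  then obtain N where N: "\<And>k i j. N k \<le> i \<Longrightarrow> N k \<le> j \<Longrightarrow> nrm (X i - X j) < (1/2) ^ k" by blast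
  define r where "r k = (MAX i\<in>{..k}. N i)" for k
  have r_ge: "N k \<le> r k" for k by (simp add: r_def)
  have r_mono: "r k \<le> r (Suc k)" for k unfolding r_def by (intro Max_mono) auto
  have r: "nrm (X (r k) - X (r (Suc k))) < (1/2) ^ k" for k
    using r_ge[of k] r_mono[of k] by (intro N) auto
  define Y where "Y k = X (r k)" for k
  note [measurable] = L2_measurable[OF X[of "r _"], folded Y_def]
  define c where "c = sqrt (measure \<nu> (space \<nu>))"
  have "(\<integral>\<^sup>+x. (\<Sum>k. ennreal \<bar>Y k x - Y (Suc k) x\<bar>) \<partial>\<nu>) = (\<Sum>k. \<integral>\<^sup>+x. ennreal \<bar>Y k x - Y (Suc k) x\<bar> \<partial>\<nu>)"
    by (rule nn_integral_suminf) measurable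
  also have "\<dots> \<le> (\<Sum>k. ennreal (c * (1/2) ^ k))"
  proof (intro suminf_le allI)
    fix k
    have D: "Y k - Y (Suc k) \<in> L2 \<nu>" by (simp add: Y_def X L2_closed)
    have "(\<integral>\<^sup>+x. ennreal \<bar>Y k x - Y (Suc k) x\<bar> \<partial>\<nu>) = ennreal (LINT x|\<nu>. \<bar>(Y k - Y (Suc k)) x\<bar>)"
      by (subst nn_integral_eq_integral[symmetric]) (use integrable_abs[OF L2_integrable[OF D]] in auto)
    also have "\<dots> \<le> ennreal (c * nrm (Y k - Y (Suc k)))"
      using integral_abs_le[OF D] by (intro ennreal_leI) (simp add: c_def)
    also have "\<dots> \<le> ennreal (c * (1/2) ^ k)"
      using r[of k] by (intro ennreal_leI mult_left_mono) (auto simp: Y_def c_def)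
    finally show "(\<integral>\<^sup>+x. ennreal \<bar>Y k x - Y (Suc k) x\<bar> \<partial>\<nu>) \<le> ennreal (c * (1/2) ^ k)" .
  qed auto
  also have "\<dots> < \<infinity>"
    by (subst suminf_ennreal2) (auto simp: c_def intro!: summable_mult summable_geometric)
  finally have "AE x in \<nu>. (\<Sum>k. ennreal \<bar>Y k x - Y (Suc k) x\<bar>) \<noteq> \<infinity>"
    by (intro nn_integral_noteq_infinite) auto
  then have conv: "AE x in \<nu>. (\<lambda>k. Y k x) \<longlonglongrightarrow> lim (\<lambda>k. Y k x)"
  proof eventually_elim
    case (elim x)
    then have "summable (\<lambda>k. \<bar>Y k x - Y (Suc k) x\<bar>)" by (intro summable_suminf_not_top) (auto simp: top.not_eq_extremum)
    then have "summable (\<lambda>k. Y k x - Y (Suc k) x)" by (rule summable_rabs_cancel)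
    then have "summable (\<lambda>k. Y (Suc k) x - Y k x)" using summable_minus by fastforce
    then have "convergent (\<lambda>n. Y n x - Y 0 x)" 
      using sum_lessThan_telescope[of "\<lambda>n. Y n x"] by (simp add: summable_iff_convergent)
    then have "convergent (\<lambda>n. Y n x)" by (simp add: convergent_diff_const_right_iff)
    then show ?case by (simp add: convergent_LIMSEQ_iff)
  qed
  define l where "l x = lim (\<lambda>k. Y k x)" for x
  have [measurable]: "l \<in> borel_measurable \<nu>" unfolding l_def[abs_def] by measurable
  have fatou: "(\<integral>\<^sup>+x. ennreal ((X n x - l x)\<^sup>2) \<partial>\<nu>) \<le> ennreal (((1/2) ^ k)\<^sup>2)" if n: "N k \<le> n" for n k
  proof -
    have "(\<integral>\<^sup>+x. ennreal ((X n x - l x)\<^sup>2) \<partial>\<nu>) = (\<integral>\<^sup>+x. liminf (\<lambda>j. ennreal ((X n x - Y j x)\<^sup>2)) \<partial>\<nu>)"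
    proof (rule nn_integral_cong_AE)
      show "AE x in \<nu>. ennreal ((X n x - l x)\<^sup>2) = liminf (\<lambda>j. ennreal ((X n x - Y j x)\<^sup>2))"
        using conv
      proof eventually_elim
        case (elim x)
        have "(\<lambda>j. ennreal ((X n x - Y j x)\<^sup>2)) \<longlonglongrightarrow> ennreal ((X n x - l x)\<^sup>2)"
          by (intro tendsto_ennrealI tendsto_intros elim[folded l_def])
        then show ?case by (rule lim_imp_Liminf[symmetric, rotated]) simp
      qed
    qed
    also have "\<dots> \<le> liminf (\<lambda>j. \<integral>\<^sup>+x. ennreal ((X n x - Y j x)\<^sup>2) \<partial>\<nu>)"
      by (rule nn_integral_liminf) measurable
    also have "\<dots> \<le> limsup (\<lambda>j. \<integral>\<^sup>+x. ennreal ((X n x - Y j x)\<^sup>2) \<partial>\<nu>)"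
      by (rule Liminf_le_Limsup) simp
    also have "\<dots> \<le> ennreal (((1/2) ^ k)\<^sup>2)"
    proof (rule Limsup_bounded)
      have "(\<integral>\<^sup>+x. ennreal ((X n x - Y j x)\<^sup>2) \<partial>\<nu>) \<le> ennreal (((1/2) ^ k)\<^sup>2)" if j: "k \<le> j" for j
      proof -
        have "r k \<le> r j" using j by (rule lift_Suc_mono_le[of r, OF r_mono])
        then have "N k \<le> r j" using r_ge[of k] by linarith
        then have "nrm (X n - Y j) < (1/2) ^ k" unfolding Y_def by (intro N n)
        then show ?thesis
          using L2_square_integral[OF L2_diff[OF X[of n] X[of "r j"]]]
          by (auto simp: Y_def intro!: ennreal_leI power_mono)
      qed
      then show "\<forall>\<^sub>F j in sequentially. (\<integral>\<^sup>+x. ennreal ((X n x - Y j x)\<^sup>2) \<partial>\<nu>) \<le> ennreal (((1/2) ^ k)\<^sup>2)"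
        by (auto simp: eventually_sequentially)
    qed
    finally show ?thesis .
  qed
  have DL: "X n - l \<in> L2 \<nu>" if "N 0 \<le> n" for n
  proof -
    have "(\<integral>\<^sup>+x. ennreal ((X n x - l x)\<^sup>2) \<partial>\<nu>) < \<infinity>"
      using fatou[OF that] by (auto simp: le_less_trans)
    then have "integrable \<nu> (\<lambda>x. (X n x - l x)\<^sup>2)" by (intro integrableI_nonneg) auto
    moreover have "(\<lambda>x. X n x - l x) \<in> borel_measurable \<nu>" by measurable
    ultimately show ?thesis by (simp add: L2_def fun_diff_def)
  qed
  have "l = X (N 0) - (X (N 0) - l)" by simp
  also have "\<dots> \<in> L2 \<nu>" by (intro L2_diff X DL) simp
  finally have lL: "l \<in> L2 \<nu>" .
  have "(\<lambda>n. nrm (X n - l)) \<longlonglongrightarrow> 0"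
  proof (rule LIMSEQ_I)
    fix e :: real assume e: "0 < e"
    obtain k where k: "(1/2) ^ k < e" using real_arch_pow_inv[OF e, of "1/2"] by auto
    have "nrm (X n - l) < e" if n: "N k \<le> n" for n
    proof -
      have "ennreal ((nrm (X n - l))\<^sup>2) \<le> ennreal (((1/2) ^ k)\<^sup>2)"
        using fatou[OF n] L2_square_integral[OF L2_diff[OF X lL]] by simp
      then have "(nrm (X n - l))\<^sup>2 \<le> ((1/2) ^ k)\<^sup>2" by (subst (asm) ennreal_le_iff) auto
      then have "nrm (X n - l) \<le> (1/2) ^ k" by (rule power2_le_imp_le) simp
      then show ?thesis using k by simp
    qed
    then show "\<exists>no. \<forall>n\<ge>no. norm (nrm (X n - l) - 0) < e" by auto
  qed
  with lL show ?thesis by blast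
qed

sublocale semi_hilbert ip
proof
  fix X :: "nat \<Rightarrow> 'a \<Rightarrow> real"
  assume cauchy: "\<And>e. 0 < e \<Longrightarrow> \<exists>N. \<forall>i\<ge>N. \<forall>j\<ge>N. nrm (X i - X j) < e"
  have eq: "nrm (proj u - proj w) = nrm (u - w)" for u w
    by (simp add: nrm_def ip_def proj_linear proj(3)[OF proj(1)])
  have "\<exists>l\<in>L2 \<nu>. (\<lambda>n. nrm (proj (X n) - l)) \<longlonglongrightarrow> 0"
    using cauchy by (intro L2_complete proj(1)) (simp add: eq)
  then obtain l where "l \<in> L2 \<nu>" "(\<lambda>n. nrm (proj (X n) - l)) \<longlonglongrightarrow> 0" by blast
  then show "\<exists>l. (\<lambda>n. nrm (X n - l)) \<longlonglongrightarrow> 0"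
    using eq[of _ l] by (auto simp: proj(3))
qed

end

section \<open>The total variation of a reversible random walk\<close>

locale walk =
  fixes m :: "'a::polish_space \<Rightarrow> 'a measure" and \<nu> :: "'a measure"
  assumes walk: "random_walk m" and radon: "finite_radon_measure \<nu>" and rev: "reversible m \<nu>"
begin

lemma sets_nu [measurable_cong]: "sets \<nu> = sets borel"
  using radon by (simp add: finite_radon_measure_def)

lemma space_nu [simp]: "space \<nu> = UNIV"
  using sets_eq_imp_space_eq[OF sets_nu] by simp

lemma sets_m [measurable_cong]: "sets (m x) = sets borel"
  using walk by (simp add: random_walk_def)

lemma space_m [simp]: "space (m x) = UNIV"
  using sets_eq_imp_space_eq[OF sets_m] by simp

lemma prob_m: "prob_space (m x)"
  using walk by (intro prob_spaceI) (simp add: random_walk_def)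

sublocale l2 \<nu>
  using radon unfolding finite_radon_measure_def by (intro l2.intro finite_measureI) (metis space_nu)

lemma kernel [measurable]: "m \<in> borel \<rightarrow>\<^sub>M subprob_algebra borel"
  using walk prob_m by (intro measurable_subprob_algebra prob_space_imp_subprob_space) (auto simp: random_walk_def sets_m)

text \<open>The measure \<open>dm\<^sub>x(y) d\<nu>(x)\<close> on pairs. Reversibility is its invariance under exchange of coordinates.\<close>

definition Q :: "('a \<times> 'a) measure" where
  "Q = \<nu> \<bind> (\<lambda>x. distr (m x) (borel \<Otimes>\<^sub>M borel) (\<lambda>y. (x, y)))"

lemma kernel_pair: "(\<lambda>x. distr (m x) (borel \<Otimes>\<^sub>M borel) (\<lambda>y. (x, y))) \<in> \<nu> \<rightarrow>\<^sub>M subprob_algebra (borel \<Otimes>\<^sub>M borel)"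
  by (rule measurable_distr2[where M = borel]) measurable

lemma sets_Q [measurable_cong]: "sets Q = sets (borel \<Otimes>\<^sub>M borel)"
  unfolding Q_def by (rule sets_bind) auto

lemma space_Q [simp]: "space Q = UNIV"
  using sets_eq_imp_space_eq[OF sets_Q] by (simp add: space_pair_measure)

lemma nn_integral_Q:
  assumes [measurable]: "g \<in> borel_measurable (borel \<Otimes>\<^sub>M borel)"
  shows "(\<integral>\<^sup>+z. g z \<partial>Q) = (\<integral>\<^sup>+x. \<integral>\<^sup>+y. g (x, y) \<partial>m x \<partial>\<nu>)"
  unfolding Q_def by (subst nn_integral_bind[OF assms kernel_pair]) (simp add: nn_integral_distr)

lemma emeasure_Q:
  assumes [measurable]: "A \<in> sets (borel \<Otimes>\<^sub>M borel)"
  shows "emeasure Q A = (\<integral>\<^sup>+x. emeasure (m x) {y. (x, y) \<in> A} \<partial>\<nu>)"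
proof -
  have "emeasure Q A = (\<integral>\<^sup>+x. \<integral>\<^sup>+y. indicator A (x, y) \<partial>m x \<partial>\<nu>)"
    by (subst nn_integral_Q[symmetric]) (simp_all add: sets_Q)
  also have "\<dots> = (\<integral>\<^sup>+x. emeasure (m x) {y. (x, y) \<in> A} \<partial>\<nu>)"
  proof (intro nn_integral_cong)
    fix x
    have "{y. (x, y) \<in> A} \<in> sets (m x)"
      using measurable_sets[OF measurable_Pair1'[of x borel borel] assms] by (simp add: sets_m vimage_def)
    moreover have "(\<lambda>y. indicator A (x, y) :: ennreal) = indicator {y. (x, y) \<in> A}"
      by (simp add: indicator_def fun_eq_iff)
    ultimately show "(\<integral>\<^sup>+y. indicator A (x, y) \<partial>m x) = emeasure (m x) {y. (x, y) \<in> A}"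
      by (simp only: nn_integral_indicator)
  qed
  finally show ?thesis .
qed

lemma Q_symmetric: "distr Q (borel \<Otimes>\<^sub>M borel) (\<lambda>(x, y). (y, x)) = Q"
proof (rule measure_eqI)
  fix A assume "A \<in> sets (distr Q (borel \<Otimes>\<^sub>M borel) (\<lambda>(x, y). (y, x)))"
  then have A [measurable]: "A \<in> sets (borel \<Otimes>\<^sub>M borel)" by simp
  let ?B = "(\<lambda>(x, y). (y, x)) -` A"
  have "?B \<in> sets (borel \<Otimes>\<^sub>M borel)"
    using measurable_sets[OF measurable_pair_swap' A] by (simp add: space_pair_measure)
  then have "emeasure (distr Q (borel \<Otimes>\<^sub>M borel) (\<lambda>(x, y). (y, x))) A
      = (\<integral>\<^sup>+x. emeasure (m x) {y. (y, x) \<in> A} \<partial>\<nu>)"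
    by (subst emeasure_distr) (simp_all add: emeasure_Q vimage_def)
  also have "\<dots> = emeasure Q A"
  proof -
    have "A \<in> sets borel" using A unfolding borel_prod .
    then show ?thesis using rev unfolding reversible_def emeasure_Q[OF A] by (auto dest: sym)
  qed
  finally show "emeasure (distr Q (borel \<Otimes>\<^sub>M borel) (\<lambda>(x, y). (y, x))) A = emeasure Q A" .
qed (simp add: sets_Q)

lemma integral_Q_swap:
  fixes g :: "'a \<times> 'a \<Rightarrow> real"
  assumes [measurable]: "g \<in> borel_measurable (borel \<Otimes>\<^sub>M borel)"
  shows "(LINT z|Q. g (snd z, fst z)) = (LINT z|Q. g z)"
    and "integrable Q (\<lambda>z. g (snd z, fst z)) \<longleftrightarrow> integrable Q g"
proof -
  have swap: "(\<lambda>(x, y). (y, x)) \<in> Q \<rightarrow>\<^sub>M borel \<Otimes>\<^sub>M borel" by measurable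
  show "(LINT z|Q. g (snd z, fst z)) = (LINT z|Q. g z)"
    using integral_distr[OF swap assms] unfolding Q_symmetric by (simp add: split_def)
  show "integrable Q (\<lambda>z. g (snd z, fst z)) \<longleftrightarrow> integrable Q g"
    using integrable_distr_eq[OF swap assms] unfolding Q_symmetric by (simp add: split_def)
qed

lemma integrable_fst:
  fixes g :: "'a \<Rightarrow> real"
  assumes g: "integrable \<nu> g"
  shows "integrable Q (\<lambda>z. g (fst z))"
proof -
  have [measurable]: "g \<in> borel_measurable borel"
    using borel_measurable_integrable[OF g] by (simp add: measurable_cong_sets[OF sets_nu refl])
  have "(\<integral>\<^sup>+z. ennreal (norm (g (fst z))) \<partial>Q) = (\<integral>\<^sup>+x. ennreal (norm (g x)) \<partial>\<nu>)"
    by (subst nn_integral_Q) (auto simp: prob_space.emeasure_space_1[OF prob_m, simplified])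
  then show ?thesis using g by (auto simp: integrable_iff_bounded)
qed

lemma integrable_snd:
  fixes g :: "'a \<Rightarrow> real"
  assumes g: "integrable \<nu> g"
  shows "integrable Q (\<lambda>z. g (snd z))"
proof -
  have [measurable]: "g \<in> borel_measurable borel"
    using borel_measurable_integrable[OF g] by (simp add: measurable_cong_sets[OF sets_nu refl])
  show ?thesis using integral_Q_swap(2)[of "\<lambda>z. g (fst z)"] integrable_fst[OF g] by simp
qed

lemma integral_kernel_measurable:
  fixes g :: "'a \<times> 'a \<Rightarrow> real"
  assumes [measurable]: "g \<in> borel_measurable (borel \<Otimes>\<^sub>M borel)"
  shows "(\<lambda>x. LINT y|m x. g (x, y)) \<in> borel_measurable \<nu>"
proof -
  have "(\<lambda>x. LINT z|distr (m x) (borel \<Otimes>\<^sub>M borel) (\<lambda>y. (x, y)). g z) \<in> borel_measurable \<nu>"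
    by (rule measurable_compose[OF kernel_pair integral_measurable_subprob_algebra[OF assms]])
  then show ?thesis by (simp add: integral_distr)
qed

text \<open>Fubini's theorem for the kernel \<open>m\<close>, obtained from the nonnegative case applied to the positive and negative parts.\<close>

lemma integral_Q:
  fixes g :: "'a \<times> 'a \<Rightarrow> real"
  assumes g: "integrable Q g"
  shows "(LINT z|Q. g z) = (LINT x|\<nu>. LINT y|m x. g (x, y))"
proof -
  have [measurable]: "g \<in> borel_measurable (borel \<Otimes>\<^sub>M borel)"
    using borel_measurable_integrable[OF g] by (simp add: measurable_cong_sets[OF sets_Q refl])
  have part: "(\<integral>\<^sup>+z. ennreal (k z) \<partial>Q) = (\<integral>\<^sup>+x. \<integral>\<^sup>+y. ennreal (k (x, y)) \<partial>m x \<partial>\<nu>)"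
    "(\<integral>\<^sup>+z. ennreal (k z) \<partial>Q) \<noteq> \<infinity> \<Longrightarrow> AE x in \<nu>. (\<integral>\<^sup>+y. ennreal (k (x, y)) \<partial>m x) \<noteq> \<infinity>"
    "(\<integral>\<^sup>+z. ennreal (k z) \<partial>Q) \<noteq> \<infinity> \<Longrightarrow>
      has_bochner_integral \<nu> (\<lambda>x. enn2real (\<integral>\<^sup>+y. ennreal (k (x, y)) \<partial>m x)) (enn2real (\<integral>\<^sup>+z. ennreal (k z) \<partial>Q))"
    if k[measurable]: "k \<in> borel_measurable (borel \<Otimes>\<^sub>M borel)" for k :: "'a \<times> 'a \<Rightarrow> real"
  proof -
    have meas: "(\<lambda>x. \<integral>\<^sup>+y. ennreal (k (x, y)) \<partial>m x) \<in> borel_measurable \<nu>"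
      by (rule nn_integral_measurable_subprob_algebra2[where N = borel]) measurable
    show eq: "(\<integral>\<^sup>+z. ennreal (k z) \<partial>Q) = (\<integral>\<^sup>+x. \<integral>\<^sup>+y. ennreal (k (x, y)) \<partial>m x \<partial>\<nu>)"
      by (rule nn_integral_Q) measurable
    assume fin: "(\<integral>\<^sup>+z. ennreal (k z) \<partial>Q) \<noteq> \<infinity>"
    then show ae: "AE x in \<nu>. (\<integral>\<^sup>+y. ennreal (k (x, y)) \<partial>m x) \<noteq> \<infinity>"
      unfolding eq by (intro nn_integral_noteq_infinite meas)
    have "(\<integral>\<^sup>+x. ennreal (enn2real (\<integral>\<^sup>+y. ennreal (k (x, y)) \<partial>m x)) \<partial>\<nu>) = ennreal (enn2real (\<integral>\<^sup>+z. ennreal (k z) \<partial>Q))"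
      using ae fin unfolding eq
      by (auto simp: ennreal_enn2real_if less_top intro!: nn_integral_cong_AE elim!: eventually_mono)
    then show "has_bochner_integral \<nu> (\<lambda>x. enn2real (\<integral>\<^sup>+y. ennreal (k (x, y)) \<partial>m x)) (enn2real (\<integral>\<^sup>+z. ennreal (k z) \<partial>Q))"
      using meas by (intro has_bochner_integral_nn_integral) auto
  qed
  have fin: "(\<integral>\<^sup>+z. ennreal (g z) \<partial>Q) \<noteq> \<infinity>" "(\<integral>\<^sup>+z. ennreal (- g z) \<partial>Q) \<noteq> \<infinity>"
    using g by (auto simp: real_integrable_def)
  let ?k = "\<lambda>x. enn2real (\<integral>\<^sup>+y. ennreal (g (x, y)) \<partial>m x) - enn2real (\<integral>\<^sup>+y. ennreal (- g (x, y)) \<partial>m x)"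
  have k: "has_bochner_integral \<nu> ?k (enn2real (\<integral>\<^sup>+z. ennreal (g z) \<partial>Q) - enn2real (\<integral>\<^sup>+z. ennreal (- g z) \<partial>Q))"
    by (intro has_bochner_integral_diff part(3) fin) measurable
  have "AE x in \<nu>. (\<integral>\<^sup>+y. ennreal (g (x, y)) \<partial>m x) \<noteq> \<infinity>"
    "AE x in \<nu>. (\<integral>\<^sup>+y. ennreal (- g (x, y)) \<partial>m x) \<noteq> \<infinity>"
    by (intro part(2) fin; measurable)+
  then have ae: "AE x in \<nu>. (LINT y|m x. g (x, y)) = ?k x"
  proof eventually_elim
    case (elim x)
    have "(\<lambda>y. g (x, y)) \<in> borel_measurable (m x)" by measurable
    then have "integrable (m x) (\<lambda>y. g (x, y))" using elim by (simp add: real_integrable_def)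
    then show ?case by (simp add: real_lebesgue_integral_def)
  qed
  have "(LINT x|\<nu>. LINT y|m x. g (x, y)) = (LINT x|\<nu>. ?k x)"
    by (rule integral_cong_AE[OF integral_kernel_measurable borel_measurable_has_bochner_integral[OF k] ae]) measurable
  also have "\<dots> = enn2real (\<integral>\<^sup>+z. ennreal (g z) \<partial>Q) - enn2real (\<integral>\<^sup>+z. ennreal (- g z) \<partial>Q)"
    by (rule has_bochner_integral_integral_eq[OF k])
  finally show ?thesis using g by (simp add: real_lebesgue_integral_def)
qed

definition F :: "('a \<Rightarrow> real) \<Rightarrow> real" where
  "F u = (LINT z|Q. \<bar>u (snd z) - u (fst z)\<bar>) / 2"

lemma L2_borel: "u \<in> L2 \<nu> \<Longrightarrow> u \<in> borel_measurable borel"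
  using L2_measurable[of u] by (simp add: measurable_cong_sets[OF sets_nu refl])

lemma integrable_variation:
  assumes "u \<in> L2 \<nu>"
  shows "integrable Q (\<lambda>z. \<bar>u (snd z) - u (fst z)\<bar>)"
  using integrable_fst[OF L2_integrable[OF assms]] integrable_snd[OF L2_integrable[OF assms]]
  by (intro integrable_abs Bochner_Integration.integrable_diff)

lemma TV_eq_F:
  assumes u: "u \<in> L2 \<nu>"
  shows "enn2ereal (TV m \<nu> u) = ereal (F u)"
proof -
  note [measurable] = L2_borel[OF u]
  have "TV m \<nu> u = (\<integral>\<^sup>+z. ennreal \<bar>u (snd z) - u (fst z)\<bar> \<partial>Q) / 2"
    unfolding TV_def by (subst nn_integral_Q) simp_all
  also have "\<dots> = ennreal (LINT z|Q. \<bar>u (snd z) - u (fst z)\<bar>) / 2"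
    by (subst nn_integral_eq_integral) (simp_all add: integrable_variation[OF u])
  also have "\<dots> = ennreal (F u)"
    unfolding F_def by (subst divide_ennreal[symmetric]) (simp_all)
  finally show ?thesis by (simp add: F_def enn2ereal_ennreal)
qed

lemma subdifferential_TV_iff:
  "p \<in> subdifferential \<nu> (\<lambda>w. enn2ereal (TV m \<nu> w)) u \<longleftrightarrow>
    p \<in> L2 \<nu> \<and> u \<in> L2 \<nu> \<and> (\<forall>w\<in>L2 \<nu>. F u + ip p (w - u) \<le> F w)"
proof (cases "p \<in> L2 \<nu> \<and> u \<in> L2 \<nu>")
  case True
  have "L2_inner \<nu> p (\<lambda>x. w x - u x) = ip p (w - u)" if "w \<in> L2 \<nu>" for w
    using L2_inner_eq_ip[OF _ L2_diff[OF that], of p u] True by (simp add: fun_diff_def)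
  then show ?thesis using True by (auto simp: subdifferential_def TV_eq_F)
qed (auto simp: subdifferential_def)

text \<open>The operator \<open>- \<Delta>\<^sub>1\<close> in which the multivalued sign of 0 has been set to 0.\<close>

definition sub :: "('a \<Rightarrow> real) \<Rightarrow> 'a \<Rightarrow> real" where
  "sub u x = (LINT y|m x. sgn (u x - u y))"

lemma sub_measurable:
  assumes [measurable]: "u \<in> borel_measurable borel"
  shows "sub u \<in> borel_measurable borel"
  unfolding sub_def[abs_def]
  using integral_kernel_measurable[of "\<lambda>z. sgn (u (fst z) - u (snd z))"]
  by (simp add: measurable_cong_sets[OF sets_nu refl])

lemma sub_abs_le: "\<bar>sub u x\<bar> \<le> 1"
proof -
  interpret prob_space "m x" by (rule prob_m)
  have "\<bar>sub u x\<bar> \<le> (LINT y|m x. \<bar>sgn (u x - u y)\<bar>)" unfolding sub_def by (rule integral_abs_bound)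
  also have "\<dots> \<le> (LINT y|m x. 1)"
    by (rule integral_mono') (auto simp: sgn_if)
  finally show ?thesis by (simp add: prob_space[simplified])
qed

lemma sub_L2: "u \<in> L2 \<nu> \<Longrightarrow> sub u \<in> L2 \<nu>"
  using sub_measurable[OF L2_borel] sub_abs_le
  by (intro L2_bounded[where B = 1]) (auto simp: measurable_cong_sets[OF sets_nu refl])

definition C :: real where "C = sqrt (measure \<nu> UNIV)"

lemma nrm_sub_le:
  assumes u: "u \<in> L2 \<nu>"
  shows "nrm (sub u) \<le> C"
proof -
  have sq: "(sub u x)\<^sup>2 \<le> 1" for x using sub_abs_le[of u x] by (simp add: abs_square_le_1)
  have "(LINT x|\<nu>. (sub u x)\<^sup>2) \<le> (LINT x|\<nu>. 1)"
    using sub_L2[OF u] sq by (intro integral_mono) (auto simp: L2_def)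
  then show ?thesis by (simp add: nrm_eq[OF sub_L2[OF u]] L2_norm_def C_def)
qed

text \<open>Convexity of the absolute value gives the inequality pointwise in \<open>(x, y)\<close>; as the sign of
\<open>u x - u y\<close> is antisymmetric and \<open>Q\<close> is symmetric, the contributions of \<open>e x\<close> and of \<open>e y\<close>, where
\<open>e = w - u\<close>, are equal.\<close>

lemma sub_subgradient:
  assumes u: "u \<in> L2 \<nu>" and w: "w \<in> L2 \<nu>"
  shows "F u + ip (sub u) (w - u) \<le> F w"
proof -
  define e where "e = w - u"
  have e: "e \<in> L2 \<nu>" unfolding e_def by (intro L2_diff assms)
  note [measurable] = L2_borel[OF u] L2_borel[OF w] L2_borel[OF e]
  define s where "s z = sgn (u (fst z) - u (snd z))" for z
  have int1: "integrable Q (\<lambda>z. s z * e (fst z))"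
    by (rule Bochner_Integration.integrable_bound[OF integrable_fst[OF L2_integrable[OF e]]])
       (auto simp: s_def abs_mult sgn_if)
  have int2: "integrable Q (\<lambda>z. s z * e (snd z))"
    by (rule Bochner_Integration.integrable_bound[OF integrable_snd[OF L2_integrable[OF e]]])
       (auto simp: s_def abs_mult sgn_if)
  have "(LINT z|Q. s z * e (fst z)) = (LINT x|\<nu>. LINT y|m x. s (x, y) * e x)"
    by (subst integral_Q[OF int1]) simp
  also have "\<dots> = ip (sub u) e"
    by (simp add: ip_eq[OF sub_L2[OF u] e] s_def sub_def)
  finally have 1: "(LINT z|Q. s z * e (fst z)) = ip (sub u) e" .
  have "(LINT z|Q. s z * e (snd z)) = (LINT z|Q. s (snd z, fst z) * e (fst z))"
    by (subst integral_Q_swap(1)[of "\<lambda>z. s z * e (snd z)", symmetric]) (auto simp: s_def)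
  also have "\<dots> = (LINT z|Q. - (s z * e (fst z)))"
  proof (rule Bochner_Integration.integral_cong)
    have "sgn (a - b) = - sgn (b - a)" for a b :: real by (simp add: sgn_if)
    then show "s (snd z, fst z) * e (fst z) = - (s z * e (fst z))" for z
      unfolding s_def by (metis fst_conv minus_mult_left snd_conv)
  qed simp
  also have "\<dots> = - (LINT z|Q. s z * e (fst z))" by simp
  finally have 2: "(LINT z|Q. s z * e (snd z)) = - ip (sub u) e" using 1 by simp
  have "(LINT z|Q. \<bar>u (snd z) - u (fst z)\<bar> + (s z * e (fst z) - s z * e (snd z))) \<le> (LINT z|Q. \<bar>w (snd z) - w (fst z)\<bar>)"
  proof (rule integral_mono)
    fix z
    have "\<bar>a\<bar> + sgn (- a) * (a - b) \<le> \<bar>b\<bar>" for a b :: real by (auto simp: sgn_if)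
    from this[of "u (snd z) - u (fst z)" "w (snd z) - w (fst z)"]
    show "\<bar>u (snd z) - u (fst z)\<bar> + (s z * e (fst z) - s z * e (snd z)) \<le> \<bar>w (snd z) - w (fst z)\<bar>"
      by (simp add: s_def e_def algebra_simps)
  qed (intro Bochner_Integration.integrable_add Bochner_Integration.integrable_diff int1 int2 integrable_variation u w)+
  then show ?thesis
    using 1 2 int1 int2 integrable_variation[OF u] by (simp add: F_def e_def)
qed

text \<open>An arbitrary subgradient \<open>p\<close> is tested with the direction \<open>p\<close> itself; the resulting increment of the total variation
is controlled by the bounded selection \<open>sub\<close>.\<close>

lemma subgradient_bound:
  assumes p: "p \<in> subdifferential \<nu> (\<lambda>w. enn2ereal (TV m \<nu> w)) u"
  shows "nrm p \<le> C"
proof -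
  have pL: "p \<in> L2 \<nu>" and uL: "u \<in> L2 \<nu>" and le: "\<And>w. w \<in> L2 \<nu> \<Longrightarrow> F u + ip p (w - u) \<le> F w"
    using p by (auto simp: subdifferential_TV_iff)
  have wL: "u + p \<in> L2 \<nu>" by (intro L2_add pL uL)
  have "(nrm p)\<^sup>2 \<le> F (u + p) - F u" using le[OF wL] by (simp add: nrm_power2)
  also have "\<dots> \<le> ip (sub (u + p)) p" using sub_subgradient[OF wL uL] by (simp add: ip_minus_right)
  also have "\<dots> \<le> C * nrm p"
    by (rule order_trans[OF ip_le_nrm]) (intro mult_right_mono nrm_sub_le wL, simp)
  finally show ?thesis
    by (cases "nrm p = 0") (auto simp: C_def power2_eq_square less_le)
qed

text \<open>For each pair of points the increment of \<open>h\<close> lies between 0 and the difference of the increments of \<open>v\<close>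
and \<open>w\<close>. So \<open>h\<close> moves these two increments towards each other and keeps their sum,
which cannot increase the sum of their absolute values.\<close>

lemma TV_exchange:
  assumes v: "v \<in> L2 \<nu>" and w: "w \<in> L2 \<nu>" and h: "h \<in> L2 \<nu>" and hb: "h = (\<lambda>x. b (v x - w x))"
    and b: "\<And>r s. r \<le> s \<Longrightarrow> b r \<le> b s \<and> b s - b r \<le> s - r"
  shows "F (v - h) + F (w + h) \<le> F v + F w"
proof -
  have vh: "v - h \<in> L2 \<nu>" and wh: "w + h \<in> L2 \<nu>" using v w h by (auto intro: L2_closed)
  have "(LINT z|Q. \<bar>(v - h) (snd z) - (v - h) (fst z)\<bar> + \<bar>(w + h) (snd z) - (w + h) (fst z)\<bar>)
     \<le> (LINT z|Q. \<bar>v (snd z) - v (fst z)\<bar> + \<bar>w (snd z) - w (fst z)\<bar>)"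
  proof (rule integral_mono)
    fix z
    show "\<bar>(v - h) (snd z) - (v - h) (fst z)\<bar> + \<bar>(w + h) (snd z) - (w + h) (fst z)\<bar>
      \<le> \<bar>v (snd z) - v (fst z)\<bar> + \<bar>w (snd z) - w (fst z)\<bar>"
      using b[of "v (fst z) - w (fst z)" "v (snd z) - w (snd z)"]
        b[of "v (snd z) - w (snd z)" "v (fst z) - w (fst z)"]
      unfolding hb by (simp add: abs_if) linarith
  qed (intro Bochner_Integration.integrable_add integrable_variation v w vh wh)+
  then show ?thesis
    using integrable_variation[OF v] integrable_variation[OF w] integrable_variation[OF vh] integrable_variation[OF wh]
    by (simp add: F_def)
qed

text \<open>Add the subgradient inequality for \<open>v\<close> at \<open>v - h\<close> to the one for \<open>w\<close> at \<open>w + h\<close>.\<close>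

lemma subdifferential_accretive:
  assumes p: "p \<in> subdifferential \<nu> (\<lambda>w. enn2ereal (TV m \<nu> w)) v"
    and q: "q \<in> subdifferential \<nu> (\<lambda>w. enn2ereal (TV m \<nu> w)) w"
    and h: "h \<in> L2 \<nu>" "h = (\<lambda>x. b (v x - w x))"
    and b: "\<And>r s. r \<le> s \<Longrightarrow> b r \<le> b s \<and> b s - b r \<le> s - r"
  shows "0 \<le> ip (p - q) h"
proof -
  have L: "v \<in> L2 \<nu>" "w \<in> L2 \<nu>" using p q by (auto simp: subdifferential_TV_iff)
  have "F v + ip p ((v - h) - v) \<le> F (v - h)"
    using p L h(1) unfolding subdifferential_TV_iff by (blast intro: L2_diff)
  moreover have "F w + ip q ((w + h) - w) \<le> F (w + h)"
    using q L h(1) unfolding subdifferential_TV_iff by (blast intro: L2_add)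
  ultimately show ?thesis
    using TV_exchange[OF L h b] by (simp add: ip_diff_left ip_minus_right)
qed

text \<open>The abstract flow for \<open>F \<circ> proj\<close>, projected back to square-integrable functions.\<close>

lemma gradient_flow_exists:
  assumes lam: "0 < lam" and f: "f \<in> L2 \<nu>" and u\<^sub>0: "u\<^sub>0 \<in> L2 \<nu>"
  obtains v v' K where "\<And>t. v t \<in> L2 \<nu>" "\<And>t. v' t \<in> L2 \<nu>"
    "nrm (v 0 - u\<^sub>0) = 0"
    "\<And>t h. 0 \<le> t \<Longrightarrow> 0 \<le> h \<Longrightarrow> nrm (v (t + h) - v t) \<le> K * h"
    "\<And>t. 0 \<le> t \<Longrightarrow> ((\<lambda>h. nrm ((1 / h) *\<^sub>R (v (t + h) - v t) - v' t)) \<longlongrightarrow> 0) (at_right 0)"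
    "\<And>t. 0 \<le> t \<Longrightarrow> (\<lambda>x. lam * (v t x - f x) + v' t x) \<in> one_laplacian m \<nu> (v t)"
proof -
  interpret S: subgradient_flow ip "\<lambda>u. F (proj u)" "\<lambda>u. sub (proj u)" C lam f u\<^sub>0
  proof
    fix u w
    have "ip (sub (proj u)) (w - u) = ip (sub (proj u)) (proj w - proj u)"
      by (simp add: ip_def proj_linear proj(3)[OF proj(1)])
    then show "F (proj u) + ip (sub (proj u)) (w - u) \<le> F (proj w)"
      using sub_subgradient[OF proj(1) proj(1), of u w] by simp
    show "nrm (sub (proj u)) \<le> C" by (rule nrm_sub_le[OF proj(1)])
  qed (rule lam)
  have nrm_proj_eq: "nrm (proj u) = nrm u" for u
    by (simp add: nrm_def ip_def proj_linear proj(3)[OF proj(1)])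
  have ip_proj: "ip (proj u) w = ip u w" "ip w (proj u) = ip w u" for u w
    by (simp_all add: ip_def proj(3)[OF proj(1)])
  have "\<forall>t. \<exists>p. 0 \<le> t \<longrightarrow> p \<in> S.eps_sub 0 (S.flow t) \<and>
      ((\<lambda>h. nrm ((1 / h) *\<^sub>R (S.flow (t + h) - S.flow t) + p)) \<longlongrightarrow> 0) (at_right 0)"
    using S.flow_right_derivative by blast
  from choice[OF this] obtain p where p: "\<And>t. 0 \<le> t \<Longrightarrow> p t \<in> S.eps_sub 0 (S.flow t)"
    and lim: "\<And>t. 0 \<le> t \<Longrightarrow>
      ((\<lambda>h. nrm ((1 / h) *\<^sub>R (S.flow (t + h) - S.flow t) + p t)) \<longlongrightarrow> 0) (at_right 0)"
    by blast
  show thesis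
  proof (rule that[of "\<lambda>t. proj (S.flow t)" "\<lambda>t. proj (- p t)" "2 * S.M"])
    fix t :: real assume t: "0 \<le> t"
    have e: "(1 / h) *\<^sub>R (proj (S.flow (t + h)) - proj (S.flow t)) - proj (- p t)
        = proj ((1 / h) *\<^sub>R (S.flow (t + h) - S.flow t) + p t)" for h
      using proj_linear(3)[of "- 1" "p t"] by (simp add: proj_linear)
    show "((\<lambda>h. nrm ((1 / h) *\<^sub>R (proj (S.flow (t + h)) - proj (S.flow t)) - proj (- p t))) \<longlongrightarrow> 0) (at_right 0)"
      unfolding e nrm_proj_eq by (rule lim[OF t])
    let ?g = "p t - lam *\<^sub>R (S.flow t - f)"
    have "proj ?g \<in> subdifferential \<nu> (\<lambda>w. enn2ereal (TV m \<nu> w)) (proj (S.flow t))"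
      unfolding subdifferential_TV_iff
    proof (intro conjI ballI proj(1))
      fix w assume w: "w \<in> L2 \<nu>"
      have "ip (proj ?g) (w - proj (S.flow t)) = ip ?g (w - S.flow t)"
        by (simp add: ip_diff_right ip_proj)
      then show "F (proj (S.flow t)) + ip (proj ?g) (w - proj (S.flow t)) \<le> F w"
        using S.F_sub_if_eps_sub[OF p[OF t], of w] by (simp add: proj(3)[OF w])
    qed
    moreover have "proj ?g = (\<lambda>x. - (lam * (proj (S.flow t) x - f x) + proj (- p t) x))"
      using proj_linear(3)[of "- 1" "p t"] by (simp add: proj_linear proj(3)[OF f] fun_eq_iff)
    ultimately show "(\<lambda>x. lam * (proj (S.flow t) x - f x) + proj (- p t) x) \<in> one_laplacian m \<nu> (proj (S.flow t))"
      by (simp add: one_laplacian_def)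
    fix h :: real assume h: "0 \<le> h"
    show "nrm (proj (S.flow (t + h)) - proj (S.flow t)) \<le> 2 * S.M * h"
      using S.flow_lipschitz[OF t h] nrm_proj_eq[of "S.flow (t + h) - S.flow t"] by (simp add: proj_linear)
  next
    show "nrm (proj (S.flow 0) - u\<^sub>0) = 0"
      using S.flow_0 nrm_proj_eq[of "S.flow 0 - u\<^sub>0"] by (simp add: proj_linear proj(3)[OF u\<^sub>0])
  qed (rule proj(1))+
qed

end

section \<open>Bochner integrals of functions of time\<close>

lemma sum_fun_apply: "sum f A x = (\<Sum>i\<in>A. f i x)" for f :: "'i \<Rightarrow> 'a \<Rightarrow> 'b::comm_monoid_add"
  by (induction A rule: infinite_finite_induct) auto

lemma has_bochner_integral_simple_compose:
  fixes \<phi> :: "'b \<Rightarrow> real"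
  assumes "finite_measure M" and s: "simple_function M s"
  shows "has_bochner_integral M (\<lambda>t. \<phi> (s t)) (\<Sum>h\<in>s ` space M. measure M {t\<in>space M. s t = h} * \<phi> h)"
proof -
  interpret finite_measure M by fact
  have sets: "{t\<in>space M. s t = h} \<in> sets M" if "h \<in> s ` space M" for h
    using simple_functionD(2)[OF s, of "{h}"] by (simp add: vimage_def Int_def conj_commute)
  have "has_bochner_integral M (\<lambda>t. \<Sum>h\<in>s ` space M. indicator {t\<in>space M. s t = h} t * \<phi> h)
      (\<Sum>h\<in>s ` space M. measure M {t\<in>space M. s t = h} * \<phi> h)"
    by (intro has_bochner_integral_sum has_bochner_integral_mult_left has_bochner_integral_real_indicator sets)
       (auto simp: emeasure_eq_measure)
  then show ?thesis
  proof (rule has_bochner_integral_cong[THEN iffD1, rotated 3])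
    fix t assume t: "t \<in> space M"
    have "(\<Sum>h\<in>s ` space M. indicator {t\<in>space M. s t = h} t * \<phi> h) = (\<Sum>h\<in>s ` space M. if s t = h then \<phi> h else 0)"
      using t by (intro sum.cong) auto
    also have "\<dots> = \<phi> (s t)" using t simple_functionD(1)[OF s] by simp
    finally show "(\<Sum>h\<in>s ` space M. indicator {t\<in>space M. s t = h} t * \<phi> h) = \<phi> (s t)" .
  qed simp_all
qed

lemma integrable_simple_compose:
  fixes \<phi> :: "'b \<Rightarrow> real"
  shows "finite_measure M \<Longrightarrow> simple_function M s \<Longrightarrow> integrable M (\<lambda>t. \<phi> (s t))"
  using has_bochner_integral_simple_compose[of M s \<phi>] by (rule integrable.intros)

context l2
begin

lemma L2_simple_integral_L2:
  assumes s: "L2_simple \<nu> M s"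
  shows "L2_simple_integral M s \<in> L2 \<nu>"
proof -
  have "(\<Sum>h\<in>s ` space M. measure M {t\<in>space M. s t = h} *\<^sub>R h) \<in> L2 \<nu>"
    using s by (intro L2_sum L2_scale) (auto simp: L2_simple_def)
  also have "(\<Sum>h\<in>s ` space M. measure M {t\<in>space M. s t = h} *\<^sub>R h) = L2_simple_integral M s"
    by (simp add: L2_simple_integral_def sum_fun_apply fun_eq_iff)
  finally show ?thesis .
qed

lemma ip_sum_right: "ip w (sum g A) = (\<Sum>i\<in>A. ip w (g i))"
  by (induction A rule: infinite_finite_induct)
     (simp_all only: sum.infinite sum.empty sum.insert ip_zero_right ip_add_right not_False_eq_True)

lemma ip_simple_integral:
  assumes "finite_measure M" and s: "L2_simple \<nu> M s"
  shows "ip w (L2_simple_integral M s) = (LINT t|M. ip w (s t))"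
proof -
  have "L2_simple_integral M s = (\<Sum>h\<in>s ` space M. measure M {t\<in>space M. s t = h} *\<^sub>R h)"
    by (simp add: L2_simple_integral_def sum_fun_apply fun_eq_iff)
  then show ?thesis
    using has_bochner_integral_simple_compose[OF assms(1), of s "ip w"] s
    by (simp add: L2_simple_def ip_sum_right ip_scale_right has_bochner_integral_integral_eq)
qed

text \<open>The triangle inequality for integrals, obtained by pairing the difference with itself.\<close>

lemma nrm_simple_integral_diff:
  assumes fin: "finite_measure M" and s: "L2_simple \<nu> M s" and s': "L2_simple \<nu> M s'"
  shows "nrm (L2_simple_integral M s - L2_simple_integral M s') \<le> (LINT t|M. nrm (s t - s' t))"
proof -
  let ?w = "L2_simple_integral M s - L2_simple_integral M s'"
  have sf: "simple_function M s" "simple_function M s'" using s s' by (auto simp: L2_simple_def)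
  note int = integrable_simple_compose[OF fin simple_function_Pair[OF sf]]
  have "(nrm ?w)\<^sup>2 = ip ?w (L2_simple_integral M s) - ip ?w (L2_simple_integral M s')"
    by (simp add: nrm_power2 ip_diff_right)
  also have "\<dots> = (LINT t|M. ip ?w (s t) - ip ?w (s' t))"
    unfolding ip_simple_integral[OF fin s] ip_simple_integral[OF fin s']
    using int[of "\<lambda>p. ip ?w (fst p)"] int[of "\<lambda>p. ip ?w (snd p)"] by simp
  also have "\<dots> \<le> (LINT t|M. nrm ?w * nrm (s t - s' t))"
    using int[of "\<lambda>p. ip ?w (fst p) - ip ?w (snd p)"] int[of "\<lambda>p. nrm ?w * nrm (fst p - snd p)"]
    by (intro integral_mono) (auto simp flip: ip_diff_right intro: ip_le_nrm)
  also have "\<dots> = nrm ?w * (LINT t|M. nrm (s t - s' t))" by simp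
  finally have "nrm ?w * nrm ?w \<le> nrm ?w * (LINT t|M. nrm (s t - s' t))" by (simp add: power2_eq_square)
  moreover have "0 \<le> (LINT t|M. nrm (s t - s' t))" by (rule Bochner_Integration.integral_nonneg) simp
  ultimately show ?thesis
    by (cases "nrm ?w = 0") (auto simp: less_le)
qed

text \<open>Uniformly bounded pointwise limits of simple functions: a sufficient condition for Bochner integrability
that is stable under the operations needed below.\<close>

definition simply_approximable :: "real measure \<Rightarrow> (real \<Rightarrow> 'a \<Rightarrow> real) \<Rightarrow> bool" where
  "simply_approximable M u \<longleftrightarrow> (\<forall>t\<in>space M. u t \<in> L2 \<nu>) \<and>
    (\<exists>K s. (\<forall>n. L2_simple \<nu> M (s n)) \<and> (\<forall>n. \<forall>t\<in>space M. nrm (s n t) \<le> K) \<and>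
       (\<forall>t\<in>space M. (\<lambda>n. nrm (s n t - u t)) \<longlonglongrightarrow> 0))"

text \<open>The integral \<open>G\<close> is determined by its pairings only up to a null function; therefore every
\<open>G'\<close> at distance 0 from it is also an integral.\<close>

lemma bochner_integral_exists:
  assumes fin: "finite_measure M" and u: "simply_approximable M u"
  shows "\<exists>G\<in>L2 \<nu>. (\<forall>G'\<in>L2 \<nu>. nrm (G - G') = 0 \<longrightarrow> L2_has_bochner_integral \<nu> M u G') \<and>
    (\<forall>w. integrable M (\<lambda>t. ip w (u t)) \<and> ip w G = (LINT t|M. ip w (u t)))"
proof -
  interpret M: finite_measure M by (rule fin)
  from u obtain K s where uL: "\<And>t. t \<in> space M \<Longrightarrow> u t \<in> L2 \<nu>"
    and s: "\<And>n. L2_simple \<nu> M (s n)" and bound: "\<And>n t. t \<in> space M \<Longrightarrow> nrm (s n t) \<le> K"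
    and lim: "\<And>t. t \<in> space M \<Longrightarrow> (\<lambda>n. nrm (s n t - u t)) \<longlonglongrightarrow> 0"
    unfolding simply_approximable_def by blast
  have sf: "simple_function M (s n)" for n using s[of n] by (simp add: L2_simple_def)
  have sL: "s n t \<in> L2 \<nu>" if "t \<in> space M" for n t using s[of n] that by (simp add: L2_simple_def)
  note int = integrable_simple_compose[OF fin sf]
  have int2: "integrable M (\<lambda>t. \<phi> (s i t) (s j t))" for i j and \<phi> :: "('a \<Rightarrow> real) \<Rightarrow> ('a \<Rightarrow> real) \<Rightarrow> real"
    using integrable_simple_compose[OF fin simple_function_Pair[OF sf sf], where \<phi> = "\<lambda>p. \<phi> (fst p) (snd p)"]
    by simp
  define g where "g n t = nrm (u t - s n t)" for n t
  have g_meas [measurable]: "g n \<in> borel_measurable M" for n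
  proof (rule borel_measurable_LIMSEQ_real)
    fix t assume t: "t \<in> space M"
    show "(\<lambda>k. nrm (s k t - s n t)) \<longlonglongrightarrow> g n t"
      unfolding g_def using tendsto_nrm[OF tendsto_nrm_diff[OF lim[OF t], of "\<lambda>_. s n t" "s n t"]] by simp
  next
    fix k show "(\<lambda>t. nrm (s k t - s n t)) \<in> borel_measurable M"
      using int2[where i = k and j = n and \<phi> = "\<lambda>x y. nrm (x - y)"] by (rule borel_measurable_integrable)
  qed
  have u_bound: "nrm (u t) \<le> K" if t: "t \<in> space M" for t
    by (rule LIMSEQ_le_const2[OF tendsto_nrm[OF lim[OF t]]]) (use bound[OF t] in blast)
  have g_le: "g n t \<le> 2 * K" if t: "t \<in> space M" for n t
    unfolding g_def using nrm_diff_le[of "u t" "s n t"] u_bound[OF t] bound[OF t, of n] by linarith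
  have g_nonneg: "0 \<le> g n t" for n t by (simp add: g_def)
  have g_int: "integrable M (g n)" for n
    using g_le g_nonneg by (intro M.integrable_const_bound[where B = "2 * K"]) auto
  have g_lim: "(\<lambda>n. LINT t|M. g n t) \<longlonglongrightarrow> (LINT t|M. 0)"
  proof (rule integral_dominated_convergence[where w = "\<lambda>_. 2 * K"])
    show "AE t in M. (\<lambda>n. g n t) \<longlonglongrightarrow> 0"
      using lim by (intro AE_I2) (simp add: g_def nrm_diff_commute)
  qed (use g_le g_nonneg in auto)
  let ?I = "\<lambda>n. L2_simple_integral M (s n)"
  have diff: "nrm (?I i - ?I j) \<le> (LINT t|M. g i t) + (LINT t|M. g j t)" for i j
  proof -
    have "nrm (?I i - ?I j) \<le> (LINT t|M. nrm (s i t - s j t))"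
      by (rule nrm_simple_integral_diff[OF fin s s])
    also have "\<dots> \<le> (LINT t|M. g i t + g j t)"
    proof (rule integral_mono)
      show "integrable M (\<lambda>t. nrm (s i t - s j t))" by (rule int2)
      show "nrm (s i t - s j t) \<le> g i t + g j t" for t
        using nrm_triangle_diff[of "s i t" "s j t" "u t"] nrm_diff_commute[of "s i t" "u t"] by (simp add: g_def)
    qed (use g_int in auto)
    finally show ?thesis using g_int by simp
  qed
  have "\<exists>G\<in>L2 \<nu>. (\<lambda>n. nrm (?I n - G)) \<longlonglongrightarrow> 0"
  proof (rule L2_complete)
    fix e :: real assume "0 < e"
    then have "\<forall>\<^sub>F n in sequentially. (LINT t|M. g n t) < e / 2"
      using g_lim by (intro order_tendstoD) auto
    then obtain N where N: "\<And>n. N \<le> n \<Longrightarrow> (LINT t|M. g n t) < e / 2" by (auto simp: eventually_sequentially)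
    have "nrm (?I i - ?I j) < e" if "N \<le> i" "N \<le> j" for i j
      using diff[of i j] N[OF that(1)] N[OF that(2)] by linarith
    then show "\<exists>N. \<forall>i\<ge>N. \<forall>j\<ge>N. nrm (?I i - ?I j) < e" by blast
  qed (rule L2_simple_integral_L2[OF s])
  then obtain G where G: "G \<in> L2 \<nu>" "(\<lambda>n. nrm (?I n - G)) \<longlonglongrightarrow> 0" by blast
  show ?thesis
  proof (intro bexI[OF _ G(1)] conjI ballI impI allI)
    fix G' assume G': "G' \<in> L2 \<nu>" "nrm (G - G') = 0"
    show "L2_has_bochner_integral \<nu> M u G'"
      unfolding L2_has_bochner_integral_def
    proof (intro conjI exI[of _ s] allI)
      have eq: "L2_norm \<nu> (\<lambda>x. u t x - s n t x) = g n t" if "t \<in> space M" for t n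
        unfolding g_def by (rule L2_norm_diff[OF uL[OF that] sL[OF that]])
      show "AE t in M. u t \<in> L2 \<nu>" using uL by auto
      show "G' \<in> L2 \<nu>" by fact
      show "L2_simple \<nu> M (s n)" for n by (rule s)
      show "(\<lambda>t. L2_norm \<nu> (\<lambda>x. u t x - s n t x)) \<in> borel_measurable M" for n
        using g_meas[of n] by (subst measurable_cong[OF eq]) simp_all
      have "(\<integral>\<^sup>+t. ennreal (L2_norm \<nu> (\<lambda>x. u t x - s n t x)) \<partial>M) = ennreal (LINT t|M. g n t)" for n
        using g_int[of n] g_nonneg by (subst nn_integral_eq_integral[symmetric]) (auto intro!: nn_integral_cong simp: eq)
      then show "(\<lambda>n. \<integral>\<^sup>+t. ennreal (L2_norm \<nu> (\<lambda>x. u t x - s n t x)) \<partial>M) \<longlonglongrightarrow> 0"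
        using tendsto_ennrealI[OF g_lim] by simp
      have "L2_norm \<nu> (\<lambda>x. ?I n x - G' x) = nrm (?I n - G')" for n
        by (rule L2_norm_diff[OF L2_simple_integral_L2[OF s] G'(1)])
      moreover have "nrm (?I n - G') \<le> nrm (?I n - G)" for n
        using nrm_triangle_diff[of "?I n" G' G] G'(2) by simp
      ultimately show "(\<lambda>n. L2_norm \<nu> (\<lambda>x. ?I n x - G' x)) \<longlonglongrightarrow> 0"
        by (intro tendsto_sandwich[OF _ _ tendsto_const G(2)]) auto
    qed
  next
    fix w
    have ip_lim: "(\<lambda>n. ip w (s n t)) \<longlonglongrightarrow> ip w (u t)" if "t \<in> space M" for t
      using tendsto_ip[OF lim[OF that], of w] by (simp add: ip_sym[of w])
    have meas: "(\<lambda>t. ip w (u t)) \<in> borel_measurable M"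
      by (rule borel_measurable_LIMSEQ_real[OF ip_lim]) (use int in \<open>auto intro: borel_measurable_integrable\<close>)
    have bnd: "\<bar>ip w z\<bar> \<le> nrm w * K" if "nrm z \<le> K" for z
      using cauchy_schwarz[of w z] mult_left_mono[OF that nrm_nonneg[of w]] by linarith
    show "integrable M (\<lambda>t. ip w (u t))"
      using meas bnd u_bound by (intro M.integrable_const_bound[where B = "nrm w * K"]) auto
    have "(\<lambda>n. LINT t|M. ip w (s n t)) \<longlonglongrightarrow> (LINT t|M. ip w (u t))"
      by (rule integral_dominated_convergence[where w = "\<lambda>_. nrm w * K"])
         (use meas ip_lim bnd bound int in \<open>auto intro: borel_measurable_integrable\<close>)
    then have "(\<lambda>n. ip w (?I n)) \<longlonglongrightarrow> (LINT t|M. ip w (u t))"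
      by (simp add: ip_simple_integral[OF fin s])
    moreover have "(\<lambda>n. ip w (?I n)) \<longlonglongrightarrow> ip w G"
      using tendsto_ip[OF G(2), of w] by (simp add: ip_sym[of w])
    ultimately show "ip w G = (LINT t|M. ip w (u t))" by (rule LIMSEQ_unique[rotated])
  qed
qed

end

definition grid :: "nat \<Rightarrow> real \<Rightarrow> real" where
  "grid n t = \<lfloor>real (Suc n) * t\<rfloor> / real (Suc n)"

lemma grid_bounds: "grid n t \<le> t" "t - 1 / real (Suc n) < grid n t" "0 \<le> t \<Longrightarrow> 0 \<le> grid n t"
proof -
  have "real_of_int \<lfloor>real (Suc n) * t\<rfloor> \<le> real (Suc n) * t" "real (Suc n) * t - 1 < real_of_int \<lfloor>real (Suc n) * t\<rfloor>"
    by linarith+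
  then have "grid n t \<le> (real (Suc n) * t) / real (Suc n)" "(real (Suc n) * t - 1) / real (Suc n) < grid n t"
    unfolding grid_def by (intro divide_right_mono divide_strict_right_mono; simp)+
  then show "grid n t \<le> t" "t - 1 / real (Suc n) < grid n t" by (simp_all add: diff_divide_distrib)
  show "0 \<le> t \<Longrightarrow> 0 \<le> grid n t" by (simp add: grid_def)
qed

lemma grid_tendsto: "(\<lambda>n. grid n t) \<longlonglongrightarrow> t"
proof (rule tendsto_sandwich[where f = "\<lambda>n. t - inverse (real (Suc n))" and h = "\<lambda>_. t"])
  show "(\<lambda>n. t - inverse (real (Suc n))) \<longlonglongrightarrow> t"
    using tendsto_diff[OF tendsto_const LIMSEQ_inverse_real_of_nat, of t] by simp
qed (use grid_bounds in \<open>auto simp: inverse_eq_divide less_imp_le intro!: always_eventually\<close>)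

lemma simple_function_grid:
  assumes S: "S \<in> sets lebesgue" "S \<subseteq> {a..b}"
  shows "simple_function (lebesgue_on S) (grid n)"
proof -
  have "simple_function (lebesgue_on S) (\<lambda>t. \<lfloor>real (Suc n) * t\<rfloor>)"
    unfolding simple_function_def
  proof (intro conjI ballI)
    show "finite ((\<lambda>t. \<lfloor>real (Suc n) * t\<rfloor>) ` space (lebesgue_on S))"
    proof (rule finite_subset[OF _ finite_atLeastAtMost_int])
      show "(\<lambda>t. \<lfloor>real (Suc n) * t\<rfloor>) ` space (lebesgue_on S) \<subseteq> {\<lfloor>real (Suc n) * a\<rfloor>..\<lfloor>real (Suc n) * b\<rfloor>}"
        using S(2) by (force intro!: floor_mono mult_left_mono simp del: of_nat_Suc)
    qed
    have "(\<lambda>t. \<lfloor>real (Suc n) * t\<rfloor>) \<in> borel \<rightarrow>\<^sub>M count_space UNIV" by measurable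
    then have "(\<lambda>t. \<lfloor>real (Suc n) * t\<rfloor>) \<in> lebesgue \<rightarrow>\<^sub>M count_space UNIV"
      by (intro measurable_completion) simp
    then have "(\<lambda>t. \<lfloor>real (Suc n) * t\<rfloor>) \<in> lebesgue_on S \<rightarrow>\<^sub>M count_space UNIV"
      by (rule measurable_restrict_space1)
    then show "(\<lambda>t. \<lfloor>real (Suc n) * t\<rfloor>) -` {k} \<inter> space (lebesgue_on S) \<in> sets (lebesgue_on S)" for k
      by (rule measurable_sets) simp
  qed
  from simple_function_compose1[OF this, of "\<lambda>k. k / real (Suc n)"]
  show ?thesis by (simp add: grid_def[abs_def])
qed

context l2
begin

lemma L2_simpleI:
  assumes "finite_measure M" "simple_function M s" "\<And>t. t \<in> space M \<Longrightarrow> s t \<in> L2 \<nu>"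
  shows "L2_simple \<nu> M s"
  using assms finite_measure.emeasure_finite[OF assms(1)] by (auto simp: L2_simple_def)

context
  fixes S :: "real set" and b :: real
  assumes S: "S \<in> sets lebesgue" "S \<subseteq> {0..b}"
begin

lemma finite_S: "finite_measure (lebesgue_on S)"
  by (rule finite_measure_lebesgue_on) (rule fmeasurableI2[of "{0..b}"], use S in auto)

lemma approximable_scale:
  assumes u: "simply_approximable (lebesgue_on S) u" and c: "continuous_on UNIV c" "\<And>t. \<bar>c t\<bar> \<le> B"
  shows "simply_approximable (lebesgue_on S) (\<lambda>t. c t *\<^sub>R u t)"
proof -
  from u obtain K s where uL: "\<And>t. t \<in> S \<Longrightarrow> u t \<in> L2 \<nu>"
    and s: "\<And>n. L2_simple \<nu> (lebesgue_on S) (s n)" and bound: "\<And>n t. t \<in> S \<Longrightarrow> nrm (s n t) \<le> K"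
    and lim: "\<And>t. t \<in> S \<Longrightarrow> (\<lambda>n. nrm (s n t - u t)) \<longlonglongrightarrow> 0"
    unfolding simply_approximable_def space_lebesgue_on by blast
  have B: "0 \<le> B" using c(2)[of 0] by linarith
  show ?thesis unfolding simply_approximable_def
  proof (intro conjI exI[of _ "B * K"] exI[of _ "\<lambda>n t. c (grid n t) *\<^sub>R s n t"] allI ballI)
    show "t \<in> space (lebesgue_on S) \<Longrightarrow> c t *\<^sub>R u t \<in> L2 \<nu>" for t using uL by (simp add: L2_scale)
    fix n
    have "simple_function (lebesgue_on S) (\<lambda>t. c (grid n t) *\<^sub>R s n t)"
      using simple_function_compose2[OF simple_function_grid[OF S], of "s n" "\<lambda>r z. c r *\<^sub>R z"] s[of n]
      by (simp add: L2_simple_def)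
    then show "L2_simple \<nu> (lebesgue_on S) (\<lambda>t. c (grid n t) *\<^sub>R s n t)"
      by (rule L2_simpleI[OF finite_S]) (use s[of n] in \<open>auto simp: L2_simple_def intro: L2_scale\<close>)
    show "nrm (c (grid n t) *\<^sub>R s n t) \<le> B * K" if "t \<in> space (lebesgue_on S)" for t
      unfolding nrm_scale using bound[of t n] c(2) B that by (intro mult_mono) auto
  next
    fix t assume "t \<in> space (lebesgue_on S)"
    then have t: "t \<in> S" by simp
    have cl: "(\<lambda>n. c (grid n t)) \<longlonglongrightarrow> c t"
      using c(1) grid_tendsto[of t] by (rule continuous_on_tendsto_compose) auto
    have "(\<lambda>n. B * nrm (s n t - u t) + \<bar>c (grid n t) - c t\<bar> * nrm (u t)) \<longlonglongrightarrow> B * 0 + \<bar>c t - c t\<bar> * nrm (u t)"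
      by (intro tendsto_intros lim t cl)
    then show "(\<lambda>n. nrm (c (grid n t) *\<^sub>R s n t - c t *\<^sub>R u t)) \<longlonglongrightarrow> 0"
    proof (rule Lim_null_comparison[rotated, OF tendsto_eq_rhs])
      have "nrm (c (grid n t) *\<^sub>R s n t - c t *\<^sub>R u t)
          \<le> B * nrm (s n t - u t) + \<bar>c (grid n t) - c t\<bar> * nrm (u t)" for n
      proof -
        have "c (grid n t) *\<^sub>R s n t - c t *\<^sub>R u t = c (grid n t) *\<^sub>R (s n t - u t) + (c (grid n t) - c t) *\<^sub>R u t"
          by (simp add: algebra_simps)
        then have "nrm (c (grid n t) *\<^sub>R s n t - c t *\<^sub>R u t)
            \<le> \<bar>c (grid n t)\<bar> * nrm (s n t - u t) + \<bar>c (grid n t) - c t\<bar> * nrm (u t)"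
          by (metis nrm_triangle nrm_scale)
        then show ?thesis using mult_right_mono[OF c(2)[of "grid n t"] nrm_nonneg[of "s n t - u t"]] by linarith
      qed
      then show "\<forall>\<^sub>F n in sequentially. norm (nrm (c (grid n t) *\<^sub>R s n t - c t *\<^sub>R u t))
          \<le> B * nrm (s n t - u t) + \<bar>c (grid n t) - c t\<bar> * nrm (u t)" by simp
    qed simp
  qed
qed

context
  fixes v :: "real \<Rightarrow> 'a \<Rightarrow> real" and K :: real
  assumes v: "\<And>t. v t \<in> L2 \<nu>"
    and lip: "\<And>t h. 0 \<le> t \<Longrightarrow> 0 \<le> h \<Longrightarrow> nrm (v (t + h) - v t) \<le> K * h"
begin

lemma K_nonneg: "0 \<le> K"
  using order_trans[OF nrm_nonneg lip[of 0 1]] by simp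

lemma approximable_lipschitz: "simply_approximable (lebesgue_on S) v"
  unfolding simply_approximable_def
proof (intro conjI exI[of _ "nrm (v 0) + K * b"] exI[of _ "\<lambda>n t. v (grid n t)"] allI ballI v)
  show "L2_simple \<nu> (lebesgue_on S) (\<lambda>t. v (grid n t))" for n
    by (intro L2_simpleI finite_S simple_function_compose1[OF simple_function_grid[OF S]] v)
  fix t assume "t \<in> space (lebesgue_on S)"
  then have t: "0 \<le> t" "t \<le> b" using S by auto
  have le: "nrm (v (grid n t) - v t) \<le> K * (t - grid n t)" for n
    using lip[of "grid n t" "t - grid n t"] grid_bounds[where n = n and t = t] t(1) nrm_diff_commute[of "v t"] by simp
  show "nrm (v (grid n t)) \<le> nrm (v 0) + K * b" for n
  proof -
    have "nrm (v (grid n t)) \<le> nrm (v 0) + nrm (v (grid n t) - v 0)"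
      using nrm_triangle[of "v 0" "v (grid n t) - v 0"] by simp
    also have "nrm (v (grid n t) - v 0) \<le> K * grid n t" using lip[of 0 "grid n t"] grid_bounds(3)[OF t(1), where n = n] by simp
    also have "\<dots> \<le> K * b" using grid_bounds(1)[where n = n and t = t] t K_nonneg by (intro mult_left_mono) auto
    finally show ?thesis by simp
  qed
  have "(\<lambda>n. K * (t - grid n t)) \<longlonglongrightarrow> K * (t - t)" by (intro tendsto_intros grid_tendsto)
  then have "(\<lambda>n. K * (t - grid n t)) \<longlonglongrightarrow> 0" by simp
  then show "(\<lambda>n. nrm (v (grid n t) - v t)) \<longlonglongrightarrow> 0"
    by (rule Lim_null_comparison[rotated]) (use le in simp)
qed

text \<open>A difference quotient with step \<open>h\<close> is frozen on a grid of width at most \<open>h\<^sup>2\<close>. By the Lipschitz condition, the error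
that freezing causes in the quotient is of order \<open>h\<^sup>2 / h = h\<close>.\<close>

lemma approximable_derivative:
  assumes v': "\<And>t. v' t \<in> L2 \<nu>"
    and deriv: "\<And>t. 0 \<le> t \<Longrightarrow> ((\<lambda>h. nrm ((1 / h) *\<^sub>R (v (t + h) - v t) - v' t)) \<longlongrightarrow> 0) (at_right 0)"
  shows "simply_approximable (lebesgue_on S) v'"
proof -
  define h where "h n = inverse (real (Suc n))" for n
  \<comment> \<open>The index makes the grid finer than the square of the step.\<close>
  define g where "g n t = grid (Suc n * Suc n) t" for n t
  define s where "s n t = (1 / h n) *\<^sub>R (v (g n t + h n) - v (g n t))" for n t
  have h: "0 < h n" for n by (simp add: h_def)
  show ?thesis unfolding simply_approximable_def
  proof (intro conjI exI[of _ K] exI[of _ s] allI ballI v')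
    show "L2_simple \<nu> (lebesgue_on S) (s n)" for n
      unfolding s_def g_def
      by (intro L2_simpleI finite_S simple_function_compose1[OF simple_function_grid[OF S]] v L2_scale L2_diff)
    fix t assume "t \<in> space (lebesgue_on S)"
    then have t: "0 \<le> t" "t \<le> b" using S by auto
    have g: "0 \<le> g n t" "g n t \<le> t" "t - g n t \<le> h n * h n" for n
    proof -
      show "0 \<le> g n t" "g n t \<le> t" unfolding g_def using grid_bounds t(1) by auto
      have "t - g n t \<le> 1 / real (Suc (Suc n * Suc n))"
        using grid_bounds(2)[where n = "Suc n * Suc n" and t = t] unfolding g_def by linarith
      also have "\<dots> \<le> 1 / (real (Suc n) * real (Suc n))"
      proof (rule divide_left_mono)
        show "real (Suc n) * real (Suc n) \<le> real (Suc (Suc n * Suc n))" by (simp only: of_nat_mult[symmetric] of_nat_le_iff)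
      qed (auto intro!: mult_pos_pos simp del: of_nat_Suc)
      also have "\<dots> = h n * h n" by (simp add: h_def inverse_eq_divide)
      finally show "t - g n t \<le> h n * h n" .
    qed
    show "nrm (s n t) \<le> K" for n
      using lip[OF g(1) less_imp_le[OF h], of n n] h[of n]
      unfolding s_def nrm_scale by (simp add: divide_le_eq)
    define q where "q n = (1 / h n) *\<^sub>R (v (t + h n) - v t)" for n
    have sq: "nrm (s n t - q n) \<le> 2 * K * h n" for n
    proof -
      let ?d = "t - g n t"
      have "s n t - q n = (1 / h n) *\<^sub>R ((v t - v (g n t)) - (v (t + h n) - v (g n t + h n)))"
        by (simp add: s_def q_def algebra_simps)
      then have "nrm (s n t - q n) \<le> (1 / h n) * (nrm (v t - v (g n t)) + nrm (v (t + h n) - v (g n t + h n)))"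
        using h[of n] nrm_diff_le by (simp add: nrm_scale divide_right_mono del: scaleR_diff_right)
      also have "\<dots> \<le> (1 / h n) * (K * ?d + K * ?d)"
      proof (intro mult_left_mono add_mono)
        show "nrm (v t - v (g n t)) \<le> K * ?d" using lip[of "g n t" ?d] g[of n] by simp
        show "nrm (v (t + h n) - v (g n t + h n)) \<le> K * ?d"
          using lip[of "g n t + h n" ?d] g[of n] h[of n] by (simp add: algebra_simps)
      qed (use h[of n] in simp)
      also have "\<dots> = (2 * K / h n) * ?d" by simp
      also have "\<dots> \<le> (2 * K / h n) * (h n * h n)"
        using g(3)[of n] K_nonneg h[of n] by (intro mult_left_mono) auto
      also have "\<dots> = 2 * K * h n" using h[of n] by simp
      finally show ?thesis .
    qed
    have h_lim: "h \<longlonglongrightarrow> 0" unfolding h_def[abs_def] by (rule LIMSEQ_inverse_real_of_nat)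
    then have "filterlim h (at_right 0) sequentially"
      using h by (intro tendsto_imp_filterlim_at_right) (auto intro!: always_eventually)
    with deriv[OF t(1)] have "(\<lambda>n. nrm (q n - v' t)) \<longlonglongrightarrow> 0"
      unfolding q_def by (rule filterlim_compose)
    then have "(\<lambda>n. 2 * K * h n + nrm (q n - v' t)) \<longlonglongrightarrow> 2 * K * 0 + 0"
      by (intro tendsto_intros h_lim)
    then have "(\<lambda>n. 2 * K * h n + nrm (q n - v' t)) \<longlonglongrightarrow> 0" by simp
    then show "(\<lambda>n. nrm (s n t - v' t)) \<longlonglongrightarrow> 0"
    proof (rule Lim_null_comparison[rotated])
      have "nrm (s n t - v' t) \<le> 2 * K * h n + nrm (q n - v' t)" for n
        using nrm_triangle_diff[of "s n t" "v' t" "q n"] sq[of n] by linarith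
      then show "\<forall>\<^sub>F n in sequentially. norm (nrm (s n t - v' t)) \<le> 2 * K * h n + nrm (q n - v' t)" by simp
    qed
  qed
qed

end

end

end

section \<open>Weak derivatives in time\<close>

lemma test_function_props:
  assumes "\<phi> \<in> test_functions T"
  obtains a b B where "0 < a" "a < b" "b < T" "\<And>t. (\<phi> has_real_derivative deriv \<phi> t) (at t)"
    "continuous_on UNIV (deriv \<phi>)" "\<And>t. t \<notin> {a..b} \<Longrightarrow> \<phi> t = 0" "\<And>t. t \<notin> {a..b} \<Longrightarrow> deriv \<phi> t = 0"
    "\<And>t. \<bar>\<phi> t\<bar> \<le> B" "\<And>t. \<bar>deriv \<phi> t\<bar> \<le> B"
proof -
  from assms obtain a b where ab: "0 < a" "a < b" "b < T" and zero: "\<And>t. t \<notin> {a..b} \<Longrightarrow> \<phi> t = 0"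
    and d: "\<And>n t. (deriv ^^ n) \<phi> differentiable (at t)"
    unfolding test_functions_def by blast
  have D: "(\<phi> has_real_derivative deriv \<phi> t) (at t)" for t
    using d[of 0 t] by (simp add: DERIV_deriv_iff_real_differentiable)
  have cd: "continuous_on UNIV (deriv \<phi>)"
    using d[of 1] by (auto simp: continuous_on_eq_continuous_at intro: differentiable_imp_continuous_within)
  have c: "continuous_on UNIV \<phi>"
    using d[of 0] by (auto simp: continuous_on_eq_continuous_at intro: differentiable_imp_continuous_within)
  have zd: "deriv \<phi> t = 0" if "t \<notin> {a..b}" for t
  proof -
    have "\<forall>\<^sub>F x in nhds t. x \<in> - {a..b}" using that by (intro eventually_nhds_in_open) auto
    then have "\<forall>\<^sub>F x in nhds t. \<phi> x = 0" by eventually_elim (use zero in auto)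
    then have "deriv \<phi> t = deriv (\<lambda>_. 0) t" by (rule deriv_cong_ev) simp
    then show ?thesis by simp
  qed
  have "bounded (\<phi> ` {a..b})" "bounded (deriv \<phi> ` {a..b})"
    by (intro compact_imp_bounded compact_continuous_image continuous_on_subset[OF c] continuous_on_subset[OF cd]; simp)+
  then obtain B1 B2 where B: "\<And>t. t \<in> {a..b} \<Longrightarrow> \<bar>\<phi> t\<bar> \<le> B1" "\<And>t. t \<in> {a..b} \<Longrightarrow> \<bar>deriv \<phi> t\<bar> \<le> B2"
    unfolding bounded_iff by fastforce
  define B' where "B' = max 0 (max B1 B2)"
  have "\<bar>\<phi> t\<bar> \<le> B'" "\<bar>deriv \<phi> t\<bar> \<le> B'" for t
    using B[of t] zero[of t] zd[of t] by (cases "t \<in> {a..b}"; force simp: B'_def)+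
  then show thesis using that ab D cd zero zd by blast
qed

text \<open>The product \<open>\<psi>\<close> of the two functions vanishes outside a compact subset of \<open>{0<..<T}\<close>, so by translation invariance
the integral of \<open>(\<psi>(t + h) - \<psi>(t)) / h\<close> is 0. These quotients are bounded and converge
everywhere to the integrand.\<close>

lemma integral_right_derivative_product:
  fixes g g' \<phi> :: "real \<Rightarrow> real"
  assumes lip: "\<And>s t. 0 \<le> s \<Longrightarrow> 0 \<le> t \<Longrightarrow> \<bar>g s - g t\<bar> \<le> K * \<bar>s - t\<bar>"
    and rd: "\<And>t. 0 \<le> t \<Longrightarrow> ((\<lambda>h. (g (t + h) - g t) / h) \<longlongrightarrow> g' t) (at_right 0)"
    and \<phi>: "\<phi> \<in> test_functions T"
  shows "(LINT t|lebesgue_on {0<..<T}. deriv \<phi> t * g t + \<phi> t * g' t) = 0"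
proof -
  obtain a b B where ab: "0 < a" "a < b" "b < T"
    and D: "\<And>t. (\<phi> has_real_derivative deriv \<phi> t) (at t)"
    and zero: "\<And>t. t \<notin> {a..b} \<Longrightarrow> \<phi> t = 0" "\<And>t. t \<notin> {a..b} \<Longrightarrow> deriv \<phi> t = 0"
    and B: "\<And>t. \<bar>\<phi> t\<bar> \<le> B" "\<And>t. \<bar>deriv \<phi> t\<bar> \<le> B"
    using test_function_props[OF \<phi>] by metis
  have K: "0 \<le> K" using lip[of 0 1] abs_ge_zero[of "g 0 - g 1"] by simp
  have B0: "0 \<le> B" using B(1)[of 0] by linarith
  have \<phi>_lip: "\<bar>\<phi> s - \<phi> t\<bar> \<le> B * \<bar>s - t\<bar>" for s t
    using field_differentiable_bound[of UNIV \<phi> "deriv \<phi>" B s t] D B(2) by (auto intro: has_field_derivative_at_within)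
  have \<phi>_cont: "continuous_on UNIV \<phi>"
    using D by (auto simp: continuous_on_eq_continuous_at intro: DERIV_isCont)
  \<comment> \<open>The constant extension to negative times is continuous on the whole line.\<close>
  define g0 where "g0 t = g (max t 0)" for t
  have g0_lip: "\<bar>g0 s - g0 t\<bar> \<le> K * \<bar>s - t\<bar>" for s t
  proof -
    have "\<bar>g0 s - g0 t\<bar> \<le> K * \<bar>max s 0 - max t 0\<bar>" unfolding g0_def by (rule lip) auto
    also have "\<dots> \<le> K * \<bar>s - t\<bar>" using K by (intro mult_left_mono) auto
    finally show ?thesis .
  qed
  have g0_cont: "continuous_on UNIV g0"
    by (rule lipschitz_on_continuous_on[of K]) (use g0_lip K in \<open>auto simp: lipschitz_on_def dist_real_def\<close>)
  define \<psi> where "\<psi> t = \<phi> t * g0 t" for t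
  have \<psi>_cont: "continuous_on UNIV \<psi>" unfolding \<psi>_def by (intro continuous_intros \<phi>_cont g0_cont)
  have \<psi>_meas [measurable]: "\<psi> \<in> borel_measurable borel" by (rule borel_measurable_continuous_onI[OF \<psi>_cont])
  define L where "L = B * K + B * (\<bar>g 0\<bar> + K * T)"
  have L: "0 \<le> L" using B0 K ab by (simp add: L_def)
  \<comment> \<open>The steps do not exceed the distance \<open>a\<close> of the support from 0.\<close>
  define h where "h n = a * inverse (real (Suc n))" for n
  have h: "0 < h n" "h n \<le> a" for n using ab(1) by (auto simp: h_def field_simps)
  have h_lim: "h \<longlonglongrightarrow> 0"
    using tendsto_mult[OF tendsto_const LIMSEQ_inverse_real_of_nat, of a] by (simp add: h_def[abs_def])
  define q where "q n t = (\<psi> (t + h n) - \<psi> t) / h n" for n t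
  define k where "k t = deriv \<phi> t * g t + \<phi> t * g' t" for t
  have q_zero: "q n t = 0" if "t \<notin> {0..T}" for n t
  proof -
    have "t \<notin> {a..b}" "t + h n \<notin> {a..b}" using that ab h[of n] by auto
    then show ?thesis by (simp add: q_def \<psi>_def zero)
  qed
  have q_bound: "\<bar>q n t\<bar> \<le> indicator {0..T} t * L" for n t
  proof (cases "t \<in> {0..T}")
    case True
    have "\<psi> (t + h n) - \<psi> t = \<phi> (t + h n) * (g0 (t + h n) - g0 t) + (\<phi> (t + h n) - \<phi> t) * g0 t"
      by (simp add: \<psi>_def algebra_simps)
    then have "\<bar>\<psi> (t + h n) - \<psi> t\<bar> \<le> \<bar>\<phi> (t + h n)\<bar> * \<bar>g0 (t + h n) - g0 t\<bar> + \<bar>\<phi> (t + h n) - \<phi> t\<bar> * \<bar>g0 t\<bar>"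
      by (metis abs_mult abs_triangle_ineq)
    also have "\<dots> \<le> B * (K * h n) + (B * h n) * (\<bar>g 0\<bar> + K * T)"
    proof (intro add_mono mult_mono)
      show "\<bar>g0 (t + h n) - g0 t\<bar> \<le> K * h n" using g0_lip[of "t + h n" t] h[of n] by simp
      show "\<bar>\<phi> (t + h n) - \<phi> t\<bar> \<le> B * h n" using \<phi>_lip[of "t + h n" t] h[of n] by simp
      have "\<bar>g t - g 0\<bar> \<le> K * t" using lip[of t 0] True by simp
      also have "\<dots> \<le> K * T" using True K by (intro mult_left_mono) auto
      finally show "\<bar>g0 t\<bar> \<le> \<bar>g 0\<bar> + K * T" using True by (simp add: g0_def)
    qed (use B B0 K h[of n] in auto)
    also have "\<dots> = L * h n" by (simp add: L_def algebra_simps)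
    finally show ?thesis using True h[of n] by (simp add: q_def divide_le_eq)
  qed (simp add: q_zero)
  have dom: "integrable lborel (\<lambda>t. indicator {0..T} t * L :: real)"
    using ab by (intro integrable_mult_left) (simp add: integrable_indicator_iff)
  have q_lim: "(\<lambda>n. q n t) \<longlonglongrightarrow> indicator {0<..<T} t * k t" for t
  proof (cases "t \<in> {a..b}")
    case True
    then have t: "0 \<le> t" "indicator {0<..<T} t = (1::real)" using ab by auto
    have right: "filterlim h (at_right 0) sequentially"
      using h h_lim by (intro tendsto_imp_filterlim_at_right) (auto intro!: always_eventually)
    have 1: "(\<lambda>n. (g (t + h n) - g t) / h n) \<longlonglongrightarrow> g' t"
      by (rule filterlim_compose[OF rd[OF t(1)] right])
    have "((\<lambda>h. (\<phi> (t + h) - \<phi> t) / h) \<longlongrightarrow> deriv \<phi> t) (at_right 0)"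
      using D[of t] unfolding DERIV_def by (rule tendsto_within_subset) simp
    then have 2: "(\<lambda>n. (\<phi> (t + h n) - \<phi> t) / h n) \<longlonglongrightarrow> deriv \<phi> t"
      by (rule filterlim_compose[OF _ right])
    have 3: "(\<lambda>n. \<phi> (t + h n)) \<longlonglongrightarrow> \<phi> (t + 0)"
      using \<phi>_cont tendsto_add[OF tendsto_const h_lim, of t]
      by (intro isCont_tendsto_compose[of "t + 0" \<phi>]) (auto simp: continuous_on_eq_continuous_at)
    have "(\<lambda>n. \<phi> (t + h n) * ((g (t + h n) - g t) / h n) + (\<phi> (t + h n) - \<phi> t) / h n * g t)
        \<longlonglongrightarrow> \<phi> (t + 0) * g' t + deriv \<phi> t * g t"
      by (intro tendsto_intros 1 2 3)
    moreover have "q n t = \<phi> (t + h n) * ((g (t + h n) - g t) / h n) + (\<phi> (t + h n) - \<phi> t) / h n * g t" for n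
      using t(1) h[of n] by (simp add: q_def \<psi>_def g0_def max_def field_simps)
    ultimately show ?thesis using t(2) by (simp add: k_def add.commute)
  next
    case False
    have "\<forall>\<^sub>F n in sequentially. t + h n \<notin> {a..b}"
    proof -
      have "(\<lambda>n. t + h n) \<longlonglongrightarrow> t + 0" by (intro tendsto_intros h_lim)
      then show ?thesis
        using False topological_tendstoD[of "\<lambda>n. t + h n" "t + 0" sequentially "- {a..b}"]
        by (auto simp: open_Compl)
    qed
    then have "\<forall>\<^sub>F n in sequentially. q n t = 0"
      by eventually_elim (use zero(1)[OF False] in \<open>simp add: q_def \<psi>_def zero(1)\<close>)
    then show ?thesis using False by (simp add: k_def zero tendsto_eventually)
  qed
  have meas: "(\<lambda>t. indicator {0<..<T} t * k t) \<in> borel_measurable borel"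
    by (rule borel_measurable_LIMSEQ_real[OF q_lim]) (simp add: q_def)
  have int_q: "(LINT t|lborel. q n t) = 0" for n
  proof -
    have bnd: "\<bar>\<psi> t\<bar> \<le> indicator {0..T} t * (B * (\<bar>g 0\<bar> + K * T))" for t
    proof (cases "t \<in> {a..b}")
      case True
      have "\<bar>g t - g 0\<bar> \<le> K * t" using lip[of t 0] True ab by simp
      also have "\<dots> \<le> K * T" using True K ab by (intro mult_left_mono) auto
      finally have "\<bar>g0 t\<bar> \<le> \<bar>g 0\<bar> + K * T" using True ab by (simp add: g0_def)
      then have "\<bar>\<phi> t\<bar> * \<bar>g0 t\<bar> \<le> B * (\<bar>g 0\<bar> + K * T)" using B B0 by (intro mult_mono) auto
      then show ?thesis using True ab by (simp add: \<psi>_def abs_mult)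
    next
      case False
      then show ?thesis using B0 K ab by (simp add: \<psi>_def zero)
    qed
    have dom': "integrable lborel (\<lambda>t. indicator {0..T} t * (B * (\<bar>g 0\<bar> + K * T)) :: real)"
      using ab by (intro integrable_mult_left) (simp add: integrable_indicator_iff)
    have int: "integrable lborel \<psi>"
      by (rule Bochner_Integration.integrable_bound[of _ "\<lambda>t. indicator {0..T} t * (B * (\<bar>g 0\<bar> + K * T)) :: real"])
         (use dom' in \<open>auto simp: order_trans[OF bnd abs_ge_self]\<close>)
    have shift: "integrable lborel (\<lambda>t. \<psi> (t + h n))"
      using lborel_integrable_real_affine[OF int, of 1 "h n"] by (simp add: add.commute)
    have "(LINT t|lborel. \<psi> (t + h n)) = (LINT t|lborel. \<psi> t)"
      using lborel_integral_real_affine[of 1 \<psi> "h n"] by (simp add: add.commute)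
    then show ?thesis using int shift by (simp add: q_def)
  qed
  have "(\<lambda>n. LINT t|lborel. q n t) \<longlonglongrightarrow> (LINT t|lborel. indicator {0<..<T} t * k t)"
    by (rule integral_dominated_convergence[OF _ _ dom]) (use meas q_lim q_bound in \<open>auto simp: q_def\<close>)
  then have "(LINT t|lborel. indicator {0<..<T} t * k t) = 0"
    by (simp add: int_q LIMSEQ_const_iff)
  also have "(LINT t|lborel. indicator {0<..<T} t * k t) = (LINT t|lebesgue. indicator {0<..<T} t * k t)"
    by (rule integral_completion[symmetric]) (use meas in simp)
  also have "\<dots> = (LINT t|lebesgue_on {0<..<T}. k t)"
    by (subst integral_restrict_space) auto
  finally show ?thesis by (simp add: k_def)
qed

context l2
begin

lemma nrm_diff_self: "nrm (u - u) = 0"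
  by (simp only: diff_self nrm_zero)

lemma bochner_integrable:
  assumes "finite_measure M" and "simply_approximable M u"
  shows "\<exists>G. L2_has_bochner_integral \<nu> M u G"
  using bochner_integral_exists[OF assms] nrm_diff_self by blast

text \<open>Both vector-valued integrals exist; that they are opposite is tested by pairing with an arbitrary
\<open>w\<close>, which reduces the claim to real functions.\<close>

lemma W11loc_deriv_right_derivative:
  assumes v: "\<And>t. v t \<in> L2 \<nu>" and v': "\<And>t. v' t \<in> L2 \<nu>"
    and lip: "\<And>t h. 0 \<le> t \<Longrightarrow> 0 \<le> h \<Longrightarrow> nrm (v (t + h) - v t) \<le> K * h"
    and deriv: "\<And>t. 0 \<le> t \<Longrightarrow> ((\<lambda>h. nrm ((1 / h) *\<^sub>R (v (t + h) - v t) - v' t)) \<longlongrightarrow> 0) (at_right 0)"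
  shows "W11loc_deriv \<nu> T v v'"
proof -
  have loc: "\<exists>G. L2_has_bochner_integral \<nu> (lebesgue_on {a..b}) v G"
    "\<exists>G. L2_has_bochner_integral \<nu> (lebesgue_on {a..b}) v' G" if ab: "0 < a" for a b
  proof -
    have S: "{a..b} \<in> sets lebesgue" "{a..b} \<subseteq> {0..b}" using ab by auto
    show "\<exists>G. L2_has_bochner_integral \<nu> (lebesgue_on {a..b}) v G"
      by (rule bochner_integrable[OF finite_S[OF S] approximable_lipschitz[OF S v lip]])
    show "\<exists>G. L2_has_bochner_integral \<nu> (lebesgue_on {a..b}) v' G"
      by (rule bochner_integrable[OF finite_S[OF S] approximable_derivative[OF S v lip v' deriv]])
  qed
  have "\<exists>G. L2_has_bochner_integral \<nu> (lebesgue_on {0<..<T}) (\<lambda>t x. deriv \<phi> t * v t x) G \<and>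
        L2_has_bochner_integral \<nu> (lebesgue_on {0<..<T}) (\<lambda>t x. \<phi> t * v' t x) (\<lambda>x. - G x)"
    if \<phi>: "\<phi> \<in> test_functions T" for \<phi>
  proof -
    obtain B where D: "\<And>t. (\<phi> has_real_derivative deriv \<phi> t) (at t)" and cd: "continuous_on UNIV (deriv \<phi>)"
      and B: "\<And>t. \<bar>\<phi> t\<bar> \<le> B" "\<And>t. \<bar>deriv \<phi> t\<bar> \<le> B"
      using test_function_props[OF \<phi>] by metis
    have c: "continuous_on UNIV \<phi>" using D by (auto simp: continuous_on_eq_continuous_at intro: DERIV_isCont)
    have S: "{0<..<T} \<in> sets lebesgue" "{0<..<T} \<subseteq> {0..T}" by auto
    note ap1 = approximable_scale[OF S approximable_lipschitz[OF S v lip] cd B(2)]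
    note ap2 = approximable_scale[OF S approximable_derivative[OF S v lip v' deriv] c B(1)]
    obtain G1 where G1: "G1 \<in> L2 \<nu>"
      "\<And>G'. G' \<in> L2 \<nu> \<Longrightarrow> nrm (G1 - G') = 0 \<Longrightarrow> L2_has_bochner_integral \<nu> (lebesgue_on {0<..<T}) (\<lambda>t. deriv \<phi> t *\<^sub>R v t) G'"
      "\<And>w. integrable (lebesgue_on {0<..<T}) (\<lambda>t. ip w (deriv \<phi> t *\<^sub>R v t))"
      "\<And>w. ip w G1 = (LINT t|lebesgue_on {0<..<T}. ip w (deriv \<phi> t *\<^sub>R v t))"
      using bochner_integral_exists[OF finite_S[OF S] ap1] by blast
    obtain G2 where G2: "G2 \<in> L2 \<nu>"
      "\<And>G'. G' \<in> L2 \<nu> \<Longrightarrow> nrm (G2 - G') = 0 \<Longrightarrow> L2_has_bochner_integral \<nu> (lebesgue_on {0<..<T}) (\<lambda>t. \<phi> t *\<^sub>R v' t) G'"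
      "\<And>w. integrable (lebesgue_on {0<..<T}) (\<lambda>t. ip w (\<phi> t *\<^sub>R v' t))"
      "\<And>w. ip w G2 = (LINT t|lebesgue_on {0<..<T}. ip w (\<phi> t *\<^sub>R v' t))"
      using bochner_integral_exists[OF finite_S[OF S] ap2] by blast
    have "ip w (G2 + G1) = 0" for w
    proof -
      have "ip w G1 + ip w G2 = (LINT t|lebesgue_on {0<..<T}. ip w (deriv \<phi> t *\<^sub>R v t) + ip w (\<phi> t *\<^sub>R v' t))"
        unfolding G1(4) G2(4) by (rule Bochner_Integration.integral_add[symmetric, OF G1(3) G2(3)])
      also have "\<dots> = (LINT t|lebesgue_on {0<..<T}. deriv \<phi> t * ip w (v t) + \<phi> t * ip w (v' t))"
        by (simp add: ip_scale_right)
      also have "\<dots> = 0"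
      proof (rule integral_right_derivative_product[OF _ _ \<phi>, where K = "nrm w * K"])
        fix s t :: real assume st: "0 \<le> s" "0 \<le> t"
        have "nrm (v s - v t) \<le> K * \<bar>s - t\<bar>"
          using lip[of s "t - s"] lip[of t "s - t"] st nrm_diff_commute[of "v s" "v t"]
          by (cases "s \<le> t") auto
        then have "nrm w * nrm (v s - v t) \<le> nrm w * (K * \<bar>s - t\<bar>)" by (intro mult_left_mono) auto
        then show "\<bar>ip w (v s) - ip w (v t)\<bar> \<le> nrm w * K * \<bar>s - t\<bar>"
          using cauchy_schwarz[of w "v s - v t"] by (simp add: ip_diff_right)
      next
        fix t :: real assume t: "0 \<le> t"
        show "((\<lambda>h. (ip w (v (t + h)) - ip w (v t)) / h) \<longlongrightarrow> ip w (v' t)) (at_right 0)"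
          using tendsto_ip[OF deriv[OF t], of w] by (simp add: ip_sym[of _ w] ip_linear divide_inverse mult.commute)
      qed
      finally show ?thesis by (simp add: ip_add_right)
    qed
    from this[of "G2 + G1"] have "nrm (G2 + G1) = 0" by (simp add: nrm_def)
    then have "nrm (G2 - (- G1)) = 0" by simp
    from G2(2)[OF L2_minus[OF G1(1)] this] G1(2)[OF G1(1) nrm_diff_self] show ?thesis
      by (intro exI[of _ G1]) (simp add: scaleR_fun_def fun_Compl_def)
  qed
  with loc show ?thesis unfolding W11loc_deriv_def L1loc_L2_def by blast
qed

end

section \<open>Smooth steps\<close>

text \<open>For every polynomial \<open>p\<close> this function is smooth, all its derivatives at 0 being 0.\<close>

definition flat :: "real poly \<Rightarrow> real \<Rightarrow> real" where
  "flat p x = (if 0 < x then poly p (1 / x) * exp (- 1 / x) else 0)"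

lemma poly_times_exp_tendsto_0: "((\<lambda>y::real. poly p y * exp (- y)) \<longlongrightarrow> 0) at_top"
proof -
  have "((\<lambda>y. \<Sum>i\<le>degree p. coeff p i * (y ^ i / exp y)) \<longlongrightarrow> (\<Sum>i\<le>degree p. coeff p i * 0)) at_top"
    by (intro tendsto_intros tendsto_power_div_exp_0)
  moreover have "(\<Sum>i\<le>degree p. coeff p i * (y ^ i / exp y)) = poly p y * exp (- y)" for y
    by (simp add: poly_altdef exp_minus divide_inverse sum_distrib_right mult.assoc)
  ultimately show ?thesis by simp
qed

text \<open>The derivative is of the same form, which gives derivatives of all orders; the factor \<open>[:0, 0, 1:]\<close> is
the square of the variable \<open>1 / x\<close> and comes from the derivative of \<open>1 / x\<close>.\<close>

lemma DERIV_flat: "(flat p has_real_derivative flat ([:0, 0, 1:] * (p - pderiv p)) x) (at x)"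
proof -
  consider "0 < x" | "x < 0" | "x = 0" by linarith
  then show ?thesis
  proof cases
    case 1
    have "((\<lambda>x. poly p (1 / x) * exp (- 1 / x)) has_real_derivative
        poly p (1 / x) * (exp (- 1 / x) * (1 / x\<^sup>2)) + poly (pderiv p) (1 / x) * (- 1 / x\<^sup>2) * exp (- 1 / x)) (at x)"
      using 1 by (auto intro!: derivative_eq_intros DERIV_chain2[OF poly_DERIV] simp: field_simps power2_eq_square)
    moreover have "\<forall>\<^sub>F y in nhds x. flat p y = poly p (1 / y) * exp (- 1 / y)"
      using eventually_nhds_in_open[of "{0<..}" x] 1 by (auto simp: flat_def elim!: eventually_mono)
    ultimately have "(flat p has_real_derivative
        poly p (1 / x) * (exp (- 1 / x) * (1 / x\<^sup>2)) + poly (pderiv p) (1 / x) * (- 1 / x\<^sup>2) * exp (- 1 / x)) (at x)"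
      by (subst DERIV_cong_ev[OF refl _ refl])
    then show ?thesis
      by (rule DERIV_cong) (use 1 in \<open>simp add: flat_def field_simps power2_eq_square\<close>)
  next
    case 2
    have "\<forall>\<^sub>F y in nhds x. flat p y = 0"
      using eventually_nhds_in_open[of "{..<0}" x] 2 by (auto simp: flat_def elim!: eventually_mono)
    then have "(flat p has_real_derivative 0) (at x)"
      by (subst DERIV_cong_ev[OF refl _ refl, of _ "\<lambda>_. 0"]) auto
    then show ?thesis using 2 by (simp add: flat_def)
  next
    case 3
    have "((\<lambda>h. flat p h / h) \<longlongrightarrow> 0) (at_right 0)"
    proof (rule Lim_transform_eventually)
      show "((\<lambda>h. poly ([:0, 1:] * p) (inverse h) * exp (- inverse h)) \<longlongrightarrow> 0) (at_right 0)"
        by (rule filterlim_compose[OF poly_times_exp_tendsto_0 filterlim_inverse_at_top_right])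
      show "\<forall>\<^sub>F h in at_right 0. poly ([:0, 1:] * p) (inverse h) * exp (- inverse h) = flat p h / h"
        using eventually_at_right_less[of 0] by eventually_elim (simp add: flat_def field_simps)
    qed
    moreover have "((\<lambda>h. flat p h / h) \<longlongrightarrow> 0) (at_left 0)"
      by (rule tendsto_eventually) (auto simp: flat_def eventually_at_filter)
    ultimately have "((\<lambda>h. flat p h / h) \<longlongrightarrow> 0) (at 0)" by (simp add: filterlim_split_at)
    then show ?thesis using 3 by (simp add: DERIV_def flat_def)
  qed
qed

text \<open>A class of smooth functions that is closed under differentiation and contains bump functions with support in any
given interval.\<close>

inductive_set flat_span :: "(real \<Rightarrow> real) set" where
  prod: "(\<lambda>t. flat p (t - a) * flat q (b - t)) \<in> flat_span"
| add: "f \<in> flat_span \<Longrightarrow> g \<in> flat_span \<Longrightarrow> (\<lambda>t. f t + g t) \<in> flat_span"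

lemma flat_smult: "flat (smult c p) x = c * flat p x"
  by (simp add: flat_def)

lemma flat_span_scale: "f \<in> flat_span \<Longrightarrow> (\<lambda>t. c * f t) \<in> flat_span"
proof (induction rule: flat_span.induct)
  case (prod p a q b)
  show ?case using flat_span.prod[of "smult c p" a q b] by (simp add: flat_smult mult.assoc)
next
  case (add f g)
  then show ?case using flat_span.add by (simp add: distrib_left)
qed

lemma flat_span_DERIV: "f \<in> flat_span \<Longrightarrow> \<exists>g\<in>flat_span. \<forall>t. (f has_real_derivative g t) (at t)"
proof (induction rule: flat_span.induct)
  case (prod p a q b)
  let ?D = "\<lambda>p. [:0, 0, 1:] * (p - pderiv p)"
  have 1: "((\<lambda>t. flat p (t - a)) has_real_derivative flat (?D p) (t - a)) (at t)" for t
    by (rule DERIV_chain2[where f = "flat p" and g = "\<lambda>t. t - a" and Db = 1, OF DERIV_flat, simplified mult_1_right])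
       (auto intro!: derivative_eq_intros)
  have 2: "((\<lambda>t. flat q (b - t)) has_real_derivative - flat (?D q) (b - t)) (at t)" for t
  proof -
    have "((\<lambda>t. flat q (b - t)) has_real_derivative flat (?D q) (b - t) * (- 1)) (at t)"
      by (rule DERIV_chain2[where f = "flat q" and g = "\<lambda>t. b - t", OF DERIV_flat])
         (auto intro!: derivative_eq_intros)
    then show ?thesis by simp
  qed
  show ?case
  proof (intro bexI allI)
    show "((\<lambda>t. flat p (t - a) * flat q (b - t)) has_real_derivative
        flat (?D p) (t - a) * flat q (b - t) + (- 1) * (flat p (t - a) * flat (?D q) (b - t))) (at t)" for t
      using DERIV_mult[OF 1[of t] 2[of t]] by (simp add: mult.commute)
    show "(\<lambda>t. flat (?D p) (t - a) * flat q (b - t) + (- 1) * (flat p (t - a) * flat (?D q) (b - t))) \<in> flat_span"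
      by (rule flat_span.add[OF flat_span.prod flat_span_scale[OF flat_span.prod]])
  qed
next
  case (add f g)
  then obtain f' g' where "f' \<in> flat_span" "g' \<in> flat_span"
    "\<And>t. (f has_real_derivative f' t) (at t)" "\<And>t. (g has_real_derivative g' t) (at t)" by blast
  then show ?case
    by (intro bexI[of _ "\<lambda>t. f' t + g' t"]) (auto intro: flat_span.add DERIV_add)
qed

lemma flat_span_smooth: "f \<in> flat_span \<Longrightarrow> (deriv ^^ n) f differentiable (at t)"
proof -
  assume f: "f \<in> flat_span"
  have step: "deriv g \<in> flat_span" if g: "g \<in> flat_span" for g
  proof -
    obtain g' where "g' \<in> flat_span" "\<And>t. (g has_real_derivative g' t) (at t)" using flat_span_DERIV[OF g] by blast
    moreover from this have "deriv g = g'" by (intro ext DERIV_imp_deriv)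
    ultimately show ?thesis by simp
  qed
  have "(deriv ^^ n) f \<in> flat_span" by (induction n) (auto intro: f step)
  from flat_span_DERIV[OF this] show ?thesis by (auto simp: real_differentiable_def)
qed

text \<open>The step is the normalised primitive of a bump function.\<close>

lemma smooth_step:
  assumes ab: "a < b"
  obtains \<Psi> \<psi> :: "real \<Rightarrow> real" where "\<psi> \<in> flat_span" "\<And>t. (\<Psi> has_real_derivative \<psi> t) (at t)"
    "\<And>t. 0 \<le> \<psi> t" "\<And>t. t \<notin> {a..b} \<Longrightarrow> \<psi> t = 0"
    "\<And>t. t \<le> a \<Longrightarrow> \<Psi> t = 0" "\<And>t. b \<le> t \<Longrightarrow> \<Psi> t = 1" "\<And>t. 0 \<le> \<Psi> t \<and> \<Psi> t \<le> 1"
proof -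
  define \<beta> where "\<beta> t = flat 1 (t - a) * flat 1 (b - t)" for t
  have \<beta>_span: "\<beta> \<in> flat_span" unfolding \<beta>_def by (rule flat_span.prod)
  have \<beta>_nonneg: "0 \<le> \<beta> t" for t by (simp add: \<beta>_def flat_def)
  have \<beta>_zero: "\<beta> t = 0" if "t \<le> a \<or> b \<le> t" for t using that by (auto simp: \<beta>_def flat_def)
  have \<beta>_pos: "0 < \<beta> t" if "a < t" "t < b" for t using that by (simp add: \<beta>_def flat_def)
  have cont: "isCont \<beta> t" for t
    using flat_span_smooth[OF \<beta>_span, of 0 t] by (simp add: differentiable_imp_continuous_within)
  have "\<exists>F. \<forall>x::real. (-\<infinity>::ereal) < x \<longrightarrow> x < \<infinity> \<longrightarrow> (F has_vector_derivative \<beta> x) (at x)"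
    by (rule einterval_antiderivative) (use cont in auto)
  then obtain F where F: "\<And>x. (F has_real_derivative \<beta> x) (at x)"
    by (auto simp: has_real_derivative_iff_has_vector_derivative)
  have mono: "F x \<le> F y" if "x \<le> y" for x y
    by (rule DERIV_nonneg_imp_nondecreasing[OF that]) (use F \<beta>_nonneg in blast)
  have const: "F x = F y" if "x \<le> y" "\<And>t. x \<le> t \<Longrightarrow> t \<le> y \<Longrightarrow> \<beta> t = 0" for x y
  proof (rule antisym[OF mono[OF that(1)]])
    show "F y \<le> F x"
      by (rule DERIV_nonpos_imp_nonincreasing[OF that(1)]) (use F that(2) in fastforce)
  qed
  have left: "F t = F a" if "t \<le> a" for t using that by (intro const) (auto intro: \<beta>_zero)
  have right: "F t = F b" if "b \<le> t" for t using that by (intro const[symmetric]) (auto intro: \<beta>_zero)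
  have strict: "F a < F b"
  proof (rule DERIV_pos_imp_increasing_open[OF ab])
    show "\<exists>y. (F has_real_derivative y) (at x) \<and> 0 < y" if "a < x" "x < b" for x
      using F \<beta>_pos[OF that] by blast
    show "continuous_on {a..b} F"
      using F by (auto intro!: continuous_at_imp_continuous_on DERIV_isCont)
  qed
  define c where "c = inverse (F b - F a)"
  have c: "0 < c" "c * (F b - F a) = 1" using strict by (auto simp: c_def)
  show thesis
  proof (rule that[of "\<lambda>t. c * \<beta> t" "\<lambda>t. c * (F t - F a)"])
    show "(\<lambda>t. c * \<beta> t) \<in> flat_span" by (rule flat_span_scale[OF \<beta>_span])
    show "((\<lambda>t. c * (F t - F a)) has_real_derivative c * \<beta> t) (at t)" for t
      by (auto intro!: derivative_eq_intros F)
    show "0 \<le> c * \<beta> t" for t using c \<beta>_nonneg by simp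
    show "t \<notin> {a..b} \<Longrightarrow> c * \<beta> t = 0" for t using \<beta>_zero[of t] by auto
    show "t \<le> a \<Longrightarrow> c * (F t - F a) = 0" for t by (simp only: left[of t]) simp
    show "b \<le> t \<Longrightarrow> c * (F t - F a) = 1" for t using c(2) by (simp only: right[of t])
    show "0 \<le> c * (F t - F a) \<and> c * (F t - F a) \<le> 1" for t
    proof -
      have "F a \<le> F t \<and> F t \<le> F b"
        using mono[of a t] mono[of t b] left[of t] right[of t] strict by linarith
      then have "0 \<le> c * (F t - F a)" "c * (F t - F a) \<le> c * (F b - F a)"
        using c(1) by (auto intro: mult_left_mono)
      then show ?thesis using c(2) by simp
    qed
  qed
qed

section \<open>Increments of functions with a weak derivative\<close>

lemma integrable_continuous_open_interval:
  fixes k :: "real \<Rightarrow> real"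
  assumes "continuous_on {0..T} k"
  shows "integrable (lebesgue_on {0<..<T}) k"
proof -
  have "set_integrable lebesgue {0..T} k"
    by (rule absolutely_integrable_continuous_real[OF assms])
  then have "set_integrable lebesgue {0<..<T} k"
    by (rule set_integrable_subset) auto
  then show ?thesis by (simp add: set_integrable_def integrable_restrict_space)
qed

text \<open>The test function rises from 0 to 1 just after \<open>s\<close> and falls back to 0 just before \<open>t\<close>. Its derivative is the difference of two
approximate unit masses at \<open>s\<close> and \<open>t\<close>, so that the integral tends to \<open>g s - g t\<close>.\<close>

lemma increment_le_if_weak_derivative_le:
  fixes g :: "real \<Rightarrow> real"
  assumes g: "continuous_on {0..T} g" and st: "0 < s" "s < t" "t < T"
    and weak: "\<And>\<phi>. \<phi> \<in> test_functions T \<Longrightarrow> (\<And>\<tau>. 0 \<le> \<phi> \<tau> \<and> \<phi> \<tau> \<le> 1) \<Longrightarrow> (\<And>\<tau>. \<tau> \<notin> {s<..<t} \<Longrightarrow> \<phi> \<tau> = 0)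
      \<Longrightarrow> - L \<le> (LINT \<tau>|lebesgue_on {0<..<T}. deriv \<phi> \<tau> * g \<tau>)"
  shows "g t - g s \<le> L"
proof (rule field_le_epsilon)
  fix e :: real assume e: "0 < e"
  have near: "\<exists>d>0. \<forall>\<tau>\<in>{0..T}. \<bar>\<tau> - r\<bar> \<le> d \<longrightarrow> \<bar>g \<tau> - g r\<bar> \<le> e / 2" if r: "r \<in> {0..T}" for r
  proof -
    obtain d where d: "0 < d" "\<And>\<tau>. \<tau> \<in> {0..T} \<Longrightarrow> dist \<tau> r < d \<Longrightarrow> dist (g \<tau>) (g r) < e / 2"
      using bspec[OF g[unfolded continuous_on_iff] r, rule_format, of "e / 2"] e by auto
    then show ?thesis by (intro exI[of _ "d / 2"]) (fastforce simp: dist_real_def)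
  qed
  obtain d1 where d1: "0 < d1" "\<And>\<tau>. \<tau> \<in> {0..T} \<Longrightarrow> \<bar>\<tau> - s\<bar> \<le> d1 \<Longrightarrow> \<bar>g \<tau> - g s\<bar> \<le> e / 2"
    using near[of s] st by auto
  obtain d2 where d2: "0 < d2" "\<And>\<tau>. \<tau> \<in> {0..T} \<Longrightarrow> \<bar>\<tau> - t\<bar> \<le> d2 \<Longrightarrow> \<bar>g \<tau> - g t\<bar> \<le> e / 2"
    using near[of t] st by auto
  define d where "d = min (min d1 d2) ((t - s) / 2)"
  have d: "0 < d" "d \<le> d1" "d \<le> d2" "s + d \<le> t - d" using d1(1) d2(1) st by (auto simp: d_def min_def field_simps)
  have lt: "s < s + d" "t - d < t" using d(1) by auto
  obtain \<Psi>1 \<psi>1 where s1: "\<psi>1 \<in> flat_span" "\<And>t. (\<Psi>1 has_real_derivative \<psi>1 t) (at t)"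
    "\<And>t. 0 \<le> \<psi>1 t" "\<And>\<tau>. \<tau> \<notin> {s..s + d} \<Longrightarrow> \<psi>1 \<tau> = 0"
    "\<And>\<tau>. \<tau> \<le> s \<Longrightarrow> \<Psi>1 \<tau> = 0" "\<And>\<tau>. s + d \<le> \<tau> \<Longrightarrow> \<Psi>1 \<tau> = 1" "\<And>t. 0 \<le> \<Psi>1 t \<and> \<Psi>1 t \<le> 1"
    by (rule smooth_step[OF lt(1)], rule that, assumption+)
  obtain \<Psi>2 \<psi>2 where s2: "\<psi>2 \<in> flat_span" "\<And>t. (\<Psi>2 has_real_derivative \<psi>2 t) (at t)"
    "\<And>t. 0 \<le> \<psi>2 t" "\<And>\<tau>. \<tau> \<notin> {t - d..t} \<Longrightarrow> \<psi>2 \<tau> = 0"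
    "\<And>\<tau>. \<tau> \<le> t - d \<Longrightarrow> \<Psi>2 \<tau> = 0" "\<And>\<tau>. t \<le> \<tau> \<Longrightarrow> \<Psi>2 \<tau> = 1" "\<And>t. 0 \<le> \<Psi>2 t \<and> \<Psi>2 t \<le> 1"
    by (rule smooth_step[OF lt(2)], rule that, assumption+)
  define \<phi> where "\<phi> \<tau> = \<Psi>1 \<tau> - \<Psi>2 \<tau>" for \<tau>
  define \<psi> where "\<psi> \<tau> = \<psi>1 \<tau> - \<psi>2 \<tau>" for \<tau>
  have \<psi>: "\<psi> \<in> flat_span"
    using flat_span.add[OF s1(1) flat_span_scale[OF s2(1), of "- 1"]] by (simp add: \<psi>_def[abs_def])
  have D: "(\<phi> has_real_derivative \<psi> \<tau>) (at \<tau>)" for \<tau>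
    unfolding \<phi>_def[abs_def] \<psi>_def by (rule DERIV_diff[OF s1(2) s2(2)])
  have deriv: "deriv \<phi> = \<psi>" using D by (intro ext DERIV_imp_deriv)
  have zero: "\<phi> \<tau> = 0" if "\<tau> \<notin> {s<..<t}" for \<tau>
    using that s1(5,6)[of \<tau>] s2(5,6)[of \<tau>] d st by (cases "\<tau> \<le> s") (auto simp: \<phi>_def)
  have test: "\<phi> \<in> test_functions T"
    unfolding test_functions_def
  proof (intro CollectI conjI allI)
    have "0 < s \<and> s < t \<and> t < T \<and> (\<forall>\<tau>. \<tau> \<notin> {s..t} \<longrightarrow> \<phi> \<tau> = 0)" using st zero by auto
    then show "\<exists>a b. 0 < a \<and> a < b \<and> b < T \<and> (\<forall>\<tau>. \<tau> \<notin> {a..b} \<longrightarrow> \<phi> \<tau> = 0)" by blast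
    fix n \<tau>
    show "(deriv ^^ n) \<phi> differentiable (at \<tau>)"
    proof (cases n)
      case 0
      then show ?thesis using D[of \<tau>] by (auto simp: real_differentiable_def)
    next
      case (Suc k)
      then show ?thesis using flat_span_smooth[OF \<psi>, of k \<tau>] by (simp add: funpow_swap1 deriv)
    qed
  qed
  have range: "0 \<le> \<phi> \<tau> \<and> \<phi> \<tau> \<le> 1" for \<tau>
    using s1(6)[of \<tau>] s1(7)[of \<tau>] s2(5)[of \<tau>] s2(7)[of \<tau>] d by (cases "\<tau> \<le> t - d") (auto simp: \<phi>_def)
  have cont: "continuous_on {0..T} h" if "h \<in> flat_span" for h
    using flat_span_smooth[OF that, of 0]
    by (auto intro!: continuous_at_imp_continuous_on differentiable_imp_continuous_within)
  have one: "(LINT \<tau>|lebesgue_on {0<..<T}. h \<tau>) = H T - H 0"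
    if "h \<in> flat_span" and "\<And>\<tau>. (H has_real_derivative h \<tau>) (at \<tau>)" for h H
  proof -
    have "(h has_integral H T - H 0) {0..T}"
      using st that(2) by (intro fundamental_theorem_of_calculus)
        (auto simp: has_real_derivative_iff_has_vector_derivative[symmetric] intro: has_field_derivative_at_within)
    then have "integral {0<..<T} h = H T - H 0"
      by (simp add: integral_open_interval_real[symmetric] integral_unique)
    then show ?thesis
      using lebesgue_integral_eq_integral[OF integrable_continuous_open_interval[OF cont[OF that(1)]]] by simp
  qed
  have int: "(LINT \<tau>|lebesgue_on {0<..<T}. \<psi>1 \<tau>) = 1" "(LINT \<tau>|lebesgue_on {0<..<T}. \<psi>2 \<tau>) = 1"
    using one[OF s1(1,2)] one[OF s2(1,2)] s1(5)[of 0] s1(6)[of T] s2(5)[of 0] s2(6)[of T] st d by auto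
  note i1 = integrable_continuous_open_interval[OF cont[OF s1(1)]]
  note i2 = integrable_continuous_open_interval[OF cont[OF s2(1)]]
  have "- L \<le> (LINT \<tau>|lebesgue_on {0<..<T}. \<psi> \<tau> * g \<tau>)"
    using weak[OF test range zero] by (simp add: deriv)
  also have "\<dots> \<le> (LINT \<tau>|lebesgue_on {0<..<T}. \<psi>1 \<tau> * (g s + e / 2) - \<psi>2 \<tau> * (g t - e / 2))"
  proof (rule integral_mono)
    show "integrable (lebesgue_on {0<..<T}) (\<lambda>\<tau>. \<psi> \<tau> * g \<tau>)"
      by (intro integrable_continuous_open_interval continuous_intros g cont \<psi>)
    show "integrable (lebesgue_on {0<..<T}) (\<lambda>\<tau>. \<psi>1 \<tau> * (g s + e / 2) - \<psi>2 \<tau> * (g t - e / 2))"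
      by (intro Bochner_Integration.integrable_diff integrable_mult_left i1 i2)
    fix \<tau> assume "\<tau> \<in> space (lebesgue_on {0<..<T})"
    then have \<tau>: "\<tau> \<in> {0..T}" by simp
    have "\<psi>1 \<tau> * g \<tau> \<le> \<psi>1 \<tau> * (g s + e / 2)"
    proof (cases "\<tau> \<in> {s..s + d}")
      case True
      then have "\<bar>\<tau> - s\<bar> \<le> d1" using d by auto
      from d1(2)[OF \<tau> this] have "g \<tau> \<le> g s + e / 2" by linarith
      then show ?thesis using s1(3) by (rule mult_left_mono)
    qed (simp add: s1(4))
    moreover have "\<psi>2 \<tau> * (g t - e / 2) \<le> \<psi>2 \<tau> * g \<tau>"
    proof (cases "\<tau> \<in> {t - d..t}")
      case True
      then have "\<bar>\<tau> - t\<bar> \<le> d2" using d by auto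
      from d2(2)[OF \<tau> this] have "g t - e / 2 \<le> g \<tau>" by linarith
      then show ?thesis using s2(3) by (rule mult_left_mono)
    qed (simp add: s2(4))
    ultimately show "\<psi> \<tau> * g \<tau> \<le> \<psi>1 \<tau> * (g s + e / 2) - \<psi>2 \<tau> * (g t - e / 2)"
      by (simp add: \<psi>_def left_diff_distrib)
  qed
  also have "\<dots> = (g s + e / 2) - (g t - e / 2)"
    using i1 i2 by (simp add: int)
  finally show "g t - g s \<le> L + e" by (simp add: field_simps)
qed

context l2
begin

text \<open>Monotonicity of the integral, tested with \<open>h\<close>. Only \<open>k\<close> and the errors of the simple approximations are integrated, and the
definition of the Bochner integral makes the latter measurable.
Two integrals are compared at once because the definition of the integral does not yield the measurability
that is needed to subtract them.\<close>

lemma bochner_integral_compare: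
  assumes fin: "finite_measure M"
    and U1: "L2_has_bochner_integral \<nu> M u1 G1" and U2: "L2_has_bochner_integral \<nu> M u2 G2"
    and h: "h \<in> L2 \<nu>" and k: "integrable M k"
    and le: "AE t in M. u1 t \<in> L2 \<nu> \<longrightarrow> u2 t \<in> L2 \<nu> \<longrightarrow> ip h (u1 t) - ip h (u2 t) \<le> k t"
  shows "ip h G1 - ip h G2 \<le> (LINT t|M. k t)"
proof -
  have approx: "\<exists>s e. (\<forall>n. L2_simple \<nu> M (s n)) \<and> (AE t in M. u t \<in> L2 \<nu>) \<and>
      (\<forall>n. \<forall>t\<in>space M. u t \<in> L2 \<nu> \<longrightarrow> e n t = nrm (u t - s n t)) \<and>
      (\<forall>\<^sub>F n in sequentially. integrable M (e n)) \<and> (\<lambda>n. LINT t|M. e n t) \<longlonglongrightarrow> 0 \<and>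
      (\<lambda>n. ip h (L2_simple_integral M (s n))) \<longlonglongrightarrow> ip h G"
    if U: "L2_has_bochner_integral \<nu> M u G" for u G
  proof -
    from U obtain s where G: "G \<in> L2 \<nu>" and uL: "AE t in M. u t \<in> L2 \<nu>"
      and s: "\<And>n. L2_simple \<nu> M (s n)"
      and meas: "\<And>n. (\<lambda>t. L2_norm \<nu> (\<lambda>x. u t x - s n t x)) \<in> borel_measurable M"
      and lim: "(\<lambda>n. \<integral>\<^sup>+t. ennreal (L2_norm \<nu> (\<lambda>x. u t x - s n t x)) \<partial>M) \<longlonglongrightarrow> 0"
      and limG: "(\<lambda>n. L2_norm \<nu> (\<lambda>x. L2_simple_integral M (s n) x - G x)) \<longlonglongrightarrow> 0"
      unfolding L2_has_bochner_integral_def by blast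
    define e where "e n t = L2_norm \<nu> (\<lambda>x. u t x - s n t x)" for n t
    have e_nonneg: "0 \<le> e n t" for n t by (simp add: e_def L2_norm_def)
    have e_eq: "e n t = nrm (u t - s n t)" if "t \<in> space M" "u t \<in> L2 \<nu>" for n t
      unfolding e_def using s[of n] that by (intro L2_norm_diff) (auto simp: L2_simple_def)
    have ev: "\<forall>\<^sub>F n in sequentially. integrable M (e n)"
    proof -
      have "\<forall>\<^sub>F n in sequentially. (\<integral>\<^sup>+t. ennreal (e n t) \<partial>M) < 1"
        using lim unfolding e_def by (rule order_tendstoD) simp
      then show ?thesis
      proof eventually_elim
        case (elim n)
        have "e n \<in> borel_measurable M" using meas[of n] by (simp add: e_def[abs_def])
        moreover have "(\<integral>\<^sup>+t. ennreal (e n t) \<partial>M) < \<infinity>" using elim by (rule less_trans) simp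
        ultimately show ?case using e_nonneg by (intro integrableI_nonneg) auto
      qed
    qed
    have "(\<lambda>n. enn2real (\<integral>\<^sup>+t. ennreal (e n t) \<partial>M)) \<longlonglongrightarrow> enn2real 0"
      using lim unfolding e_def by (intro tendsto_enn2real) auto
    moreover have "(LINT t|M. e n t) = enn2real (\<integral>\<^sup>+t. ennreal (e n t) \<partial>M)" for n
      using meas[of n] e_nonneg by (intro integral_eq_nn_integral) (auto simp: e_def)
    ultimately have "(\<lambda>n. LINT t|M. e n t) \<longlonglongrightarrow> 0" by simp
    moreover have "(\<lambda>n. ip h (L2_simple_integral M (s n))) \<longlonglongrightarrow> ip h G"
    proof -
      have "L2_norm \<nu> (\<lambda>x. L2_simple_integral M (s n) x - G x) = nrm (L2_simple_integral M (s n) - G)" for n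
        by (rule L2_norm_diff[OF L2_simple_integral_L2[OF s] G])
      then have "(\<lambda>n. nrm (L2_simple_integral M (s n) - G)) \<longlonglongrightarrow> 0" using limG by simp
      from tendsto_ip[OF this, of h] show ?thesis by (simp add: ip_sym[of h])
    qed
    ultimately show ?thesis using s uL e_eq ev by blast
  qed
  from approx[OF U1] obtain s1 e1 where 1: "\<And>n. L2_simple \<nu> M (s1 n)" "AE t in M. u1 t \<in> L2 \<nu>"
      "\<And>n t. t \<in> space M \<Longrightarrow> u1 t \<in> L2 \<nu> \<Longrightarrow> e1 n t = nrm (u1 t - s1 n t)"
      "\<forall>\<^sub>F n in sequentially. integrable M (e1 n)" "(\<lambda>n. LINT t|M. e1 n t) \<longlonglongrightarrow> 0"
      "(\<lambda>n. ip h (L2_simple_integral M (s1 n))) \<longlonglongrightarrow> ip h G1" by blast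
  from approx[OF U2] obtain s2 e2 where 2: "\<And>n. L2_simple \<nu> M (s2 n)" "AE t in M. u2 t \<in> L2 \<nu>"
      "\<And>n t. t \<in> space M \<Longrightarrow> u2 t \<in> L2 \<nu> \<Longrightarrow> e2 n t = nrm (u2 t - s2 n t)"
      "\<forall>\<^sub>F n in sequentially. integrable M (e2 n)" "(\<lambda>n. LINT t|M. e2 n t) \<longlonglongrightarrow> 0"
      "(\<lambda>n. ip h (L2_simple_integral M (s2 n))) \<longlonglongrightarrow> ip h G2" by blast
  have "\<forall>\<^sub>F n in sequentially. ip h (L2_simple_integral M (s1 n)) - ip h (L2_simple_integral M (s2 n))
      \<le> (LINT t|M. k t) + nrm h * ((LINT t|M. e1 n t) + (LINT t|M. e2 n t))"
    using 1(4) 2(4)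
  proof eventually_elim
    case (elim n)
    have int: "integrable M (\<lambda>t. ip h (s1 n t))" "integrable M (\<lambda>t. ip h (s2 n t))"
      using 1(1)[of n] 2(1)[of n] integrable_simple_compose[OF fin, of _ "ip h"] by (auto simp: L2_simple_def)
    have "ip h (L2_simple_integral M (s1 n)) - ip h (L2_simple_integral M (s2 n))
        = (LINT t|M. ip h (s1 n t) - ip h (s2 n t))"
      unfolding ip_simple_integral[OF fin 1(1)] ip_simple_integral[OF fin 2(1)] using int by simp
    also have "\<dots> \<le> (LINT t|M. k t + nrm h * (e1 n t + e2 n t))"
    proof (rule integral_mono_AE)
      show "AE t in M. ip h (s1 n t) - ip h (s2 n t) \<le> k t + nrm h * (e1 n t + e2 n t)"
        using le 1(2) 2(2) AE_space
      proof eventually_elim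
        case (elim t)
        have "ip h (s1 n t) - ip h (s2 n t) = (ip h (u1 t) - ip h (u2 t)) - ip h (u1 t - s1 n t) + ip h (u2 t - s2 n t)"
          by (simp only: ip_diff_right)
        moreover have "- ip h (u1 t - s1 n t) \<le> nrm h * e1 n t" "ip h (u2 t - s2 n t) \<le> nrm h * e2 n t"
          using cauchy_schwarz[of h "u1 t - s1 n t"] cauchy_schwarz[of h "u2 t - s2 n t"] 1(3) 2(3) elim by auto
        ultimately show ?case using elim by (simp add: distrib_left)
      qed
    qed (use int k elim in auto)
    also have "\<dots> = (LINT t|M. k t) + nrm h * ((LINT t|M. e1 n t) + (LINT t|M. e2 n t))"
      using k elim by simp
    finally show ?case .
  qed
  moreover have "(\<lambda>n. ip h (L2_simple_integral M (s1 n)) - ip h (L2_simple_integral M (s2 n))) \<longlonglongrightarrow> ip h G1 - ip h G2"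
    by (intro tendsto_intros 1 2)
  moreover have "(\<lambda>n. (LINT t|M. k t) + nrm h * ((LINT t|M. e1 n t) + (LINT t|M. e2 n t)))
      \<longlonglongrightarrow> (LINT t|M. k t) + nrm h * (0 + 0)"
    by (intro tendsto_intros 1 2)
  ultimately have "ip h G1 - ip h G2 \<le> (LINT t|M. k t) + nrm h * (0 + 0)"
    by (intro tendsto_le[OF sequentially_bot])
  then show ?thesis by simp
qed

lemma L2_continuous_tendsto:
  assumes "L2_continuous_on \<nu> S v" and t: "t \<in> S"
  shows "((\<lambda>s. nrm (v s - v t)) \<longlongrightarrow> 0) (at t within S)"
proof -
  have "\<forall>\<^sub>F s in at t within S. L2_norm \<nu> (\<lambda>x. v s x - v t x) = nrm (v s - v t)"
    unfolding eventually_at_filter using assms by (auto simp: L2_continuous_on_def L2_norm_diff)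
  then show ?thesis
    using assms by (auto simp: L2_continuous_on_def intro: Lim_transform_eventually)
qed

lemma continuous_on_ip:
  assumes "L2_continuous_on \<nu> S v"
  shows "continuous_on S (\<lambda>t. ip h (v t))"
  unfolding continuous_on_def
proof
  fix t assume "t \<in> S"
  from tendsto_ip[OF L2_continuous_tendsto[OF assms this], of h]
  show "((\<lambda>t. ip h (v t)) \<longlongrightarrow> ip h (v t)) (at t within S)" by (simp add: ip_sym[of h])
qed

lemma increment_le_if_W11loc_deriv_le:
  assumes T: "0 < s" "s < t" "t < T"
    and cont: "L2_continuous_on \<nu> {0..T} v" "L2_continuous_on \<nu> {0..T} w"
    and W: "W11loc_deriv \<nu> T v v'" "W11loc_deriv \<nu> T w w'"
    and h: "h \<in> L2 \<nu>" and L: "0 \<le> L"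
    and le: "AE \<tau> in lebesgue_on {0<..<T}. s < \<tau> \<longrightarrow> \<tau> < t \<longrightarrow> ip h (v' \<tau>) - ip h (w' \<tau>) \<le> L"
  shows "ip h ((v t - w t) - (v s - w s)) \<le> L * (t - s)"
proof -
  have fin: "finite_measure (lebesgue_on {0<..<T})"
    by (rule finite_S[where b = T]) auto
  have "(ip h (v t) - ip h (w t)) - (ip h (v s) - ip h (w s)) \<le> L * (t - s)"
  proof (rule increment_le_if_weak_derivative_le[OF _ T])
    show g: "continuous_on {0..T} (\<lambda>t. ip h (v t) - ip h (w t))"
      by (intro continuous_on_diff continuous_on_ip cont)
    fix \<phi> assume \<phi>: "\<phi> \<in> test_functions T" and range: "\<And>\<tau>. 0 \<le> \<phi> \<tau> \<and> \<phi> \<tau> \<le> 1"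
      and zero: "\<And>\<tau>. \<tau> \<notin> {s<..<t} \<Longrightarrow> \<phi> \<tau> = 0"
    obtain Gv where Gv: "L2_has_bochner_integral \<nu> (lebesgue_on {0<..<T}) (\<lambda>t. deriv \<phi> t *\<^sub>R v t) Gv"
      "L2_has_bochner_integral \<nu> (lebesgue_on {0<..<T}) (\<lambda>t. \<phi> t *\<^sub>R v' t) (- Gv)"
      using W(1) \<phi> unfolding W11loc_deriv_def by (auto simp: scaleR_fun_def fun_Compl_def)
    obtain Gw where Gw: "L2_has_bochner_integral \<nu> (lebesgue_on {0<..<T}) (\<lambda>t. deriv \<phi> t *\<^sub>R w t) Gw"
      "L2_has_bochner_integral \<nu> (lebesgue_on {0<..<T}) (\<lambda>t. \<phi> t *\<^sub>R w' t) (- Gw)"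
      using W(2) \<phi> unfolding W11loc_deriv_def by (auto simp: scaleR_fun_def fun_Compl_def)
    have cd: "continuous_on UNIV (deriv \<phi>)" using test_function_props[OF \<phi>] by metis
    have int: "integrable (lebesgue_on {0<..<T}) (\<lambda>\<tau>. deriv \<phi> \<tau> * (ip h (v \<tau>) - ip h (w \<tau>)))"
      by (intro integrable_continuous_open_interval continuous_intros g continuous_on_subset[OF cd]) auto
    have "ip h Gv - ip h Gw \<le> (LINT \<tau>|lebesgue_on {0<..<T}. deriv \<phi> \<tau> * (ip h (v \<tau>) - ip h (w \<tau>)))"
      by (rule bochner_integral_compare[OF fin Gv(1) Gw(1) h int])
         (simp add: ip_scale_right right_diff_distrib)
    moreover have "ip h (- Gv) - ip h (- Gw) \<le> (LINT \<tau>|lebesgue_on {0<..<T}. indicator {s<..<t} \<tau> * L)"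
    proof (rule bochner_integral_compare[OF fin Gv(2) Gw(2) h])
      show "integrable (lebesgue_on {0<..<T}) (\<lambda>\<tau>. indicator {s<..<t} \<tau> * L)"
        using T by (intro integrable_mult_left integrable_real_indicator)
          (auto simp: sets_restrict_space_iff finite_measure.emeasure_eq_measure[OF fin])
      show "AE \<tau> in lebesgue_on {0<..<T}. \<phi> \<tau> *\<^sub>R v' \<tau> \<in> L2 \<nu> \<longrightarrow> \<phi> \<tau> *\<^sub>R w' \<tau> \<in> L2 \<nu> \<longrightarrow>
          ip h (\<phi> \<tau> *\<^sub>R v' \<tau>) - ip h (\<phi> \<tau> *\<^sub>R w' \<tau>) \<le> indicator {s<..<t} \<tau> * L"
        using le
      proof eventually_elim
        case (elim \<tau>)
        show ?case
        proof (cases "\<tau> \<in> {s<..<t}")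
          case True
          then have "\<phi> \<tau> * (ip h (v' \<tau>) - ip h (w' \<tau>)) \<le> \<phi> \<tau> * L"
            using elim range[of \<tau>] by (intro mult_left_mono) auto
          also have "\<dots> \<le> 1 * L" using range[of \<tau>] L by (intro mult_right_mono) auto
          finally show ?thesis using True by (simp add: ip_scale_right right_diff_distrib)
        qed (simp add: zero ip_scale_right)
      qed
    qed
    moreover have "(LINT \<tau>|lebesgue_on {0<..<T}. indicator {s<..<t} \<tau> * L) = L * (t - s)"
    proof -
      have "measure (lebesgue_on {0<..<T}) {s<..<t} = t - s"
        using T by (subst measure_restrict_space) auto
      then show ?thesis using T by (simp add: sets_restrict_space_iff space_restrict_space Int_absorb1 mult.commute)
    qed
    ultimately show "- (L * (t - s)) \<le> (LINT \<tau>|lebesgue_on {0<..<T}. deriv \<phi> \<tau> * (ip h (v \<tau>) - ip h (w \<tau>)))"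
      unfolding ip_minus_right by linarith
  qed
  then show ?thesis by (simp only: ip_diff_right)
qed

end

section \<open>Comparison of norms by means of excess integrals\<close>

text \<open>The function \<open>y\<^sup>r\<close> as a superposition of the functions \<open>(y - k)\<^sup>+\<close>, the weight being its second derivative up to a
constant factor.\<close>

lemma powr_layer_integral:
  fixes y r :: real
  assumes r: "1 < r" and y: "0 \<le> y"
  shows "(\<integral>\<^sup>+k. ennreal (indicator {0..} k * (k powr (r - 2) * max (y - k) 0)) \<partial>lborel)
    = ennreal (y powr r / (r * (r - 1)))"
proof -
  have 1: "((\<lambda>k. k powr (r - 2)) has_integral (y powr (r - 1) / (r - 1))) {0..y}"
    using has_integral_powr_from_0[of "r - 2" y] r y by simp
  have 2: "((\<lambda>k. k powr (r - 1)) has_integral (y powr r / r)) {0..y}"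
    using has_integral_powr_from_0[of "r - 1" y] r y by simp
  have "((\<lambda>k. y * k powr (r - 2) - k powr (r - 1)) has_integral (y * (y powr (r - 1) / (r - 1)) - y powr r / r)) {0..y}"
    by (intro has_integral_diff has_integral_mult_right 1 2)
  moreover have "y * (y powr (r - 1) / (r - 1)) - y powr r / r = y powr r / (r * (r - 1))"
  proof (cases "y = 0")
    case False
    then have "y * y powr (r - 1) = y powr r"
      using y by (simp add: powr_diff)
    then show ?thesis using r by (simp add: field_simps)
  qed simp
  moreover have "y * k powr (r - 2) - k powr (r - 1) = k powr (r - 2) * (y - k)" if "0 \<le> k" for k
  proof (cases "k = 0")
    case False
    then have "k powr (r - 1) = k * k powr (r - 2)"
      using that powr_add[of k 1 "r - 2"] by simp
    then show ?thesis by (simp add: algebra_simps)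
  qed simp
  ultimately have "((\<lambda>k. k powr (r - 2) * (y - k)) has_integral (y powr r / (r * (r - 1)))) {0..y}"
    by (subst has_integral_cong[where g = "\<lambda>k. y * k powr (r - 2) - k powr (r - 1)"]) auto
  from nn_integral_has_integral_lebesgue[OF _ this]
  have "(\<integral>\<^sup>+k. ennreal (indicator {0..y} k * (k powr (r - 2) * (y - k))) \<partial>lborel) = ennreal (y powr r / (r * (r - 1)))"
    by simp
  moreover have "indicator {0..y} k * (k powr (r - 2) * (y - k)) = indicator {0..} k * (k powr (r - 2) * max (y - k) 0)" for k
    by (auto simp: indicator_def)
  ultimately show ?thesis by simp
qed

lemma (in finite_measure) nn_integral_powr_mono_excess:
  fixes a c :: "'a \<Rightarrow> real"
  assumes [measurable]: "a \<in> borel_measurable M" "c \<in> borel_measurable M"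
    and nonneg: "\<And>x. 0 \<le> a x" "\<And>x. 0 \<le> c x"
    and excess: "\<And>k. 0 \<le> k \<Longrightarrow> (\<integral>\<^sup>+x. ennreal (max (a x - k) 0) \<partial>M) \<le> (\<integral>\<^sup>+x. ennreal (max (c x - k) 0) \<partial>M)"
    and r: "1 \<le> r"
  shows "(\<integral>\<^sup>+x. ennreal (a x powr r) \<partial>M) \<le> (\<integral>\<^sup>+x. ennreal (c x powr r) \<partial>M)"
proof (cases "r = 1")
  case True
  then show ?thesis using excess[of 0] nonneg by (simp add: max_absorb1)
next
  case False
  with r have r: "1 < r" by simp
  interpret pair_sigma_finite lborel M ..
  have layer: "(\<integral>\<^sup>+x. ennreal (g x powr r / (r * (r - 1))) \<partial>M)
      = (\<integral>\<^sup>+k. ennreal (indicator {0..} k * k powr (r - 2)) * (\<integral>\<^sup>+x. ennreal (max (g x - k) 0) \<partial>M) \<partial>lborel)"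
    if [measurable]: "g \<in> borel_measurable M" and g: "\<And>x. 0 \<le> g x" for g
  proof -
    have "(\<integral>\<^sup>+x. ennreal (g x powr r / (r * (r - 1))) \<partial>M)
        = (\<integral>\<^sup>+x. \<integral>\<^sup>+k. ennreal (indicator {0..} k * (k powr (r - 2) * max (g x - k) 0)) \<partial>lborel \<partial>M)"
      by (simp add: powr_layer_integral[OF r g])
    also have "\<dots> = (\<integral>\<^sup>+k. \<integral>\<^sup>+x. ennreal (indicator {0..} k * (k powr (r - 2) * max (g x - k) 0)) \<partial>M \<partial>lborel)"
      by (rule Fubini') measurable
    also have "\<dots> = (\<integral>\<^sup>+k. \<integral>\<^sup>+x. ennreal (indicator {0..} k * k powr (r - 2)) * ennreal (max (g x - k) 0) \<partial>M \<partial>lborel)"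
      by (intro nn_integral_cong) (simp add: mult.assoc flip: ennreal_mult)
    also have "\<dots> = (\<integral>\<^sup>+k. ennreal (indicator {0..} k * k powr (r - 2)) * (\<integral>\<^sup>+x. ennreal (max (g x - k) 0) \<partial>M) \<partial>lborel)"
      by (intro nn_integral_cong nn_integral_cmult) measurable
    finally show ?thesis .
  qed
  have scale: "(\<integral>\<^sup>+x. ennreal (g x powr r) \<partial>M) = ennreal (r * (r - 1)) * (\<integral>\<^sup>+x. ennreal (g x powr r / (r * (r - 1))) \<partial>M)"
    if [measurable]: "g \<in> borel_measurable M" for g
    using r by (subst nn_integral_cmult[symmetric]) (auto simp flip: ennreal_mult)
  have "(\<integral>\<^sup>+k. ennreal (indicator {0..} k * k powr (r - 2)) * (\<integral>\<^sup>+x. ennreal (max (a x - k) 0) \<partial>M) \<partial>lborel)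
     \<le> (\<integral>\<^sup>+k. ennreal (indicator {0..} k * k powr (r - 2)) * (\<integral>\<^sup>+x. ennreal (max (c x - k) 0) \<partial>M) \<partial>lborel)"
  proof (intro nn_integral_mono)
    fix k :: real
    show "ennreal (indicator {0..} k * k powr (r - 2)) * (\<integral>\<^sup>+x. ennreal (max (a x - k) 0) \<partial>M)
       \<le> ennreal (indicator {0..} k * k powr (r - 2)) * (\<integral>\<^sup>+x. ennreal (max (c x - k) 0) \<partial>M)"
      using excess[of k] by (cases "0 \<le> k") (auto intro: mult_left_mono)
  qed
  then show ?thesis
    unfolding scale[OF assms(1)] scale[OF assms(2)] layer[OF assms(1) nonneg(1)] layer[OF assms(2) nonneg(2)]
    by (intro mult_left_mono) auto
qed

text \<open>For finite \<open>q\<close> integrate the layer formula; for \<open>q = \<infinity>\<close> take \<open>k\<close> to be the essential supremum of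
\<open>c\<close>, at which the excess of \<open>c\<close>, and hence that of \<open>a\<close>, vanishes.\<close>

lemma (in finite_measure) Lq_norm_mono_excess:
  fixes a c :: "'a \<Rightarrow> real"
  assumes meas [measurable]: "a \<in> borel_measurable M" "c \<in> borel_measurable M"
    and nonneg: "\<And>x. 0 \<le> a x" "\<And>x. 0 \<le> c x"
    and excess: "\<And>k. 0 \<le> k \<Longrightarrow> (\<integral>\<^sup>+x. ennreal (max (a x - k) 0) \<partial>M) \<le> (\<integral>\<^sup>+x. ennreal (max (c x - k) 0) \<partial>M)"
    and q: "1 \<le> q"
  shows "Lq_norm M q a \<le> Lq_norm M q c"
proof (cases "q = \<infinity>")
  case True
  let ?E = "esssup M (\<lambda>x. ennreal \<bar>c x\<bar>)"
  have "esssup M (\<lambda>x. ennreal \<bar>a x\<bar>) \<le> ?E"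
  proof (cases "?E = \<infinity>")
    case False
    define k where "k = enn2real ?E"
    have k: "ennreal k = ?E" "0 \<le> k" using False by (simp_all add: k_def less_top)
    have "AE x in M. c x \<le> k"
      using esssup_AE[of "\<lambda>x. ennreal \<bar>c x\<bar>" M]
    proof eventually_elim
      case (elim x)
      then have "ennreal \<bar>c x\<bar> \<le> ennreal k" by (simp add: k)
      then show ?case using k(2) nonneg(2)[of x] by (simp add: ennreal_le_iff)
    qed
    then have "(\<integral>\<^sup>+x. ennreal (max (c x - k) 0) \<partial>M) = 0"
      by (subst nn_integral_0_iff_AE) (auto simp: ennreal_eq_0_iff)
    then have "(\<integral>\<^sup>+x. ennreal (max (a x - k) 0) \<partial>M) = 0" using excess[OF k(2)] by simp
    then have "AE x in M. a x \<le> k"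
      by (subst (asm) nn_integral_0_iff_AE) (auto simp: ennreal_eq_0_iff)
    then have "AE x in M. ennreal \<bar>a x\<bar> \<le> ?E"
      unfolding k(1)[symmetric] by eventually_elim (use nonneg(1) in \<open>simp add: ennreal_leI\<close>)
    then show ?thesis by (intro esssup_I) auto
  qed simp
  then show ?thesis using True by (simp add: Lq_norm_def)
next
  case False
  define r where "r = enn2real q"
  have "1 \<le> r"
    using q False unfolding r_def by (metis enn2real_1 enn2real_mono infinity_ennreal_def less_top)
  have le: "(\<integral>\<^sup>+x. ennreal (\<bar>a x\<bar> powr r) \<partial>M) \<le> (\<integral>\<^sup>+x. ennreal (\<bar>c x\<bar> powr r) \<partial>M)"
    using nn_integral_powr_mono_excess[OF meas nonneg excess \<open>1 \<le> r\<close>] nonneg by simp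
  show ?thesis
  proof (cases "(\<integral>\<^sup>+x. ennreal (\<bar>c x\<bar> powr r) \<partial>M) = \<infinity>")
    case True
    then show ?thesis using False by (simp add: Lq_norm_def r_def Let_def)
  next
    case fin: False
    then have fin': "(\<integral>\<^sup>+x. ennreal (\<bar>a x\<bar> powr r) \<partial>M) \<noteq> \<infinity>" using le by (auto simp: top_unique)
    have "enn2real (\<integral>\<^sup>+x. ennreal (\<bar>a x\<bar> powr r) \<partial>M) \<le> enn2real (\<integral>\<^sup>+x. ennreal (\<bar>c x\<bar> powr r) \<partial>M)"
      using le fin by (intro enn2real_mono) (auto simp: less_top)
    then have "enn2real (\<integral>\<^sup>+x. ennreal (\<bar>a x\<bar> powr r) \<partial>M) powr (1 / r)
        \<le> enn2real (\<integral>\<^sup>+x. ennreal (\<bar>c x\<bar> powr r) \<partial>M) powr (1 / r)"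
      using \<open>1 \<le> r\<close> by (intro powr_mono2) auto
    then show ?thesis using False fin fin' by (simp add: Lq_norm_def Let_def ennreal_leI flip: r_def)
  qed
qed

section \<open>Decay of the excess of one solution over another\<close>

text \<open>Summing over a partition into \<open>N\<close> equal parts bounds the increment by \<open>c (t - s)\<^sup>2 / N\<close>.\<close>

lemma nonincreasing_if_increments_quadratic:
  fixes J :: "real \<Rightarrow> real"
  assumes c: "0 \<le> c" and J: "\<And>s t. a < s \<Longrightarrow> s < t \<Longrightarrow> t < b \<Longrightarrow> J t - J s \<le> c * (t - s)\<^sup>2"
    and st: "a < s" "s < t" "t < b"
  shows "J t \<le> J s"
proof -
  have "J t - J s \<le> c * (t - s)\<^sup>2 * inverse (real (Suc N))" for N
  proof -
    define d where "d = (t - s) / real (Suc N)"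
    have d: "0 < d" using st by (simp add: d_def)
    have end_eq: "s + real (Suc N) * d = t" by (simp add: d_def)
    have "J (s + real k * d) - J s \<le> real k * (c * d\<^sup>2)" if "k \<le> Suc N" for k
      using that
    proof (induction k)
      case 0 show ?case by simp
    next
      case (Suc k)
      have "real (Suc k) * d \<le> real (Suc N) * d" using Suc.prems d by (intro mult_right_mono) auto
      then have "s + real (Suc k) * d < b" using end_eq st by linarith
      moreover have "0 \<le> real k * d" using d by simp
      then have "a < s + real k * d" using st by linarith
      moreover have "s + real k * d < s + real (Suc k) * d" using d by simp
      ultimately have "J (s + real (Suc k) * d) - J (s + real k * d) \<le> c * ((s + real (Suc k) * d) - (s + real k * d))\<^sup>2"
        by (intro J)
      also have "(s + real (Suc k) * d) - (s + real k * d) = d" by (simp add: algebra_simps)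
      finally show ?case using Suc by (simp add: algebra_simps)
    qed
    from this[of "Suc N"] have "J t - J s \<le> real (Suc N) * (c * d\<^sup>2)" unfolding end_eq by simp
    also have "\<dots> = c * (t - s)\<^sup>2 * inverse (real (Suc N))"
    proof -
      have "n * (c * (x / n)\<^sup>2) = c * x\<^sup>2 * inverse n" if "0 < n" for n x :: real
        using that by (simp add: power2_eq_square field_simps)
      from this[of "real (Suc N)" "t - s"] show ?thesis by (simp add: d_def)
    qed
    finally show ?thesis .
  qed
  moreover have "(\<lambda>N. c * (t - s)\<^sup>2 * inverse (real (Suc N))) \<longlonglongrightarrow> c * (t - s)\<^sup>2 * 0"
    by (intro tendsto_intros LIMSEQ_inverse_real_of_nat)
  ultimately have "J t - J s \<le> c * (t - s)\<^sup>2 * 0" by (intro LIMSEQ_le_const) auto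
  then show ?thesis by simp
qed

definition clip :: "real \<Rightarrow> real \<Rightarrow> real \<Rightarrow> real" where
  "clip k d r = min (max (r - k) 0) d"

text \<open>The primitive of \<open>clip k d\<close>: quadratic on \<open>{k..k + d}\<close> and of slope \<open>d\<close> beyond. Divided by \<open>d\<close> it
differs from \<open>(r - k)\<^sup>+\<close> by at most \<open>d / 2\<close>.\<close>

definition huber :: "real \<Rightarrow> real \<Rightarrow> real \<Rightarrow> real" where
  "huber k d r = clip k d r * max (r - k) 0 - (clip k d r)\<^sup>2 / 2"

lemma clip_mono_nonexpansive:
  "0 \<le> d \<Longrightarrow> r \<le> s \<Longrightarrow> clip k d r \<le> clip k d s \<and> clip k d s - clip k d r \<le> s - r"
  by (auto simp: clip_def min_def max_def)

lemma clip_bounds: "0 \<le> d \<Longrightarrow> 0 \<le> clip k d r \<and> clip k d r \<le> d"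
  by (auto simp: clip_def)

lemma clip_measurable [measurable]: "clip k d \<in> borel_measurable borel"
  unfolding clip_def by measurable

lemma huber_convex:
  assumes d: "0 \<le> d"
  shows "huber k d r - huber k d s \<le> clip k d r * (r - s)"
proof -
  define A C where "A = max (r - k) 0" and "C = max (s - k) 0"
  define p q where "p = min A d" and "q = min C d"
  have nn: "0 \<le> A" "0 \<le> C" "0 \<le> p" "0 \<le> q" using d by (auto simp: A_def C_def p_def q_def)
  have "(p - q) * (C - (p + q) / 2) \<le> 0"
  proof (cases "q < p")
    case True
    then have "q = C" by (auto simp: p_def q_def)
    then have "C - (p + q) / 2 \<le> 0" using True by simp
    then show ?thesis using True by (simp add: mult_nonneg_nonpos)
  next
    case False
    then have "0 \<le> C - (p + q) / 2" using nn by (auto simp: q_def)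
    then show ?thesis using False by (simp add: mult_nonpos_nonneg)
  qed
  moreover have "(p - q) * (C - (p + q) / 2) = p * C - q * C - (p\<^sup>2 / 2 - q\<^sup>2 / 2)"
    by (simp add: power2_eq_square field_simps)
  ultimately have "p * A - p\<^sup>2 / 2 - (q * C - q\<^sup>2 / 2) \<le> p * (A - C)"
    unfolding right_diff_distrib by linarith
  also have "\<dots> \<le> p * (r - s)"
  proof (cases "r \<le> k")
    case True
    then have "p = 0" using d by (simp add: p_def A_def)
    then show ?thesis by simp
  next
    case False
    then show ?thesis using nn by (intro mult_left_mono) (auto simp: A_def C_def)
  qed
  finally show ?thesis by (simp add: huber_def clip_def A_def C_def p_def q_def)
qed

lemma huber_bounds:
  assumes "0 \<le> d"
  shows "d * max (r - k) 0 - d\<^sup>2 / 2 \<le> huber k d r" and "huber k d r \<le> d * max (r - k) 0" and "0 \<le> huber k d r"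
proof -
  define y where "y = max (r - k) 0"
  have y: "0 \<le> y" by (simp add: y_def)
  have sq: "0 \<le> (y - d)\<^sup>2" by simp
  have "d * y - d\<^sup>2 / 2 \<le> min y d * y - (min y d)\<^sup>2 / 2 \<and> min y d * y - (min y d)\<^sup>2 / 2 \<le> d * y \<and> 0 \<le> min y d * y - (min y d)\<^sup>2 / 2"
  proof (cases "y \<le> d")
    case True
    have "y * y \<le> d * y" using True y by (rule mult_right_mono)
    moreover have "0 \<le> d * y" using y assms by simp
    moreover have "0 \<le> y * y - 2 * (d * y) + d * d" using sq by (simp add: power2_eq_square algebra_simps)
    ultimately show ?thesis
      using zero_le_square[of y] unfolding min_absorb1[OF True] power2_eq_square by (intro conjI; linarith)
  next
    case False
    then have "d \<le> y" by simp
    then have "d * d \<le> d * y" using assms by (intro mult_left_mono) auto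
    then show ?thesis
      using \<open>d \<le> y\<close> zero_le_square[of d] unfolding min_absorb2[OF \<open>d \<le> y\<close>] power2_eq_square
      by (intro conjI; linarith)
  qed
  then show "d * max (r - k) 0 - d\<^sup>2 / 2 \<le> huber k d r" "huber k d r \<le> d * max (r - k) 0" "0 \<le> huber k d r"
    by (auto simp: huber_def clip_def y_def)
qed

lemma (in l2) nrm_mono:
  assumes "u \<in> L2 \<nu>" "w \<in> L2 \<nu>" "\<And>x. \<bar>u x\<bar> \<le> \<bar>w x\<bar>"
  shows "nrm u \<le> nrm w"
  unfolding nrm_eq[OF assms(1)] nrm_eq[OF assms(2)] L2_norm_def
  using assms by (intro real_sqrt_le_mono integral_mono) (auto simp: L2_def abs_le_square_iff[symmetric])

lemma (in l2) clip_L2: "u \<in> L2 \<nu> \<Longrightarrow> 0 \<le> d \<Longrightarrow> (\<lambda>x. clip k d (u x)) \<in> L2 \<nu>"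
  using clip_bounds[of d k] measurable_compose[OF L2_measurable clip_measurable]
  by (intro L2_bounded[where B = d]) (simp_all add: abs_le_iff)

context walk
begin

text \<open>Formally the integral of \<open>huber (u t)\<close> for \<open>u = v - w\<close> has the derivative \<open>\<langle>clip u, u'\<rangle>\<close>, and this is nonpositive by
accretivity, \<open>k \<ge> 0\<close> and \<open>f \<le> f'\<close>. In place of the chain rule, convexity bounds an increment
by \<open>\<langle>clip (u r), u r - u s\<rangle>\<close>. In this pairing the first factor is constant in time, so the weak derivative can be
inserted; replacing \<open>clip (u r)\<close> by \<open>clip (u \<tau>)\<close> costs \<open>O(r - s)\<close> because \<open>u\<close> is Lipschitz in
time. So increments are at most quadratic in \<open>r - s\<close>, which makes the function nonincreasing.\<close>

lemma excess_nonincreasing: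
  assumes lam: "0 < lam" and f: "f \<in> L2 \<nu>" and f': "f' \<in> L2 \<nu>" and ff': "AE x in \<nu>. f x \<le> f' x"
    and v: "strong_solution m \<nu> lam f v\<^sub>0 T v" and w: "strong_solution m \<nu> lam f' w\<^sub>0 T w"
    and k: "0 \<le> k" and t: "0 < t" "t < T"
  shows "(LINT x|\<nu>. max (v t x - w t x - k) 0) \<le> (LINT x|\<nu>. max (v 0 x - w 0 x - k) 0)"
proof -
  from v obtain v' where cv: "L2_continuous_on \<nu> {0..T} v" and Wv: "W11loc_deriv \<nu> T v v'"
    and iv: "AE t in lebesgue_on {0<..<T}. (\<lambda>x. lam * (v t x - f x) + v' t x) \<in> one_laplacian m \<nu> (v t)"
    unfolding strong_solution_def by blast
  from w obtain w' where cw: "L2_continuous_on \<nu> {0..T} w" and Ww: "W11loc_deriv \<nu> T w w'"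
    and iw: "AE t in lebesgue_on {0<..<T}. (\<lambda>x. lam * (w t x - f' x) + w' t x) \<in> one_laplacian m \<nu> (w t)"
    unfolding strong_solution_def by blast
  have vL: "v t \<in> L2 \<nu>" and wL: "w t \<in> L2 \<nu>" if "t \<in> {0..T}" for t
    using cv cw that by (auto simp: L2_continuous_on_def)
  define u where "u t = v t - w t" for t
  have uL: "u t \<in> L2 \<nu>" if "t \<in> {0..T}" for t
    unfolding u_def using vL[OF that] wL[OF that] by (rule L2_diff)
  have u_lim: "((\<lambda>s. nrm (u s - u t)) \<longlongrightarrow> 0) (at t within {0..T})" if "t \<in> {0..T}" for t
    unfolding u_def by (intro tendsto_nrm_diff L2_continuous_tendsto cv cw that)
  have "continuous_on {0..T} (\<lambda>t. nrm (u t))"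
    unfolding continuous_on_def using tendsto_nrm[OF u_lim] by blast
  then have "bounded ((\<lambda>t. nrm (u t)) ` {0..T})"
    by (intro compact_imp_bounded compact_continuous_image) auto
  then obtain U where "\<forall>t\<in>{0..T}. nrm (u t) \<le> U"
    unfolding bounded_iff by auto
  then have U: "\<And>t. t \<in> {0..T} \<Longrightarrow> nrm (u t) \<le> U" by blast
  define M where "M = 2 * C + lam * U + lam * nrm (f - f')"
  \<comment> \<open>All that is needed from the two inclusions.\<close>
  have good: "AE \<tau> in lebesgue_on {0<..<T}. v' \<tau> \<in> L2 \<nu> \<and> w' \<tau> \<in> L2 \<nu> \<and> nrm (v' \<tau> - w' \<tau>) \<le> M \<and>
      (\<forall>d\<ge>0. ip (\<lambda>x. clip k d (u \<tau> x)) (v' \<tau> - w' \<tau>) \<le> 0)"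
    using iv iw AE_space
  proof eventually_elim
    case (elim \<tau>)
    then have \<tau>: "\<tau> \<in> {0..T}" by simp
    define p q where "p = (\<lambda>x. - (lam * (v \<tau> x - f x) + v' \<tau> x))" and "q = (\<lambda>x. - (lam * (w \<tau> x - f' x) + w' \<tau> x))"
    have p: "p \<in> subdifferential \<nu> (\<lambda>w. enn2ereal (TV m \<nu> w)) (v \<tau>)"
      and q: "q \<in> subdifferential \<nu> (\<lambda>w. enn2ereal (TV m \<nu> w)) (w \<tau>)"
      using elim unfolding one_laplacian_def p_def q_def by auto
    have pL: "p \<in> L2 \<nu>" and qL: "q \<in> L2 \<nu>" using p q by (auto simp: subdifferential_TV_iff)
    have v'_eq: "v' \<tau> = - p - lam *\<^sub>R (v \<tau> - f)" and w'_eq: "w' \<tau> = - q - lam *\<^sub>R (w \<tau> - f')"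
      by (simp_all add: p_def q_def fun_eq_iff)
    have v'L: "v' \<tau> \<in> L2 \<nu>" unfolding v'_eq by (intro L2_diff L2_minus L2_scale pL vL \<tau> f)
    have w'L: "w' \<tau> \<in> L2 \<nu>" unfolding w'_eq by (intro L2_diff L2_minus L2_scale qL wL \<tau> f')
    have D: "v' \<tau> - w' \<tau> = - (p - q) - lam *\<^sub>R u \<tau> + lam *\<^sub>R (f - f')"
      unfolding v'_eq w'_eq u_def by (simp only: scaleR_diff_right) (simp add: fun_eq_iff)
    have "nrm (v' \<tau> - w' \<tau>) \<le> nrm (- (p - q) - lam *\<^sub>R u \<tau>) + nrm (lam *\<^sub>R (f - f'))"
      unfolding D by (rule nrm_triangle)
    also have "nrm (- (p - q) - lam *\<^sub>R u \<tau>) \<le> nrm (- (p - q)) + nrm (lam *\<^sub>R u \<tau>)" by (rule nrm_diff_le)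
    also have "nrm (- (p - q)) \<le> C + C"
      unfolding nrm_minus using nrm_diff_le[of p q] subgradient_bound[OF p] subgradient_bound[OF q] by linarith
    also have "nrm (lam *\<^sub>R u \<tau>) \<le> lam * U"
      using U[OF \<tau>] lam by (simp add: nrm_scale)
    also have "nrm (lam *\<^sub>R (f - f')) = lam * nrm (f - f')" unfolding nrm_scale using lam by simp
    finally have M: "nrm (v' \<tau> - w' \<tau>) \<le> M" unfolding M_def by linarith
    have neg: "ip (\<lambda>x. clip k d (u \<tau> x)) (v' \<tau> - w' \<tau>) \<le> 0" if d: "0 \<le> d" for d
    proof -
      define B where "B = (\<lambda>x. clip k d (u \<tau> x))"
      have BL: "B \<in> L2 \<nu>" unfolding B_def by (rule clip_L2[OF uL[OF \<tau>] d])
      have "0 \<le> ip (p - q) B"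
        by (rule subdifferential_accretive[OF p q BL, where b = "clip k d"])
           (use clip_mono_nonexpansive[OF d] in \<open>auto simp: B_def u_def\<close>)
      moreover have "0 \<le> ip (u \<tau>) B"
        unfolding ip_eq[OF uL[OF \<tau>] BL]
      proof (rule Bochner_Integration.integral_nonneg)
        show "0 \<le> u \<tau> x * B x" for x
          using k d by (cases "u \<tau> x \<le> k") (auto simp: B_def clip_def min_def max_def)
      qed
      moreover have "ip (f - f') B \<le> 0"
      proof -
        have "0 \<le> (LINT x|\<nu>. - ((f - f') x * B x))"
          using ff' clip_bounds[OF d, of k]
          by (intro integral_nonneg_AE) (auto simp: B_def mult_nonpos_nonneg elim!: eventually_mono)
        then show ?thesis by (simp add: ip_eq[OF L2_diff[OF f f'] BL])
      qed
      ultimately have "ip (v' \<tau> - w' \<tau>) B \<le> 0"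
        unfolding D ip_add_left ip_diff_left[of "- (p - q)"] ip_minus_left ip_scale_left
        using lam mult_nonneg_nonneg[of lam "ip (u \<tau>) B"] mult_nonneg_nonpos[of lam "ip (f - f') B"] by linarith
      then show ?thesis unfolding B_def ip_sym[of "v' \<tau> - w' \<tau>"] .
    qed
    show ?case using v'L w'L M neg by blast
  qed
  have T: "0 < T" using t by simp
  have M_nonneg: "0 \<le> M"
  proof -
    have "0 \<le> U" using U[of 0] T order_trans[OF nrm_nonneg] by auto
    then show ?thesis using lam by (simp add: M_def C_def)
  qed
  have bound: "ip h (u r - u s) \<le> L * (r - s)"
    if "0 < s" "s < r" "r < T" "h \<in> L2 \<nu>" "0 \<le> L"
      "AE \<tau> in lebesgue_on {0<..<T}. s < \<tau> \<longrightarrow> \<tau> < r \<longrightarrow> ip h (v' \<tau>) - ip h (w' \<tau>) \<le> L" for h r s L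
    unfolding u_def by (rule increment_le_if_W11loc_deriv_le[OF that(1-3) cv cw Wv Ww that(4-6)])
  have lip: "nrm (u r - u s) \<le> M * (r - s)" if sr: "0 < s" "s < r" "r < T" for r s
  proof -
    let ?h = "u r - u s"
    have hL: "?h \<in> L2 \<nu>" using sr by (intro L2_diff uL) auto
    have "ip ?h ?h \<le> (nrm ?h * M) * (r - s)"
    proof (rule bound[OF sr hL])
      show "AE \<tau> in lebesgue_on {0<..<T}. s < \<tau> \<longrightarrow> \<tau> < r \<longrightarrow> ip ?h (v' \<tau>) - ip ?h (w' \<tau>) \<le> nrm ?h * M"
        using good
      proof eventually_elim
        case (elim \<tau>)
        have "ip ?h (v' \<tau> - w' \<tau>) \<le> nrm ?h * nrm (v' \<tau> - w' \<tau>)" by (rule ip_le_nrm)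
        also have "\<dots> \<le> nrm ?h * M" using elim by (intro mult_left_mono) auto
        finally show ?case unfolding ip_diff_right by simp
      qed
    qed (use M_nonneg in simp)
    then have "nrm ?h * nrm ?h \<le> nrm ?h * (M * (r - s))"
      unfolding nrm_power2[symmetric] power2_eq_square by (simp add: mult.assoc)
    then show ?thesis
      using M_nonneg sr by (cases "nrm ?h = 0") (auto simp: less_le)
  qed
  have huber_le: "(LINT x|\<nu>. huber k d (u t x)) \<le> (LINT x|\<nu>. huber k d (u 0 x))" if d: "0 \<le> d" for d
  proof -
    define B where "B s = (\<lambda>x. clip k d (u s x))" for s
    define J where "J s = (LINT x|\<nu>. huber k d (u s x))" for s
    have BL: "B s \<in> L2 \<nu>" if "s \<in> {0..T}" for s unfolding B_def by (rule clip_L2[OF uL[OF that] d])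
    have huber_int: "integrable \<nu> (\<lambda>x. huber k d (u s x))" if s: "s \<in> {0..T}" for s
    proof (rule Bochner_Integration.integrable_bound)
      note [measurable] = L2_measurable[OF uL[OF s]]
      show "integrable \<nu> (\<lambda>x. d * u s x)" using L2_integrable[OF uL[OF s]] by simp
      show "(\<lambda>x. huber k d (u s x)) \<in> borel_measurable \<nu>" unfolding huber_def by measurable
      have "\<bar>huber k d (u s x)\<bar> \<le> \<bar>d * u s x\<bar>" for x
      proof -
        have "d * max (u s x - k) 0 \<le> d * \<bar>u s x\<bar>" using k d by (intro mult_left_mono) auto
        then show ?thesis using huber_bounds[OF d, of k "u s x"] d by (simp add: abs_mult)
      qed
      then show "AE x in \<nu>. norm (huber k d (u s x)) \<le> norm (d * u s x)" by simp
    qed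
    have J_diff: "J r - J s \<le> ip (B r) (u r - u s)" if "r \<in> {0..T}" "s \<in> {0..T}" for r s
    proof -
      have L: "u r - u s \<in> L2 \<nu>" using that by (intro L2_diff uL)
      have "J r - J s = (LINT x|\<nu>. huber k d (u r x) - huber k d (u s x))"
        unfolding J_def using huber_int that by simp
      also have "\<dots> \<le> (LINT x|\<nu>. B r x * (u r - u s) x)"
        using huber_convex[OF d, of k] huber_int that L2_integrable_mult[OF BL L] that
        by (intro integral_mono) (auto simp: B_def)
      finally show ?thesis by (simp add: ip_eq[OF BL[OF that(1)] L])
    qed
    have step: "J r - J s \<le> M\<^sup>2 * (r - s)\<^sup>2" if sr: "0 < s" "s < r" "r < T" for r s
    proof -
      have r: "r \<in> {0..T}" "s \<in> {0..T}" using sr by auto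
      have "ip (B r) (u r - u s) \<le> (M * (r - s) * M) * (r - s)"
      proof (rule bound[OF sr BL[OF r(1)]])
        show "AE \<tau> in lebesgue_on {0<..<T}. s < \<tau> \<longrightarrow> \<tau> < r \<longrightarrow> ip (B r) (v' \<tau>) - ip (B r) (w' \<tau>) \<le> M * (r - s) * M"
          using good
        proof eventually_elim
          case (elim \<tau>)
          show ?case
          proof (intro impI)
            assume \<tau>: "s < \<tau>" "\<tau> < r"
            then have \<tau>': "\<tau> \<in> {0..T}" using sr by auto
            have clip_lip: "\<bar>clip k d a - clip k d c\<bar> \<le> \<bar>a - c\<bar>" for a c
              using clip_mono_nonexpansive[OF d, of a c k] clip_mono_nonexpansive[OF d, of c a k] by linarith
            have "nrm (B r - B \<tau>) \<le> nrm (u r - u \<tau>)"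
              by (rule nrm_mono) (use r \<tau>' BL uL clip_lip in \<open>auto simp: B_def intro!: L2_diff\<close>)
            also have "\<dots> \<le> M * (r - \<tau>)" using lip[of \<tau> r] \<tau> sr by auto
            also have "\<dots> \<le> M * (r - s)" using \<tau> M_nonneg by (intro mult_left_mono) auto
            finally have 1: "nrm (B r - B \<tau>) \<le> M * (r - s)" .
            have "ip (B r) (v' \<tau> - w' \<tau>) = ip (B r - B \<tau>) (v' \<tau> - w' \<tau>) + ip (B \<tau>) (v' \<tau> - w' \<tau>)"
              by (simp only: ip_diff_left)
            also have "\<dots> \<le> nrm (B r - B \<tau>) * nrm (v' \<tau> - w' \<tau>) + 0"
            proof (rule add_mono[OF ip_le_nrm])
              show "ip (B \<tau>) (v' \<tau> - w' \<tau>) \<le> 0" using elim d unfolding B_def by blast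
            qed
            also have "\<dots> \<le> M * (r - s) * M + 0"
              using 1 elim M_nonneg sr by (intro add_mono mult_mono) auto
            finally show "ip (B r) (v' \<tau>) - ip (B r) (w' \<tau>) \<le> M * (r - s) * M" unfolding ip_diff_right by simp
          qed
        qed
      qed (use M_nonneg sr in simp)
      then show ?thesis using J_diff[OF r] by (simp add: power2_eq_square mult_ac)
    qed
    have mono: "J t \<le> J s" if "0 < s" "s < t" for s
      by (rule nonincreasing_if_increments_quadratic[OF _ step, of 0 T]) (use that t in auto)
    define E where "E = nrm (\<lambda>_. d)"
    have constL: "(\<lambda>_. d) \<in> L2 \<nu>" by (rule L2_bounded[where B = d]) (use d in auto)
    have "J t \<le> J 0 + e" if e: "0 < e" for e
    proof -
      have E: "0 \<le> E" by (simp add: E_def)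
      have "\<forall>\<^sub>F s in at 0 within {0..T}. nrm (u s - u 0) < e / (E + 1)"
        using u_lim[of 0] T e E by (intro order_tendstoD) auto
      then obtain \<rho> where \<rho>: "0 < \<rho>" "\<And>s. s \<in> {0..T} \<Longrightarrow> s \<noteq> 0 \<Longrightarrow> dist s 0 < \<rho> \<Longrightarrow> nrm (u s - u 0) < e / (E + 1)"
        unfolding eventually_at by blast
      \<comment> \<open>A time so close to 0 that \<open>u s\<close> is close to \<open>u 0\<close>; this extends the monotonicity to the initial time.\<close>
      define s where "s = min (\<rho> / 2) (t / 2)"
      have s: "0 < s" "s < t" "s \<in> {0..T}" "dist s 0 < \<rho>" using \<rho>(1) t by (auto simp: s_def dist_real_def min_def)
      have "J t \<le> J s" by (rule mono[OF s(1,2)])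
      also have "J s \<le> J 0 + ip (B s) (u s - u 0)" using J_diff[OF s(3), of 0] T by simp
      also have "ip (B s) (u s - u 0) \<le> E * (e / (E + 1))"
      proof -
        have "nrm (B s) \<le> E" unfolding E_def
          by (rule nrm_mono[OF BL[OF s(3)] constL]) (use clip_bounds[OF d, of k] d in \<open>auto simp: B_def\<close>)
        then have "nrm (B s) * nrm (u s - u 0) \<le> E * (e / (E + 1))"
          using \<rho>(2)[OF s(3) _ s(4)] s(1) E e by (intro mult_mono) auto
        then show ?thesis using ip_le_nrm[of "B s" "u s - u 0"] by linarith
      qed
      also have "\<dots> \<le> e" using E e by (simp add: field_simps)
      finally show ?thesis by simp
    qed
    then have "J t \<le> J 0" by (rule field_le_epsilon)
    then show ?thesis by (simp add: J_def)
  qed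
  have t': "t \<in> {0..T}" "0 \<in> {0..T}" using t by auto
  have max_int: "integrable \<nu> (\<lambda>x. max (u s x - k) 0)" if "s \<in> {0..T}" for s
    using L2_integrable[OF uL[OF that]] by (intro integrable_max) auto
  define N where "N = measure \<nu> (space \<nu>)"
  have "(LINT x|\<nu>. max (u t x - k) 0) \<le> (LINT x|\<nu>. max (u 0 x - k) 0) + e" if e: "0 < e" for e
  proof -
    \<comment> \<open>The width of the quadratic part of the Huber function, chosen so that its total error is below \<open>e\<close>.\<close>
    define d where "d = e / (N + 1)"
    have N: "0 \<le> N" by (simp add: N_def)
    have d: "0 < d" using e N by (simp add: d_def)
    have hint: "integrable \<nu> (\<lambda>x. huber k d (u s x))" if s: "s \<in> {0..T}" for s
    proof (rule Bochner_Integration.integrable_bound)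
      note [measurable] = L2_measurable[OF uL[OF s]]
      show "integrable \<nu> (\<lambda>x. d * max (u s x - k) 0)" using max_int[OF s] by simp
      show "(\<lambda>x. huber k d (u s x)) \<in> borel_measurable \<nu>" unfolding huber_def by measurable
      show "AE x in \<nu>. norm (huber k d (u s x)) \<le> norm (d * max (u s x - k) 0)"
        using huber_bounds(2,3)[of d k] d by auto
    qed
    have "d * (LINT x|\<nu>. max (u t x - k) 0) - d\<^sup>2 / 2 * N = (LINT x|\<nu>. d * max (u t x - k) 0 - d\<^sup>2 / 2)"
      using max_int[OF t'(1)] by (simp add: N_def)
    also have "\<dots> \<le> (LINT x|\<nu>. huber k d (u t x))"
      using max_int[OF t'(1)] hint[OF t'(1)] huber_bounds(1)[of d] d by (intro integral_mono) auto
    also have "\<dots> \<le> (LINT x|\<nu>. huber k d (u 0 x))" using d by (intro huber_le) simp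
    also have "\<dots> \<le> (LINT x|\<nu>. d * max (u 0 x - k) 0)"
      using max_int[OF t'(2)] hint[OF t'(2)] huber_bounds(2)[of d] d by (intro integral_mono) auto
    finally have "d * (LINT x|\<nu>. max (u t x - k) 0) \<le> d * ((LINT x|\<nu>. max (u 0 x - k) 0) + d / 2 * N)"
      by (simp add: algebra_simps power2_eq_square)
    then have "(LINT x|\<nu>. max (u t x - k) 0) \<le> (LINT x|\<nu>. max (u 0 x - k) 0) + d / 2 * N"
      using d by simp
    also have "d / 2 * N \<le> e"
    proof -
      have "d * N \<le> d * (N + 1)" using d by simp
      also have "\<dots> = e" using N by (simp add: d_def)
      finally show ?thesis using e by simp
    qed
    finally show ?thesis by simp
  qed
  then have "(LINT x|\<nu>. max (u t x - k) 0) \<le> (LINT x|\<nu>. max (u 0 x - k) 0)" by (rule field_le_epsilon)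
  then show ?thesis by (simp add: u_def)
qed

end

section \<open>Existence, contraction and uniqueness\<close>

context walk
begin

lemma strong_solution_exists:
  assumes lam: "0 < lam" and f: "f \<in> L2 \<nu>" and v\<^sub>0: "v\<^sub>0 \<in> L2 \<nu>"
  shows "\<exists>v. strong_solution m \<nu> lam f v\<^sub>0 T v"
proof -
  obtain v v' K where v: "\<And>t. v t \<in> L2 \<nu>" and v': "\<And>t. v' t \<in> L2 \<nu>" and init: "nrm (v 0 - v\<^sub>0) = 0"
    and lip: "\<And>t h. 0 \<le> t \<Longrightarrow> 0 \<le> h \<Longrightarrow> nrm (v (t + h) - v t) \<le> K * h"
    and deriv: "\<And>t. 0 \<le> t \<Longrightarrow> ((\<lambda>h. nrm ((1 / h) *\<^sub>R (v (t + h) - v t) - v' t)) \<longlongrightarrow> 0) (at_right 0)"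
    and incl: "\<And>t. 0 \<le> t \<Longrightarrow> (\<lambda>x. lam * (v t x - f x) + v' t x) \<in> one_laplacian m \<nu> (v t)"
    using gradient_flow_exists[OF lam f v\<^sub>0] by blast
  have cont: "L2_continuous_on \<nu> {0..T} v"
    unfolding L2_continuous_on_def
  proof (intro ballI conjI v)
    fix t assume t: "t \<in> {0..T}"
    have le: "nrm (v s - v t) \<le> K * \<bar>s - t\<bar>" if "s \<in> {0..T}" for s
      using lip[of t "s - t"] lip[of s "t - s"] t that nrm_diff_commute[of "v s" "v t"]
      by (cases "s \<le> t") auto
    have "((\<lambda>s. K * \<bar>s - t\<bar>) \<longlongrightarrow> K * \<bar>t - t\<bar>) (at t within {0..T})" by (intro tendsto_intros)
    then have "((\<lambda>s. K * \<bar>s - t\<bar>) \<longlongrightarrow> 0) (at t within {0..T})" by simp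
    then show "((\<lambda>s. L2_norm \<nu> (\<lambda>x. v s x - v t x)) \<longlongrightarrow> 0) (at t within {0..T})"
      unfolding L2_norm_diff[OF v v]
      by (rule Lim_null_comparison[rotated]) (use le in \<open>auto simp: eventually_at_filter\<close>)
  qed
  have "AE x in \<nu>. (v 0 - v\<^sub>0) x = 0"
    using init nrm_0_iff_AE[OF L2_diff[OF v v\<^sub>0]] by blast
  then have "AE x in \<nu>. v 0 x = v\<^sub>0 x" by eventually_elim simp
  moreover have "W11loc_deriv \<nu> T v v'" by (rule W11loc_deriv_right_derivative[OF v v' lip deriv])
  moreover have "AE t in lebesgue_on {0<..<T}. (\<lambda>x. lam * (v t x - f x) + v' t x) \<in> one_laplacian m \<nu> (v t)"
    by (rule AE_I2) (use incl in auto)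
  ultimately show ?thesis using cont unfolding strong_solution_def by blast
qed

lemma strong_solution_L2:
  "strong_solution m \<nu> lam f v\<^sub>0 T v \<Longrightarrow> t \<in> {0..T} \<Longrightarrow> v t \<in> L2 \<nu>"
  by (simp add: strong_solution_def L2_continuous_on_def)

lemma excess_le_initial:
  assumes lam: "0 < lam" and f: "f \<in> L2 \<nu>" and f': "f' \<in> L2 \<nu>" and ff': "AE x in \<nu>. f x \<le> f' x"
    and v: "strong_solution m \<nu> lam f v\<^sub>0 T v" and w: "strong_solution m \<nu> lam f' w\<^sub>0 T w"
    and v\<^sub>0: "v\<^sub>0 \<in> L2 \<nu>" and w\<^sub>0: "w\<^sub>0 \<in> L2 \<nu>"
    and k: "0 \<le> k" and t: "0 < t" "t < T"
  shows "(\<integral>\<^sup>+x. ennreal (max (max (v t x - w t x) 0 - k) 0) \<partial>\<nu>)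
    \<le> (\<integral>\<^sup>+x. ennreal (max (max (v\<^sub>0 x - w\<^sub>0 x) 0 - k) 0) \<partial>\<nu>)"
proof -
  have max_max: "max (max r 0 - k) 0 = max (r - k) 0" for r :: real using k by auto
  have int: "integrable \<nu> (\<lambda>x. max (a x - b x - k) 0)" if "a \<in> L2 \<nu>" "b \<in> L2 \<nu>" for a b
    using L2_integrable[OF that(1)] L2_integrable[OF that(2)] by (intro integrable_max) auto
  have tT: "t \<in> {0..T}" "0 \<in> {0..T}" using t by auto
  have "(\<integral>\<^sup>+x. ennreal (max (v t x - w t x - k) 0) \<partial>\<nu>) = ennreal (LINT x|\<nu>. max (v t x - w t x - k) 0)"
    by (rule nn_integral_eq_integral[OF int]) (use strong_solution_L2[OF v tT(1)] strong_solution_L2[OF w tT(1)] in auto)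
  also have "\<dots> \<le> ennreal (LINT x|\<nu>. max (v 0 x - w 0 x - k) 0)"
    by (intro ennreal_leI excess_nonincreasing[OF lam f f' ff' v w k t])
  also have "\<dots> = (\<integral>\<^sup>+x. ennreal (max (v 0 x - w 0 x - k) 0) \<partial>\<nu>)"
    by (rule nn_integral_eq_integral[OF int, symmetric]) (use strong_solution_L2[OF v tT(2)] strong_solution_L2[OF w tT(2)] in auto)
  also have "\<dots> = (\<integral>\<^sup>+x. ennreal (max (v\<^sub>0 x - w\<^sub>0 x - k) 0) \<partial>\<nu>)"
  proof (rule nn_integral_cong_AE)
    have "AE x in \<nu>. v 0 x = v\<^sub>0 x" "AE x in \<nu>. w 0 x = w\<^sub>0 x" using v w by (auto simp: strong_solution_def)
    then show "AE x in \<nu>. ennreal (max (v 0 x - w 0 x - k) 0) = ennreal (max (v\<^sub>0 x - w\<^sub>0 x - k) 0)"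
      by eventually_elim simp
  qed
  finally show ?thesis by (simp add: max_max)
qed

lemma strong_solution_contraction:
  assumes lam: "0 < lam" and f: "f \<in> L2 \<nu>" and f': "f' \<in> L2 \<nu>" and ff': "AE x in \<nu>. f x \<le> f' x"
    and v: "strong_solution m \<nu> lam f v\<^sub>0 T v" and w: "strong_solution m \<nu> lam f' w\<^sub>0 T w"
    and v\<^sub>0: "v\<^sub>0 \<in> L2 \<nu>" and w\<^sub>0: "w\<^sub>0 \<in> L2 \<nu>" and q: "1 \<le> q" and t: "0 < t" "t < T"
  shows "Lq_norm \<nu> q (\<lambda>x. max (v t x - w t x) 0) \<le> Lq_norm \<nu> q (\<lambda>x. max (v\<^sub>0 x - w\<^sub>0 x) 0)"
proof (rule Lq_norm_mono_excess[OF _ _ _ _ _ q])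
  have tT: "t \<in> {0..T}" using t by auto
  note [measurable] = L2_measurable[OF strong_solution_L2[OF v tT]] L2_measurable[OF strong_solution_L2[OF w tT]]
    L2_measurable[OF v\<^sub>0] L2_measurable[OF w\<^sub>0]
  show "(\<lambda>x. max (v t x - w t x) 0) \<in> borel_measurable \<nu>" "(\<lambda>x. max (v\<^sub>0 x - w\<^sub>0 x) 0) \<in> borel_measurable \<nu>"
    by measurable
qed (use excess_le_initial[OF lam f f' ff' v w v\<^sub>0 w\<^sub>0 _ t] in auto)

text \<open>At interior times uniqueness is the contraction with equal data in both orders; at \<open>T\<close> it follows by continuity.\<close>

lemma strong_solution_unique:
  assumes lam: "0 < lam" and f: "f \<in> L2 \<nu>" and v\<^sub>0: "v\<^sub>0 \<in> L2 \<nu>" and T: "0 < T"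
    and v: "strong_solution m \<nu> lam f v\<^sub>0 T v" and w: "strong_solution m \<nu> lam f v\<^sub>0 T w"
    and t: "t \<in> {0..T}"
  shows "AE x in \<nu>. w t x = v t x"
proof -
  have L: "v s - w s \<in> L2 \<nu>" if "s \<in> {0..T}" for s
    using strong_solution_L2[OF v that] strong_solution_L2[OF w that] by (rule L2_diff)
  have le: "AE x in \<nu>. v s x \<le> w s x"
    if v: "strong_solution m \<nu> lam f v\<^sub>0 T v" and w: "strong_solution m \<nu> lam f v\<^sub>0 T w" and s: "0 < s" "s < T" for v w s
  proof -
    have sT: "s \<in> {0..T}" using s by auto
    note [measurable] = L2_measurable[OF strong_solution_L2[OF v sT]] L2_measurable[OF strong_solution_L2[OF w sT]]
    have "(\<integral>\<^sup>+x. ennreal (max (v s x - w s x) 0) \<partial>\<nu>) = 0"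
      using excess_le_initial[OF lam f f _ v w v\<^sub>0 v\<^sub>0 order_refl s] by simp
    then have "AE x in \<nu>. ennreal (max (v s x - w s x) 0) = 0"
      by (subst (asm) nn_integral_0_iff_AE) auto
    then show ?thesis by eventually_elim (simp add: ennreal_eq_0_iff)
  qed
  have zero: "nrm (v s - w s) = 0" if s: "0 < s" "s < T" for s
  proof -
    have "s \<in> {0..T}" using s by auto
    from le[OF v w s] le[OF w v s] have "AE x in \<nu>. (v s - w s) x = 0" by eventually_elim simp
    then show ?thesis using nrm_0_iff_AE[OF L[OF \<open>s \<in> {0..T}\<close>]] by blast
  qed
  consider "t = 0" | "0 < t" "t < T" | "t = T" using t by fastforce
  then have "AE x in \<nu>. (v t - w t) x = 0"
  proof cases
    case 1
    have "AE x in \<nu>. v 0 x = v\<^sub>0 x" "AE x in \<nu>. w 0 x = v\<^sub>0 x" using v w by (auto simp: strong_solution_def)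
    then show ?thesis unfolding 1 by eventually_elim simp
  next
    case 2
    then show ?thesis using zero nrm_0_iff_AE[OF L[OF t]] by blast
  next
    case 3
    have "nrm (v T - w T) = 0"
    proof (rule ccontr)
      assume "nrm (v T - w T) \<noteq> 0"
      then have pos: "0 < nrm (v T - w T)" by (simp add: less_le)
      have "((\<lambda>s. nrm ((v s - w s) - (v T - w T))) \<longlongrightarrow> 0) (at T within {0..T})"
        using v w T by (intro tendsto_nrm_diff L2_continuous_tendsto) (auto simp: strong_solution_def)
      from order_tendstoD(1)[OF tendsto_nrm[OF this] pos]
      obtain \<rho> where \<rho>: "0 < \<rho>" "\<And>s. s \<in> {0..T} \<Longrightarrow> s \<noteq> T \<Longrightarrow> dist s T < \<rho> \<Longrightarrow> 0 < nrm (v s - w s)"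
        unfolding eventually_at by blast
      define s where "s = max (T - \<rho> / 2) (T / 2)"
      have "0 < s" "s < T" "dist s T < \<rho>" using \<rho>(1) T by (auto simp: s_def dist_real_def max_def)
      then show False using \<rho>(2)[of s] zero[of s] by auto
    qed
    then show ?thesis using nrm_0_iff_AE[OF L[OF t]] 3 by blast
  qed
  then show ?thesis by eventually_elim simp
qed

end

theorem theorem2p10:
  fixes m :: "'a::polish_space \<Rightarrow> 'a measure"
    and \<nu> :: "'a measure"
    and lam :: real
    and f :: "'a \<Rightarrow> real"
  assumes "random_walk m"
    and "finite_radon_measure \<nu>"
    and "emeasure \<nu> UNIV \<noteq> 0"
    and "reversible m \<nu>"
    and "ergodic m \<nu>"
    and "0 < lam"
    and "f \<in> L2 \<nu>"
  shows "(\<forall>v\<^sub>0\<in>L2 \<nu>. \<forall>T>0.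
            \<exists>v. strong_solution m \<nu> lam f v\<^sub>0 T v \<and>
                (\<forall>w. strong_solution m \<nu> lam f v\<^sub>0 T w \<longrightarrow>
                     (\<forall>t\<in>{0..T}. AE x in \<nu>. w t x = v t x))) \<and>
         (\<forall>f'\<in>L2 \<nu>. \<forall>v\<^sub>0\<in>L2 \<nu>. \<forall>w\<^sub>0\<in>L2 \<nu>. \<forall>T>0. \<forall>v w. \<forall>q::ennreal.
            (AE x in \<nu>. f x \<le> f' x) \<longrightarrow>
            strong_solution m \<nu> lam f v\<^sub>0 T v \<longrightarrow>
            strong_solution m \<nu> lam f' w\<^sub>0 T w \<longrightarrow>
            1 \<le> q \<longrightarrow>
            (\<forall>t. 0 < t \<and> t < T \<longrightarrow>
               Lq_norm \<nu> q (\<lambda>x. max (v t x - w t x) 0)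
                 \<le> Lq_norm \<nu> q (\<lambda>x. max (v\<^sub>0 x - w\<^sub>0 x) 0)))"
proof -
  interpret walk m \<nu> using assms by unfold_locales
  show ?thesis
  proof (intro conjI ballI allI impI)
    fix v\<^sub>0 and T :: real assume v\<^sub>0: "v\<^sub>0 \<in> L2 \<nu>" and T: "0 < T"
    obtain v where v: "strong_solution m \<nu> lam f v\<^sub>0 T v"
      using strong_solution_exists[OF assms(6,7) v\<^sub>0] by blast
    then show "\<exists>v. strong_solution m \<nu> lam f v\<^sub>0 T v \<and>
        (\<forall>w. strong_solution m \<nu> lam f v\<^sub>0 T w \<longrightarrow> (\<forall>t\<in>{0..T}. AE x in \<nu>. w t x = v t x))"
      using strong_solution_unique[OF assms(6,7) v\<^sub>0 T v] by blast
  qed (use strong_solution_contraction[OF assms(6,7)] in blast)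
qed

end
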